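(* Let $R$ be a denumerable relational structure whose age $\mathcal{A}=\mathcal{A}(R)$ is inexhaustible, and let $k$ be a non-negative integer. If the height $H(\mathcal{A})$ is defined and $H(\mathcal{A})\leq \omega(k+1)$, then $\varphi_R(n)\leq \binom{n+k}{k}$ for every non-negative integer $n$.
   Context: A relational structure is $R=(E,(\rho_i)_{i\in I})$ where $E$ is a set and each $\rho_i\subseteq E^{m_i}$ for a positive integer $m_i$; $\mu=(m_i)_{i\in I}$ is its signature. For $A\subseteq E$, $R_{\restriction A}=(A,(\rho_i\cap A^{m_i})_{i\in I})$. Isomorphisms are bijections preserving and reflecting every $\rho_i$; $R$ embeds into $R'$ if $R$ is isomorphic to a restriction of $R'$. The age $\mathcal{A}(R)$ is the set of isomorphism types of restrictions of $R$ to finite subsets of $E$, ordered by embeddability; it is an ideal (non-empty, down-closed, up-directed subset) of the poset $\Omega_\mu$ of isomorphism types of finite structures of signature $\mu$ ordered by embeddability. The profile $\varphi_R(n)$ is the number of isomorphism types of restrictions $R_{\restriction A}$ with $|A|=n$. An age is inexhaustible if any two of its members can be embedded into a third member with disjoint images (equivalently, the kernel $K(R)=\{x\in E:\mathcal{A}(R_{\restriction E\setminus\{x\}})\neq \mathcal{A}(R)\}$ is empty). Height: in a poset, $h(x)=\sup\{h(y)+1: y<x\}$ (defined when $\{y:y\le x\}$ is well-founded). For an age $\mathcal{A}$, $H(\mathcal{A})$ is the height of $\mathcal{A}$ in the poset, ordered by inclusion, of all ideals of $\Omega_\mu$ contained in $\mathcal{A}$. *)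

theory Defs
  imports Complex_Main "HOL-Library.Extended_Nat" "HOL-Library.Countable_Set"
begin

unbundle cardinal_syntax

record 'i signature =
  idx :: "'i set"
  arity :: "'i \<Rightarrow> nat"

definition valid_signature :: "'i signature \<Rightarrow> bool" where
  "valid_signature \<mu> \<longleftrightarrow> (\<forall>i\<in>idx \<mu>. 0 < arity \<mu> i)"

definition tuples :: "'a set \<Rightarrow> nat \<Rightarrow> 'a list set" where
  "tuples E m = {xs. length xs = m \<and> set xs \<subseteq> E}"

text \<open>Values \<open>rels R i\<close> at indices \<open>i\<close> outside \<open>idx \<mu>\<close> are irrelevant: no notion below
  depends on them.\<close>

record ('a, 'i) relstruct =
  base :: "'a set"
  rels :: "'i \<Rightarrow> 'a list set"

definition is_structure :: "'i signature \<Rightarrow> ('a, 'i) relstruct \<Rightarrow> bool" where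
  "is_structure \<mu> R \<longleftrightarrow> (\<forall>i\<in>idx \<mu>. rels R i \<subseteq> tuples (base R) (arity \<mu> i))"

definition restriction ::
  "'i signature \<Rightarrow> ('a, 'i) relstruct \<Rightarrow> 'a set \<Rightarrow> ('a, 'i) relstruct" where
  "restriction \<mu> R A = \<lparr>base = A, rels = (\<lambda>i. rels R i \<inter> tuples A (arity \<mu> i))\<rparr>"

definition is_iso ::
  "'i signature \<Rightarrow> ('a, 'i) relstruct \<Rightarrow> ('b, 'i) relstruct \<Rightarrow> ('a \<Rightarrow> 'b) \<Rightarrow> bool" where
  "is_iso \<mu> R S f \<longleftrightarrow> bij_betw f (base R) (base S) \<and>
     (\<forall>i\<in>idx \<mu>. \<forall>xs\<in>tuples (base R) (arity \<mu> i). xs \<in> rels R i \<longleftrightarrow> map f xs \<in> rels S i)"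

definition isomorphic ::
  "'i signature \<Rightarrow> ('a, 'i) relstruct \<Rightarrow> ('b, 'i) relstruct \<Rightarrow> bool" where
  "isomorphic \<mu> R S \<longleftrightarrow> (\<exists>f. is_iso \<mu> R S f)"

definition embeds ::
  "'i signature \<Rightarrow> ('a, 'i) relstruct \<Rightarrow> ('b, 'i) relstruct \<Rightarrow> bool" where
  "embeds \<mu> R S \<longleftrightarrow> (\<exists>A\<subseteq>base S. isomorphic \<mu> R (restriction \<mu> S A))"

text \<open>Every finite structure has an isomorphic copy whose base is a finite set of natural
  numbers, so its isomorphism type is represented by the class of all such copies.\<close>

type_synonym 'i iso_type = "(nat, 'i) relstruct set"

definition finite_structures :: "'i signature \<Rightarrow> (nat, 'i) relstruct set" where
  "finite_structures \<mu> = {S. is_structure \<mu> S \<and> finite (base S)}"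

definition type_of :: "'i signature \<Rightarrow> ('a, 'i) relstruct \<Rightarrow> 'i iso_type" where
  "type_of \<mu> R = {S \<in> finite_structures \<mu>. isomorphic \<mu> R S}"

definition Omega :: "'i signature \<Rightarrow> 'i iso_type set" where
  "Omega \<mu> = type_of \<mu> ` finite_structures \<mu>"

definition type_le :: "'i signature \<Rightarrow> 'i iso_type \<Rightarrow> 'i iso_type \<Rightarrow> bool" where
  "type_le \<mu> s t \<longleftrightarrow> (\<exists>S\<in>s. \<exists>T\<in>t. embeds \<mu> S T)"

definition is_ideal :: "'i signature \<Rightarrow> 'i iso_type set \<Rightarrow> bool" where
  "is_ideal \<mu> I \<longleftrightarrow> I \<subseteq> Omega \<mu> \<and> I \<noteq> {} \<and>
     (\<forall>t\<in>I. \<forall>s\<in>Omega \<mu>. type_le \<mu> s t \<longrightarrow> s \<in> I) \<and>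
     (\<forall>s\<in>I. \<forall>t\<in>I. \<exists>u\<in>I. type_le \<mu> s u \<and> type_le \<mu> t u)"

definition age :: "'i signature \<Rightarrow> ('a, 'i) relstruct \<Rightarrow> 'i iso_type set" where
  "age \<mu> R = {type_of \<mu> (restriction \<mu> R A) | A. A \<subseteq> base R \<and> finite A}"

text \<open>If \<open>idx \<mu>\<close> is infinite, there may be infinitely many isomorphism types on \<open>n\<close> elements.\<close>

definition profile :: "'i signature \<Rightarrow> ('a, 'i) relstruct \<Rightarrow> nat \<Rightarrow> enat" where
  "profile \<mu> R n =
     (let T = {type_of \<mu> (restriction \<mu> R A) | A. A \<subseteq> base R \<and> finite A \<and> card A = n}
      in if finite T then enat (card T) else \<infinity>)"

definition inexhaustible :: "'i signature \<Rightarrow> 'i iso_type set \<Rightarrow> bool" where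
  "inexhaustible \<mu> \<A> \<longleftrightarrow>
     (\<forall>s\<in>\<A>. \<forall>t\<in>\<A>. \<exists>u\<in>\<A>. \<exists>S\<in>s. \<exists>T\<in>t. \<exists>U\<in>u. \<exists>A B.
        A \<subseteq> base U \<and> B \<subseteq> base U \<and> A \<inter> B = {} \<and>
        isomorphic \<mu> S (restriction \<mu> U A) \<and> isomorphic \<mu> T (restriction \<mu> U B))"

text \<open>An ordinal is given by a (reflexive) well-order, compared up to isomorphism by the
  library relations \<open>=o\<close>, \<open>\<le>o\<close> and \<open><o\<close>. The supremum of the ordinals \<open>\<alpha> + 1\<close>, for \<open>\<alpha>\<close> in a set
  \<open>X\<close>, is the least ordinal strictly above all members of \<open>X\<close>. Lemma \<open>least_strict_upper_bound_ex\<close>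
  shows that it can be realised on the same (infinite) type when \<open>X\<close> is indexed by that type.\<close>

definition is_sup_succ :: "'b rel set \<Rightarrow> 'b rel \<Rightarrow> bool" where
  "is_sup_succ X W \<longleftrightarrow> Well_order W \<and> (\<forall>V\<in>X. V <o W) \<and>
     (\<forall>W'::'b rel. Well_order W' \<and> (\<forall>V\<in>X. V <o W') \<longrightarrow> W \<le>o W')"

definition sup_succ :: "'b rel set \<Rightarrow> 'b rel" where
  "sup_succ X = (SOME W. is_sup_succ X W)"

text \<open>\<open>r\<close> is the strict order of the poset, assumed well-founded.\<close>

definition height :: "'b rel \<Rightarrow> 'b \<Rightarrow> 'b rel" where
  "height r = wfrec r (\<lambda>h x. sup_succ (h ` {y. (y, x) \<in> r}))"

lemma bounding_well_order_ex:
  fixes h :: "'b \<Rightarrow> 'b rel"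
  assumes inf: "infinite (UNIV :: 'b set)" and wo: "\<And>y. y \<in> Y \<Longrightarrow> Well_order (h y)"
  shows "\<exists>W::'b rel. Well_order W \<and> (\<forall>y\<in>Y. h y <o W)"
proof -
  let ?U = "UNIV :: 'b set"
  let ?C = "cardSuc |?U|"
  let ?P = "\<lambda>i. Restr ?C (underS ?C i)"
  have U: "Card_order |?U|" by (rule card_of_Card_order)
  have C: "Card_order ?C" "Well_order ?C"
    using cardSuc_Card_order[OF U] unfolding card_order_on_def by auto
  have CI: "infinite (Field ?C)"
    using cardSuc_finite[OF U] inf by (simp add: Field_card_of)
  have P: "Well_order (?P i)" for i by (rule Well_order_Restr[OF C(2)])
  have small: "r <o ?C" if r: "Well_order r" for r :: "'b rel"
  proof (rule ccontr)
    assume "\<not> r <o ?C"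
    then have "?C \<le>o r" using r C(2) not_ordLess_iff_ordLeq by blast
    then have "|Field ?C| \<le>o |Field r|" by (rule card_of_mono2)
    moreover have "|Field r| \<le>o |?U|" by (simp add: card_of_mono1)
    ultimately have "?C \<le>o |?U|"
      using card_of_Field_ordIso[OF C(1)] ordIso_symmetric ordIso_ordLeq_trans ordLeq_transitive
      by blast
    then show False
      using cardSuc_greater[OF U] not_ordLess_ordLeq by blast
  qed
  have fil: "wo_rel.ofilter ?C (underS ?C i)" for i
    using C(2) by (simp add: wo_rel.underS_ofilter wo_rel_def)
  have incr: "underS ?C i \<subseteq> underS ?C j" if "(i, j) \<in> ?C" for i j
    using that C(2) by (intro underS_incr) (auto simp: order_on_defs)
  have mono: "?P i \<le>o ?P j" if "(i, j) \<in> ?C" for i j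
    using ofilter_subset_ordLeq[OF C(2) fil fil] incr[OF that] by blast
  define As where "As i = {y\<in>Y. h y \<le>o ?P i}" for i
  have "relChain ?C As"
    unfolding relChain_def As_def using mono ordLeq_transitive by blast
  moreover have "Y \<subseteq> (\<Union>i\<in>Field ?C. As i)"
  proof
    fix y assume y: "y \<in> Y"
    then obtain a where "a \<in> Field ?C" "h y =o ?P a"
      using small[OF wo[OF y]] ordLess_iff_ordIso_Restr[OF C(2) wo[OF y]] by blast
    then show "y \<in> (\<Union>i\<in>Field ?C. As i)"
      using y by (auto simp: As_def ordIso_iff_ordLeq)
  qed
  moreover have "|Y| \<le>o |?U|" by (simp add: card_of_mono1)
  ultimately obtain i where i: "i \<in> Field ?C" "Y \<subseteq> As i"
    using cardSuc_UNION[of "|?U|" As Y] U inf by (auto simp: Field_card_of)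
  obtain j where j: "j \<in> Field ?C" "i \<noteq> j" "(i, j) \<in> ?C"
    using infinite_Card_order_limit[OF C(1) CI i(1)] by blast
  have "i \<in> underS ?C j" "i \<notin> underS ?C i"
    using j by (auto simp: underS_def)
  then have ij: "?P i <o ?P j"
    using ofilter_subset_ordLess[OF C(2) fil fil] incr[OF j(3)] by blast
  have below: "h y <o ?P j" if "y \<in> Y" for y
    using i(2) that ij ordLeq_ordLess_trans unfolding As_def by blast
  have "?P j <o ?C" using underS_Restr_ordLess[OF C(2)] j(1) by blast
  then have "|Field (?P j)| <o ?C"
    using ordLeq_ordLess_trans[OF card_of_least] P by blast
  then have "|Field (?P j)| \<le>o |?U|"
    using cardSuc_ordLeq_ordLess[OF U card_of_Card_order] by blast
  then obtain f where f: "inj_on f (Field (?P j))" "f ` Field (?P j) \<subseteq> ?U"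
    unfolding card_of_ordLeq[symmetric] by blast
  let ?W = "dir_image (?P j) f"
  have "?P j =o ?W" by (rule dir_image_ordIso[OF P f(1)])
  moreover have "Well_order ?W" by (rule Well_order_dir_image[OF P f(1)])
  ultimately show ?thesis using below ordLess_ordIso_trans by blast
qed

lemma least_strict_upper_bound_ex:
  fixes h :: "'b \<Rightarrow> 'b rel"
  assumes "infinite (UNIV :: 'b set)" and "\<And>y. y \<in> Y \<Longrightarrow> Well_order (h y)"
  shows "is_sup_succ (h ` Y) (sup_succ (h ` Y))"
proof -
  let ?B = "{W::'b rel. Well_order W \<and> (\<forall>y\<in>Y. h y <o W)}"
  have "?B \<noteq> {}" using bounding_well_order_ex[of Y h, OF assms] by blast
  then obtain W where "W \<in> ?B" "\<forall>W'\<in>?B. W \<le>o W'"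
    using exists_minim_Well_order[of ?B] by blast
  then have "is_sup_succ (h ` Y) W" by (auto simp: is_sup_succ_def)
  then show ?thesis unfolding sup_succ_def by (rule someI)
qed

lemma height_is_sup_succ:
  fixes r :: "'b rel"
  assumes inf: "infinite (UNIV :: 'b set)" and wf: "wf r"
  shows "is_sup_succ (height r ` {y. (y, x) \<in> r}) (height r x)"
  using wf
proof (induction x rule: wf_induct_rule)
  case (less x)
  have "height r x = sup_succ (cut (height r) r x ` {y. (y, x) \<in> r})"
    unfolding height_def by (subst wfrec[OF wf]) simp
  also have "cut (height r) r x ` {y. (y, x) \<in> r} = height r ` {y. (y, x) \<in> r}"
    by (auto simp: cut_apply intro!: image_cong)
  finally show ?case
    using less least_strict_upper_bound_ex[OF inf, of "{y. (y, x) \<in> r}" "height r"]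
    by (simp add: is_sup_succ_def)
qed

text \<open>The strict inclusion order on the ideals contained in \<open>\<A>\<close>. An age \<open>\<A>\<close> is the largest
  element of this poset, so \<open>{\<J>. \<J> \<subseteq> \<A>}\<close> is well-founded iff the whole poset is.\<close>

definition ideal_less :: "'i signature \<Rightarrow> 'i iso_type set \<Rightarrow> 'i iso_type set rel" where
  "ideal_less \<mu> \<A> = {(\<I>, \<J>). is_ideal \<mu> \<I> \<and> is_ideal \<mu> \<J> \<and> \<I> \<subset> \<J> \<and> \<J> \<subseteq> \<A>}"

definition age_height_defined :: "'i signature \<Rightarrow> 'i iso_type set \<Rightarrow> bool" where
  "age_height_defined \<mu> \<A> \<longleftrightarrow> wf (ideal_less \<mu> \<A>)"

definition age_height :: "'i signature \<Rightarrow> 'i iso_type set \<Rightarrow> 'i iso_type set rel" where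
  "age_height \<mu> \<A> = height (ideal_less \<mu> \<A>) \<A>"

text \<open>The ordinal \<open>\<omega> \<cdot> m\<close>: \<open>m\<close> consecutive copies of \<open>\<omega>\<close>, the pair \<open>(i, a)\<close> standing for
  \<open>\<omega> \<cdot> i + a\<close>.\<close>

definition omega_times :: "nat \<Rightarrow> (nat \<times> nat) rel" where
  "omega_times m = {((i, a), (j, b)). i < m \<and> j < m \<and> (i < j \<or> i = j \<and> a \<le> b)}"

lemma Field_omega_times: "Field (omega_times m) = {..<m} \<times> UNIV"
  by (fastforce simp: Field_def omega_times_def)

lemma Well_order_omega_times: "Well_order (omega_times m)"
proof -
  have "wf (omega_times m - Id)"
    by (rule wf_subset[OF wf_lex_prod[OF wf_less wf_less]]) (auto simp: omega_times_def)
  then show ?thesis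
    unfolding order_on_defs Field_omega_times
    by (auto simp: omega_times_def refl_on_def trans_def antisym_def total_on_def)
qed

lemma infinite_ideal_type: "infinite (UNIV :: 'i iso_type set set)"
proof -
  have "inj (\<lambda>n::nat. {{\<lparr>base = {n}, rels = (\<lambda>_::'i. {})\<rparr>}})"
    by (auto simp: inj_def)
  then show ?thesis by (metis finite_imageD infinite_UNIV_nat finite_subset subset_UNIV)
qed

end

theory Submission
  imports Defs "HOL-Library.Ramsey" "HOL-Library.Nat_Bijection" "HOL-Library.Function_Algebras"
begin

text \<open>Any finitely many types of size \<open>n\<close> occur together in one finite substructure, and
  since the age is inexhaustible, \<open>R\<close> contains infinitely many disjoint copies of it. By well-foundedness and Ramsey's theorem the copies may be taken indiscernible and indexed by
  \<open>\<rat>\<close>, so a finite substructure is a finite family of pieces, one for each index, each piece being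
  a subset of the finite set \<open>C\<close> of points of a copy.

  The order of the indices does not matter: a piece that cannot be moved across another one would
  mark arbitrarily many gaps whose contents can be recovered from the isomorphism type, and this
  would give ideals of arbitrarily large rank \<open>\<omega> \<cdot> i\<close>. Hence a finite substructure is determined up to
  isomorphism by the numbers of its pieces of each kind (letter), a vector of natural numbers. As a
  function of this vector, the number of copies of a type \<open>s\<close> is killed by iterated differences of
  order above \<open>|s|\<close>. Call a shift of the vector invisible if it preserves all these numbers, and let
  \<open>Q\<close> be the set of the letters that are not the largest letter changed by an invisible shift.

  On the one hand, every letter in \<open>Q\<close> raises the coefficient of \<open>\<omega>\<close> in the rank by one, whence
  \<open>|Q| \<le> k + 1\<close>. On the other hand, a representative of a type that maximises a suitable weight
  uses letters of \<open>Q\<close> only, so there are at most as many types of size \<open>n\<close> as there are vectors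
  over \<open>Q\<close> of weighted size \<open>n\<close>, and these number at most \<open>(n + k) choose k\<close>.\<close>

text \<open>Heights are estimated through growth. For a set \<open>X\<close> of points,
  \<open>cnt X M\<close> counts the types with at most \<open>M\<close> points inside
  \<open>X\<close>, and it depends on the age of \<open>X\<close> alone. When finite blocks of equal
  pieces are enlarged without end, the union has growth of higher degree than each stage. So no
  stage has the age of the union, the ages increase for ever, and the union costs a new multiple of
  \<omega>. Growth must therefore be bounded from both sides, and the obstacle is that a type need
  not determine its vector. From below, a finite part is pinned: isomorphisms fixing it recover the
  vector, and automorphisms leave boundedly many positions for it. From above, vectors are counted
  modulo invisible shifts. Shifts are sorted by their largest letter because codes increase with
  inclusion: subsets of pieces with codes below \<open>i\<close> again have codes below
  \<open>i\<close>, so letters can be added one at a time in the order of their codes. The bound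
  \<open>k + 1\<close> on \<open>card Q\<close> arises since proper ideals have height \<omega> * i
  + a with i at most \<open>k\<close>, while the age itself receives the coefficient
  \<open>k + 1\<close>.\<close>

lemma strict_mono_bij_ex:
  fixes A :: "'a::linorder set" and B :: "'b::linorder set"
  assumes "finite A" "finite B" "card A = card B"
  shows "\<exists>h. bij_betw h A B \<and> strict_mono_on A h"
  using assms
proof (induction A arbitrary: B rule: finite_linorder_max_induct)
  case empty
  then show ?case by (auto simp: strict_mono_on_def bij_betw_def)
next
  case (insert a A)
  have aA: "a \<notin> A" using insert.hyps by auto
  have card_B: "card B = Suc (card A)" using insert aA by simp
  define b where "b = Max B"
  have ne: "B \<noteq> {}" using card_B by auto
  have b: "b \<in> B" "\<And>y. y \<in> B \<Longrightarrow> y \<le> b"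
    using insert.prems ne by (auto simp: b_def)
  have "card (B - {b}) = card A" using b(1) card_B insert.prems by simp
  then obtain h where h: "bij_betw h A (B - {b})" "strict_mono_on A h"
    using insert.IH[of "B - {b}"] insert.prems by auto
  let ?h = "h(a := b)"
  have "bij_betw ?h A (B - {b}) = bij_betw h A (B - {b})"
    by (rule bij_betw_cong) (use aA in auto)
  then have "bij_betw ?h A (B - {b})" using h(1) by simp
  then have "bij_betw ?h (insert a A) (insert b (B - {b}))"
    using aA notIn_Un_bij_betw[of a A ?h "B - {b}"] by simp
  then have "bij_betw ?h (insert a A) B" using b(1) by (simp add: insert_absorb)
  moreover have "strict_mono_on (insert a A) ?h"
  proof (rule strict_mono_onI)
    fix x y assume xy: "x \<in> insert a A" "y \<in> insert a A" "x < y"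
    then have x: "x \<in> A" "x \<noteq> a" using insert.hyps(2) by fastforce+
    have "h x \<in> B - {b}" using h(1) x by (auto simp: bij_betw_def)
    then have "h x < b" using b(2)[of "h x"] by auto
    then show "?h x < ?h y" using xy x h(2) by (auto simp: strict_mono_on_def)
  qed
  ultimately show ?case by blast
qed

section \<open>Finite sets of points \<open>(i, c)\<close>, read as pieces \<open>trace F i\<close>
  placed at indices \<open>i\<close>\<close>

definition trace :: "('i \<times> 'c) set \<Rightarrow> 'i \<Rightarrow> 'c set" where
  "trace F i = {c. (i, c) \<in> F}"

definition mv :: "('i \<Rightarrow> 'j) \<Rightarrow> ('i \<times> 'c) set \<Rightarrow> ('j \<times> 'c) set" where
  "mv g F = (\<lambda>(i, c). (g i, c)) ` F"

lemma trace_nonempty: "i \<in> fst ` F \<longleftrightarrow> trace F i \<noteq> {}"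
  by (force simp: trace_def)

lemma mem_trace [simp]: "c \<in> trace F i \<longleftrightarrow> (i, c) \<in> F"
  by (simp add: trace_def)

lemma trace_Un: "trace (F \<union> G) i = trace F i \<union> trace G i"
  by auto

lemma finite_trace: "finite F \<Longrightarrow> finite (trace F i)"
proof -
  assume "finite F"
  moreover have "trace F i \<subseteq> snd ` F" by force
  ultimately show ?thesis by (meson finite_imageI finite_subset)
qed

lemma fst_mv [simp]: "fst ` mv g F = g ` fst ` F"
  by (force simp: mv_def)

lemma mv_Un: "mv g (F \<union> G) = mv g F \<union> mv g G"
  by (auto simp: mv_def)

lemma mv_mv: "mv g (mv h F) = mv (g \<circ> h) F"
  by (force simp: mv_def)

lemma mv_cong: "(\<And>i. i \<in> fst ` F \<Longrightarrow> g i = h i) \<Longrightarrow> mv g F = mv h F"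
  by (force simp: mv_def)

lemma mv_id: "(\<And>i. i \<in> fst ` F \<Longrightarrow> g i = i) \<Longrightarrow> mv g F = F"
  by (force simp: mv_def)

lemma finite_mv: "finite F \<Longrightarrow> finite (mv g F)"
  by (simp add: mv_def)

lemma mv_columns: "F \<subseteq> UNIV \<times> C \<Longrightarrow> mv g F \<subseteq> UNIV \<times> C"
  by (auto simp: mv_def)

lemma inj_on_mv: "inj_on g (fst ` F) \<Longrightarrow> inj_on (\<lambda>(i, c). (g i, c)) F"
  by (force simp: inj_on_def)

lemma card_mv: "inj_on g (fst ` F) \<Longrightarrow> card (mv g F) = card F"
  unfolding mv_def by (rule card_image[OF inj_on_mv])

lemma trace_mv:
  assumes "inj_on g (fst ` F)" "i \<in> fst ` F"
  shows "trace (mv g F) (g i) = trace F i"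
proof -
  have "i' = i" if "(i', c) \<in> F" "g i' = g i" for i' c
    using that assms by (force simp: inj_on_def)
  then show ?thesis by (force simp: mv_def trace_def)
qed

text \<open>The keys \<open>cl\<close> group the indices of a finite set; two sets whose groups have the same sizes
  and carry the same traces differ only by a move of indices.\<close>

lemma regroup:
  fixes F :: "('i::linorder \<times> 'c) set" and F' :: "('j::linorder \<times> 'c) set"
  assumes fin: "finite F" "finite F'"
    and tr: "\<And>i j. i \<in> fst ` F \<Longrightarrow> j \<in> fst ` F' \<Longrightarrow> cl i = cl' j \<Longrightarrow> trace F i = trace F' j"
    and card: "\<And>k. card {i \<in> fst ` F. cl i = k} = card {j \<in> fst ` F'. cl' j = k}"
  obtains g where "inj_on g (fst ` F)" "mv g F = F'" "\<And>i. i \<in> fst ` F \<Longrightarrow> g i \<in> fst ` F'"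
    "\<And>i. i \<in> fst ` F \<Longrightarrow> cl' (g i) = cl i"
    "\<And>i j. i \<in> fst ` F \<Longrightarrow> j \<in> fst ` F \<Longrightarrow> cl i = cl j \<Longrightarrow> i < j \<Longrightarrow> g i < g j"
proof -
  let ?S = "\<lambda>k. {i \<in> fst ` F. cl i = k}" and ?S' = "\<lambda>k. {j \<in> fst ` F'. cl' j = k}"
  have "\<forall>k. \<exists>h. bij_betw h (?S k) (?S' k) \<and> strict_mono_on (?S k) h"
    by (intro allI strict_mono_bij_ex) (use fin card in auto)
  from choice[OF this] obtain h
    where h: "\<And>k. bij_betw (h k) (?S k) (?S' k)" "\<And>k. strict_mono_on (?S k) (h k)" by blast
  define g where "g i = h (cl i) i" for i
  have g: "g i \<in> fst ` F'" "cl' (g i) = cl i" if "i \<in> fst ` F" for i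
    using bij_betwE[OF h(1)[of "cl i"]] that by (simp_all add: g_def)
  have mono: "g i < g j" if "i \<in> fst ` F" "j \<in> fst ` F" "cl i = cl j" "i < j" for i j
    using that h(2)[of "cl j"] by (auto simp: g_def strict_mono_on_def)
  have inj: "inj_on g (fst ` F)"
  proof (rule inj_onI)
    fix i j assume ij: "i \<in> fst ` F" "j \<in> fst ` F" "g i = g j"
    then have "cl i = cl j" using g by metis
    then show "i = j" using mono ij by (metis less_irrefl neq_iff)
  qed
  have onto: "\<exists>i\<in>fst ` F. g i = j" if "j \<in> fst ` F'" for j
  proof -
    have "j \<in> h (cl' j) ` ?S (cl' j)" using h(1)[of "cl' j"] that by (auto simp: bij_betw_def)
    then show ?thesis by (force simp: g_def)
  qed
  have trg: "trace F i = trace F' (g i)" if "i \<in> fst ` F" for i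
    using tr[OF that g(1)[OF that]] g(2)[OF that] by simp
  have "mv g F = F'"
  proof (rule set_eqI)
    fix x :: "'j \<times> 'c"
    obtain j c where x: "x = (j, c)" by (cases x)
    show "x \<in> mv g F \<longleftrightarrow> x \<in> F'"
    proof
      assume "x \<in> mv g F"
      then obtain i where i: "(i, c) \<in> F" "j = g i" by (auto simp: mv_def x)
      then have "c \<in> trace F' (g i)" using trg[of i] by (force simp: trace_def)
      then show "x \<in> F'" using i x by simp
    next
      assume "x \<in> F'"
      then have "j \<in> fst ` F'" by (force simp: x)
      then obtain i where i: "i \<in> fst ` F" "g i = j" using onto by blast
      then have "c \<in> trace F i" using trg[of i] \<open>x \<in> F'\<close> by (simp add: x)
      then show "x \<in> mv g F" using i by (force simp: mv_def x)
    qed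
  qed
  then show ?thesis using that[OF inj] g mono by blast
qed

text \<open>\<open>t F\<close> stands for the isomorphism type of the structure induced on \<open>F\<close> by infinitely many
  disjoint copies of a structure on the finite set \<open>C\<close>, arranged along \<open>\<rat>\<close> in an indiscernible way.
  The values \<open>R1\<close> and \<open>R2\<close> at an ideal are \<open>i\<close> and \<open>a\<close> if its height is \<open>\<omega> \<cdot> i + a\<close>.\<close>

locale type_system =
  fixes C :: "nat set" and t :: "(rat \<times> nat) set \<Rightarrow> 'q"
    and R1 R2 :: "'q set \<Rightarrow> nat" and \<kappa> :: nat
  assumes fin_C: "finite C"
    and iso: "\<And>F G. finite F \<Longrightarrow> finite G \<Longrightarrow> F \<subseteq> UNIV \<times> C \<Longrightarrow> G \<subseteq> UNIV \<times> C \<Longrightarrow> t F = t G \<Longrightarrow>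
      \<exists>\<theta>. bij_betw \<theta> F G \<and> (\<forall>X\<subseteq>F. t (\<theta> ` X) = t X)"
    and indisc: "\<And>F g. finite F \<Longrightarrow> F \<subseteq> UNIV \<times> C \<Longrightarrow> strict_mono_on (fst ` F) g \<Longrightarrow>
      t (mv g F) = t F"
    and rank: "\<And>X Y. X \<subseteq> UNIV \<times> C \<Longrightarrow> Y \<subseteq> UNIV \<times> C \<Longrightarrow>
      {t F |F. finite F \<and> F \<subseteq> X} \<subset> {t F |F. finite F \<and> F \<subseteq> Y} \<Longrightarrow>
      R1 {t F |F. finite F \<and> F \<subseteq> X} < R1 {t F |F. finite F \<and> F \<subseteq> Y} \<or>
      R1 {t F |F. finite F \<and> F \<subseteq> X} = R1 {t F |F. finite F \<and> F \<subseteq> Y} \<and>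
      R2 {t F |F. finite F \<and> F \<subseteq> X} < R2 {t F |F. finite F \<and> F \<subseteq> Y}"
    and R1_le: "\<And>X. X \<subseteq> UNIV \<times> C \<Longrightarrow> R1 {t F |F. finite F \<and> F \<subseteq> X} \<le> \<kappa>"
begin

abbreviation E :: "(rat \<times> nat) set" where "E \<equiv> UNIV \<times> C"

section \<open>Ages inside a type system, their ranks and their counting functions\<close>

definition ag :: "(rat \<times> nat) set \<Rightarrow> 'q set" where
  "ag X = {t F |F. finite F \<and> F \<subseteq> X}"

text \<open>A cumulative profile. Sets of equal type have equal size, so it is an invariant of the
  age (\<open>cnt_cong\<close>) and can show that two ages differ.\<close>

definition cnt :: "(rat \<times> nat) set \<Rightarrow> nat \<Rightarrow> nat" where
  "cnt X M = card {t F |F. finite F \<and> F \<subseteq> X \<and> card F \<le> M}"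

lemma ag_mono: "X \<subseteq> Y \<Longrightarrow> ag X \<subseteq> ag Y"
  by (auto simp: ag_def)

lemma rank_ag: "X \<subseteq> E \<Longrightarrow> Y \<subseteq> E \<Longrightarrow> ag X \<subset> ag Y \<Longrightarrow>
    R1 (ag X) < R1 (ag Y) \<or> R1 (ag X) = R1 (ag Y) \<and> R2 (ag X) < R2 (ag Y)"
  unfolding ag_def by (rule rank)

lemma R1_mono: "X \<subseteq> Y \<Longrightarrow> Y \<subseteq> E \<Longrightarrow> R1 (ag X) \<le> R1 (ag Y)"
proof -
  assume XY: "X \<subseteq> Y" "Y \<subseteq> E"
  then have "X \<subseteq> E" by blast
  then show ?thesis
    using XY rank_ag[of X Y] ag_mono[of X Y] by (cases "ag X = ag Y") (auto simp: psubset_eq)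
qed

lemma card_eq_of_t_eq:
  assumes "finite F" "finite G" "F \<subseteq> E" "G \<subseteq> E" "t F = t G"
  shows "card F = card G"
  using iso[OF assms] bij_betw_same_card by blast

lemma cnt_cong:
  assumes "X \<subseteq> E" "Y \<subseteq> E" "ag X = ag Y"
  shows "cnt X M = cnt Y M"
proof -
  have *: "{t F |F. finite F \<and> F \<subseteq> X \<and> card F \<le> M} \<subseteq> {t F |F. finite F \<and> F \<subseteq> Y \<and> card F \<le> M}"
    if XY: "X \<subseteq> E" "Y \<subseteq> E" "ag X = ag Y" for X Y
  proof (clarify)
    fix F assume F: "finite F" "F \<subseteq> X" "card F \<le> M"
    then have "t F \<in> ag Y" using XY unfolding ag_def by blast
    then obtain G where G: "finite G" "G \<subseteq> Y" "t F = t G" by (auto simp: ag_def)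
    then have "card G = card F"
      using card_eq_of_t_eq[of F G] F XY by auto
    then show "\<exists>G. t F = t G \<and> finite G \<and> G \<subseteq> Y \<and> card G \<le> M" using F G by auto
  qed
  show ?thesis
    unfolding cnt_def
    by (rule arg_cong[where f = card], rule equalityI; rule *) (use assms in auto)
qed

text \<open>An increasing chain of ages that never reaches its union raises the \<open>\<omega>\<close>-coefficient of the
  rank, because the finite parts are bounded by that of the union.\<close>

lemma R1_limit:
  assumes inc: "\<And>c. X c \<subseteq> X (Suc c)" and sub: "\<And>c. X c \<subseteq> E"
    and ne: "\<And>c. ag (X c) \<noteq> ag (\<Union>c. X c)" and d: "\<And>c. d \<le> R1 (ag (X c))"
  shows "Suc d \<le> R1 (ag (\<Union>c. X c))"
proof (rule ccontr)
  let ?Y = "\<Union>c. X c"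
  assume "\<not> ?thesis"
  then have "R1 (ag ?Y) \<le> d" by simp
  have YE: "?Y \<subseteq> E" using sub by blast
  have mono: "X c \<subseteq> X c'" if "c \<le> c'" for c c'
    using that lift_Suc_mono_le[of X] inc by blast
  have "ag (X c) \<subset> ag ?Y" for c using ag_mono[of "X c" ?Y] ne[of c] by blast
  then have r: "R1 (ag (X c)) = d \<and> R2 (ag (X c)) < R2 (ag ?Y)" for c
    using rank_ag[OF sub YE, of c] d[of c] \<open>R1 (ag ?Y) \<le> d\<close> by fastforce
  have "\<exists>c'. ag (X c) \<subset> ag (X c')" for c
  proof -
    obtain q where q: "q \<in> ag ?Y" "q \<notin> ag (X c)" using \<open>ag (X c) \<subset> ag ?Y\<close> by blast
    then obtain F where F: "finite F" "F \<subseteq> ?Y" "t F \<notin> ag (X c)"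
      unfolding ag_def[of ?Y] by blast
    obtain c' where c': "F \<subseteq> X c'"
    proof -
      have "\<exists>c'. F \<subseteq> X c'" using F(1,2)
      proof induction
        case (insert x F)
        then obtain c1 c2 where "F \<subseteq> X c1" "x \<in> X c2" by auto
        then show ?case using mono[of c1 "max c1 c2"] mono[of c2 "max c1 c2"] by force
      qed simp
      then show ?thesis using that by blast
    qed
    have "t F \<in> ag (X c')" using F c' by (auto simp: ag_def)
    moreover have "ag (X c) \<subseteq> ag (X c') \<or> ag (X c') \<subseteq> ag (X c)"
      using ag_mono mono by (metis nat_le_linear)
    ultimately show ?thesis using F(3) by blast
  qed
  then have "\<forall>c. \<exists>c'. ag (X c) \<subset> ag (X c')" by blast
  from choice[OF this] obtain nx where nx: "\<And>c. ag (X c) \<subset> ag (X (nx c))" by blast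
  \<comment> \<open>All stages share the value \<open>d\<close> of \<open>R1\<close>, so each strict
    step must raise \<open>R2\<close>, which stays below its value at the union.\<close>
  have "n \<le> R2 (ag (X ((nx ^^ n) 0)))" for n
  proof (induction n)
    case (Suc n)
    have "R2 (ag (X ((nx ^^ n) 0))) < R2 (ag (X ((nx ^^ Suc n) 0)))"
      using rank_ag[OF sub sub nx, of "(nx ^^ n) 0"] r by auto
    then show ?case using Suc by simp
  qed simp
  from this[of "R2 (ag ?Y)"] r[of "(nx ^^ R2 (ag ?Y)) 0"] show False by simp
qed

text \<open>The copies of a fixed type that contain distinguishable copies of \<open>f\<close> are boundedly many:
  after a rearrangement the image of \<open>f\<close> lies in the fixed finite set \<open>T\<^sub>0\<close>.\<close>

lemma bounded_to_one:
  assumes f: "finite f" "f \<subseteq> E" and T0: "finite T\<^sub>0"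
    and F: "\<And>a. a \<in> A \<Longrightarrow> finite (F a) \<and> F a \<subseteq> E \<and> f \<subseteq> F a"
    and push: "\<And>a S. a \<in> A \<Longrightarrow> S \<subseteq> F a \<Longrightarrow> card S \<le> card f \<Longrightarrow>
      \<exists>\<pi>. bij_betw \<pi> (F a) (F a) \<and> \<pi> ` S \<subseteq> T\<^sub>0 \<and> (\<forall>X\<subseteq>F a. t (\<pi> ` X) = t X)"
    and dist: "\<And>a b \<theta>. a \<in> A \<Longrightarrow> b \<in> A \<Longrightarrow> bij_betw \<theta> (F a) (F b) \<Longrightarrow>
      (\<forall>X\<subseteq>F a. t (\<theta> ` X) = t X) \<Longrightarrow> (\<forall>x\<in>f. \<theta> x = x) \<Longrightarrow> a = b"
    and finA: "finite A"
  shows "card A \<le> card ((\<lambda>a. t (F a)) ` A) * card T\<^sub>0 ^ card f"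
proof -
  have "card {a \<in> A. t (F a) = q} \<le> card T\<^sub>0 ^ card f" for q
  proof (cases "{a \<in> A. t (F a) = q} = {}")
    case True
    then show ?thesis unfolding True by simp
  next
    case False
    then obtain b where b: "b \<in> A" "t (F b) = q" by blast
    let ?A = "{a \<in> A. t (F a) = q}"
    have "\<exists>\<phi>. bij_betw \<phi> (F a) (F b) \<and> \<phi> ` f \<subseteq> T\<^sub>0 \<and> (\<forall>X\<subseteq>F a. t (\<phi> ` X) = t X)" if a: "a \<in> ?A" for a
    proof -
      obtain \<theta> where \<theta>: "bij_betw \<theta> (F a) (F b)" "\<forall>X\<subseteq>F a. t (\<theta> ` X) = t X"
        using iso[of "F a" "F b"] F a b by auto
      have "\<theta> ` f \<subseteq> F b" using \<theta>(1) F a by (force simp: bij_betw_def)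
      moreover have "card (\<theta> ` f) \<le> card f" by (rule card_image_le[OF f(1)])
      ultimately obtain \<pi> where \<pi>: "bij_betw \<pi> (F b) (F b)" "\<pi> ` \<theta> ` f \<subseteq> T\<^sub>0" "\<forall>X\<subseteq>F b. t (\<pi> ` X) = t X"
        using push[OF b(1), of "\<theta> ` f"] by blast
      have "t ((\<pi> \<circ> \<theta>) ` X) = t X" if "X \<subseteq> F a" for X
      proof -
        have "\<theta> ` X \<subseteq> F b" using that \<theta>(1) by (auto simp: bij_betw_def)
        then have "t (\<pi> ` \<theta> ` X) = t X" using \<pi>(3) \<theta>(2) that by simp
        then show ?thesis by (simp only: image_comp)
      qed
      then show ?thesis using bij_betw_trans[OF \<theta>(1) \<pi>(1)] \<pi>(2)
        by (intro exI[of _ "\<pi> \<circ> \<theta>"]) (auto simp: image_comp)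
    qed
    then have "\<forall>a\<in>?A. \<exists>\<phi>. bij_betw \<phi> (F a) (F b) \<and> \<phi> ` f \<subseteq> T\<^sub>0 \<and> (\<forall>X\<subseteq>F a. t (\<phi> ` X) = t X)"
      by blast
    from bchoice[OF this] obtain \<phi> where \<phi>': "\<forall>a\<in>?A. bij_betw (\<phi> a) (F a) (F b) \<and>
        \<phi> a ` f \<subseteq> T\<^sub>0 \<and> (\<forall>X\<subseteq>F a. t (\<phi> a ` X) = t X)" ..
    then have \<phi>: "bij_betw (\<phi> a) (F a) (F b)" "\<phi> a ` f \<subseteq> T\<^sub>0" "X \<subseteq> F a \<Longrightarrow> t (\<phi> a ` X) = t X"
      if "a \<in> ?A" for a X
      using that by simp_all
    \<comment> \<open>If \<open>\<phi> a\<close> and \<open>\<phi> a'\<close> agree on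
      \<open>f\<close>, going to \<open>F b\<close> by one and back by the other fixes
      \<open>f\<close> pointwise, so \<open>dist\<close> gives \<open>a = a'\<close>. Hence
      \<open>a\<close> is coded by a map from \<open>f\<close> to \<open>T\<^sub>0\<close>.\<close>
    have "inj_on (\<lambda>a. restrict (\<phi> a) f) ?A"
    proof (rule inj_onI)
      fix a a' assume aa: "a \<in> ?A" "a' \<in> ?A" "restrict (\<phi> a) f = restrict (\<phi> a') f"
      let ?\<theta> = "inv_into (F a') (\<phi> a') \<circ> \<phi> a"
      have bij': "bij_betw (inv_into (F a') (\<phi> a')) (F b) (F a')"
        by (rule bij_betw_inv_into[OF \<phi>(1)[OF aa(2)]])
      have "bij_betw ?\<theta> (F a) (F a')" by (rule bij_betw_trans[OF \<phi>(1)[OF aa(1)] bij'])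
      moreover have "t (?\<theta> ` X) = t X" if X: "X \<subseteq> F a" for X
      proof -
        have sub: "\<phi> a ` X \<subseteq> F b" using X \<phi>(1)[OF aa(1)] by (auto simp: bij_betw_def)
        then have sub': "?\<theta> ` X \<subseteq> F a'" using bij' by (auto simp: bij_betw_def image_comp[symmetric])
        have "\<phi> a' ` inv_into (F a') (\<phi> a') ` \<phi> a ` X = \<phi> a ` X"
          by (rule image_inv_into_cancel[OF bij_betw_imp_surj_on[OF \<phi>(1)[OF aa(2)]] sub])
        then have "\<phi> a' ` ?\<theta> ` X = \<phi> a ` X" by (simp only: image_comp)
        then show ?thesis using \<phi>(3)[OF aa(1) X] \<phi>(3)[OF aa(2) sub'] by simp
      qed
      moreover have "?\<theta> x = x" if x: "x \<in> f" for x
      proof -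
        have "\<phi> a x = \<phi> a' x" using aa(3) x by (metis restrict_apply')
        moreover have "x \<in> F a'" using F x aa(2) by auto
        ultimately show ?thesis using \<phi>(1)[OF aa(2)] by (simp add: bij_betw_def)
      qed
      ultimately show "a = a'" using dist[of a a' ?\<theta>] aa by blast
    qed
    moreover have "(\<lambda>a. restrict (\<phi> a) f) ` ?A \<subseteq> f \<rightarrow>\<^sub>E T\<^sub>0"
      using \<phi>(2) by (auto simp: image_subset_iff)
    ultimately have "card ?A \<le> card (f \<rightarrow>\<^sub>E T\<^sub>0)"
      using card_inj_on_le finite_PiE f(1) T0 by (metis (no_types, lifting))
    then show ?thesis using f(1) by (simp add: card_PiE)
  qed
  then have "(\<Sum>q\<in>(\<lambda>a. t (F a)) ` A. card {a \<in> A. t (F a) = q})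
      \<le> (\<Sum>q\<in>(\<lambda>a. t (F a)) ` A. card T\<^sub>0 ^ card f)"
    by (intro sum_mono)
  moreover have "card A = (\<Sum>q\<in>(\<lambda>a. t (F a)) ` A. card {a \<in> A. t (F a) = q})"
  proof -
    have "A = (\<Union>q\<in>(\<lambda>a. t (F a)) ` A. {a \<in> A. t (F a) = q})" by auto
    then show ?thesis using finA
      by (subst card_UN_disjoint[symmetric]) (auto simp: disjoint_iff)
  qed
  ultimately show ?thesis by simp
qed

end

section \<open>Growth along blocks of repeated pieces\<close>

lemma growth_gap: "\<exists>M::nat. K * (\<alpha> * M + \<beta> + 1) ^ e < (M + 1) ^ Suc e"
proof
  \<comment> \<open>The affine term is at most \<open>(\<alpha> + \<beta> + 1) * (M + 1)\<close>;
    with this choice the constants multiply to exactly \<open>M\<close>, just below the extra factor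
    \<open>M + 1\<close>.\<close>
  define M where "M = K * (\<alpha> + \<beta> + 1) ^ e"
  have "\<alpha> * M + \<beta> + 1 \<le> (\<alpha> + \<beta> + 1) * (M + 1)" by (simp add: algebra_simps)
  then have "K * (\<alpha> * M + \<beta> + 1) ^ e \<le> K * ((\<alpha> + \<beta> + 1) * (M + 1)) ^ e"
    by (intro mult_left_mono power_mono) auto
  also have "\<dots> = M * (M + 1) ^ e" by (simp only: M_def power_mult_distrib mult.assoc)
  also have "\<dots> < (M + 1) ^ Suc e" by simp
  finally show "K * (\<alpha> * M + \<beta> + 1) ^ e < (M + 1) ^ Suc e" .
qed

text \<open>Serves to bring those pieces of a block that meet a small set to the front of the
  block.\<close>

lemma bij_betw_initial:
  assumes "D \<subseteq> {..<a::nat}"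
  obtains \<sigma> where "bij_betw \<sigma> {..<a} {..<a}" "\<sigma> ` D = {..<card D}"
proof -
  have fin: "finite D" using assms finite_subset by blast
  have le: "card D \<le> a" using card_mono[OF _ assms] by simp
  obtain h where h: "bij_betw h D {..<card D}"
    using ex_bij_betw_finite_nat[OF fin] by (auto simp: atLeast0LessThan)
  have "card ({..<a} - D) = card ({..<a} - {..<card D})"
    using assms fin le by (simp add: card_Diff_subset)
  then obtain k where k: "bij_betw k ({..<a} - D) ({..<a} - {..<card D})"
    using finite_same_card_bij[of "{..<a} - D" "{..<a} - {..<card D}"] by auto
  let ?\<sigma> = "\<lambda>x. if x \<in> D then h x else k x"
  have "bij_betw ?\<sigma> D {..<card D}" using h by (simp cong: bij_betw_cong)
  have "bij_betw ?\<sigma> ({..<a} - D) ({..<a} - {..<card D}) \<longleftrightarrow>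
      bij_betw k ({..<a} - D) ({..<a} - {..<card D})"
    by (rule bij_betw_cong) auto
  then have "bij_betw ?\<sigma> ({..<a} - D) ({..<a} - {..<card D})" using k by blast
  then have "bij_betw ?\<sigma> (D \<union> ({..<a} - D)) ({..<card D} \<union> ({..<a} - {..<card D}))"
    by (rule bij_betw_combine[OF \<open>bij_betw ?\<sigma> D {..<card D}\<close>]) auto
  moreover have "D \<union> ({..<a} - D) = {..<a}" "{..<card D} \<union> ({..<a} - {..<card D}) = {..<a}"
    using assms le by auto
  moreover have "?\<sigma> ` D = {..<card D}" using h by (auto simp: bij_betw_def)
  ultimately show ?thesis using that[of ?\<sigma>] by simp
qed

lemma card_bounded_functions:
  fixes c :: "nat \<Rightarrow> nat"
  assumes "finite J"
  shows "card {a. \<forall>g. if g \<in> J then c g \<le> a g \<and> a g \<le> c g + M else a g = c g} = (M + 1) ^ card J"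
    (is "card ?A = _")
proof -
  have "bij_betw (\<lambda>a. restrict a J) ?A (PiE J (\<lambda>g. {c g..c g + M}))"
  proof (rule bij_betw_byWitness[where f' = "\<lambda>a g. if g \<in> J then a g else c g"])
    show "\<forall>a\<in>?A. (\<lambda>g. if g \<in> J then restrict a J g else c g) = a"
      by (auto simp: fun_eq_iff split: if_splits)
    show "\<forall>a'\<in>PiE J (\<lambda>g. {c g..c g + M}). restrict (\<lambda>g. if g \<in> J then a' g else c g) J = a'"
      by (auto simp: fun_eq_iff PiE_def extensional_def)
    show "(\<lambda>a. restrict a J) ` ?A \<subseteq> PiE J (\<lambda>g. {c g..c g + M})" by auto
    show "(\<lambda>a g. if g \<in> J then a g else c g) ` PiE J (\<lambda>g. {c g..c g + M}) \<subseteq> ?A"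
      by (auto simp: PiE_def Pi_def)
  qed
  then have "card ?A = card (PiE J (\<lambda>g. {c g..c g + M}))" by (rule bij_betw_same_card)
  also have "\<dots> = (M + 1) ^ card J" using assms by (simp add: card_PiE)
  finally show ?thesis .
qed

context type_system
begin

text \<open>At most \<open>M\<close> indices occur, and by indiscernibility they may be taken among
  0, ..., \<open>M - 1\<close>; over these and the finite set \<open>C\<close> there are finitely
  many sets.\<close>

lemma finite_types: "finite {t F |F. finite F \<and> F \<subseteq> E \<and> card F \<le> M}"
proof -
  let ?I = "(of_nat :: nat \<Rightarrow> rat) ` {..<M}"
  have "{t F |F. finite F \<and> F \<subseteq> E \<and> card F \<le> M} \<subseteq> t ` Pow (?I \<times> C)"
  proof clarify
    fix F assume F: "finite F" "F \<subseteq> E" "card F \<le> M"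
    have le: "card (fst ` F) \<le> M" using F(3) card_image_le[OF F(1), of fst] by linarith
    let ?J = "(of_nat :: nat \<Rightarrow> rat) ` {..<card (fst ` F)}"
    have "card (fst ` F) = card ?J" by (subst card_image) (auto simp: inj_on_def)
    then obtain h where h: "bij_betw h (fst ` F) ?J" "strict_mono_on (fst ` F) h"
      using strict_mono_bij_ex[of "fst ` F" ?J] F(1) by auto
    have "mv h F \<subseteq> ?I \<times> C"
    proof
      fix x assume "x \<in> mv h F"
      then obtain i c where x: "x = (h i, c)" "(i, c) \<in> F" by (auto simp: mv_def)
      then have "i \<in> fst ` F" by force
      then have "h i \<in> ?J" using h(1) by (auto simp: bij_betw_def)
      then show "x \<in> ?I \<times> C" using x F(2) le by auto
    qed
    then show "t F \<in> t ` Pow (?I \<times> C)" using indisc[OF F(1,2) h(2)] by (metis PowI image_eqI)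
  qed
  moreover have "finite (t ` Pow (?I \<times> C))" using fin_C by simp
  ultimately show ?thesis by (rule finite_subset)
qed

lemma cnt_mono:
  assumes "X \<subseteq> Y" "Y \<subseteq> E"
  shows "cnt X M \<le> cnt Y M"
  unfolding cnt_def
proof (rule card_mono)
  show "finite {t F |F. finite F \<and> F \<subseteq> Y \<and> card F \<le> M}"
    by (rule finite_subset[OF _ finite_types[of M]]) (use assms(2) in blast)
qed (use assms(1) in blast)

lemma cnt_ge:
  assumes "X \<subseteq> E" "\<And>a. a \<in> A \<Longrightarrow> finite (F a) \<and> F a \<subseteq> X \<and> card (F a) \<le> M"
  shows "card ((\<lambda>a. t (F a)) ` A) \<le> cnt X M"
  unfolding cnt_def
proof (rule card_mono)
  show "finite {t F |F. finite F \<and> F \<subseteq> X \<and> card F \<le> M}"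
    by (rule finite_subset[OF _ finite_types[of M]]) (use assms(1) in blast)
qed (use assms(2) in blast)

text \<open>The data \<open>D F\<close> may differ between sets of the same type, so one
  representative of each type is fixed and its data are counted.\<close>

lemma cnt_le:
  assumes "finite S"
    and D: "\<And>F. finite F \<Longrightarrow> F \<subseteq> X \<Longrightarrow> card F \<le> M \<Longrightarrow> D F \<in> S"
    and eq: "\<And>F G. finite F \<Longrightarrow> F \<subseteq> X \<Longrightarrow> card F \<le> M \<Longrightarrow> finite G \<Longrightarrow> G \<subseteq> X \<Longrightarrow> card G \<le> M \<Longrightarrow>
      D F = D G \<Longrightarrow> t F = t G"
  shows "cnt X M \<le> card S"
proof -
  let ?T = "{F. finite F \<and> F \<subseteq> X \<and> card F \<le> M}"
  have T: "{t F |F. finite F \<and> F \<subseteq> X \<and> card F \<le> M} = t ` ?T" by auto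
  let ?s = "\<lambda>q. D (SOME F. F \<in> ?T \<and> t F = q)"
  have some: "(SOME F. F \<in> ?T \<and> t F = q) \<in> ?T \<and> t (SOME F. F \<in> ?T \<and> t F = q) = q"
    if "q \<in> t ` ?T" for q
    by (rule someI_ex) (use that in blast)
  have "inj_on ?s (t ` ?T)"
  proof (rule inj_onI)
    fix q q' assume q: "q \<in> t ` ?T" "q' \<in> t ` ?T" "?s q = ?s q'"
    show "q = q'" using eq[OF _ _ _ _ _ _ q(3)] some[OF q(1)] some[OF q(2)] by simp
  qed
  moreover have "?s ` t ` ?T \<subseteq> S"
  proof (rule image_subsetI)
    fix q assume "q \<in> t ` ?T"
    then show "?s q \<in> S" using D some[of q] by blast
  qed
  ultimately show ?thesis unfolding cnt_def T by (rule card_inj_on_le[OF _ _ assms(1)])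
qed

end

text \<open>Block \<open>g\<close> consists of the pieces \<open>{pos g n} \<times> lam g\<close> for \<open>n = 0, 1, \<dots>\<close>.\<close>

locale block_system = type_system +
  fixes L :: nat and lam :: "nat \<Rightarrow> nat set" and pos :: "nat \<Rightarrow> nat \<Rightarrow> rat" and W :: "(rat \<times> nat) set"
  assumes lam: "\<And>g. g < L \<Longrightarrow> lam g \<subseteq> C"
    and pos_inj: "\<And>g g' n n'. g < L \<Longrightarrow> g' < L \<Longrightarrow> pos g n = pos g' n' \<Longrightarrow> g = g' \<and> n = n'"
    and W: "finite W" "W \<subseteq> E" "\<And>g n. g < L \<Longrightarrow> pos g n \<notin> fst ` W"
begin

definition blocks :: "(nat \<Rightarrow> nat) \<Rightarrow> (rat \<times> nat) set" where
  "blocks a = W \<union> {(pos g n, c) |g n c. g < L \<and> n < a g \<and> c \<in> lam g}"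

text \<open>Ages of towers are the ideals whose rank is estimated. Letting the finite blocks grow
  approaches a tower with more infinite blocks.\<close>

definition tower :: "nat set \<Rightarrow> (nat \<Rightarrow> nat) \<Rightarrow> (rat \<times> nat) set" where
  "tower J c = W \<union> {(pos g n, x) |g n x. g < L \<and> (g \<in> J \<or> n < c g) \<and> x \<in> lam g}"

text \<open>The source of automorphisms: it provides the hypothesis \<open>push\<close> of
  \<open>bounded_to_one\<close>.\<close>

definition permutable :: bool where
  "permutable \<longleftrightarrow> (\<forall>a \<psi> X. inj_on \<psi> (fst ` blocks a) \<longrightarrow> (\<forall>i\<in>fst ` W. \<psi> i = i) \<longrightarrow>
     (\<forall>g n. g < L \<longrightarrow> n < a g \<longrightarrow> (\<exists>n'<a g. \<psi> (pos g n) = pos g n')) \<longrightarrow>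
     X \<subseteq> blocks a \<longrightarrow> t (mv \<psi> X) = t X)"

text \<open>The hypothesis \<open>dist\<close> of \<open>bounded_to_one\<close> with
  \<open>blocks c\<close> as the pinned set; the numbers \<open>c\<close> say how much of each block
  is pinned.\<close>

definition distinguished :: "nat set \<Rightarrow> (nat \<Rightarrow> nat) \<Rightarrow> bool" where
  "distinguished J c \<longleftrightarrow> (\<forall>a b \<theta>. (\<forall>g. c g \<le> a g \<and> c g \<le> b g \<and> (g \<notin> J \<longrightarrow> a g = c g \<and> b g = c g)) \<longrightarrow>
     bij_betw \<theta> (blocks a) (blocks b) \<longrightarrow> (\<forall>X\<subseteq>blocks a. t (\<theta> ` X) = t X) \<longrightarrow>
     (\<forall>x\<in>blocks c. \<theta> x = x) \<longrightarrow> a = b)"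

lemma blocks_eq: "blocks a = W \<union> (\<Union>g\<in>{..<L}. (\<lambda>(n, x). (pos g n, x)) ` ({..<a g} \<times> lam g))"
  by (force simp: blocks_def)

lemma finite_lam: "g < L \<Longrightarrow> finite (lam g)"
  using lam fin_C finite_subset by blast

lemma finite_blocks: "finite (blocks a)"
  using W(1) finite_lam by (auto simp: blocks_eq)

lemma blocks_E: "blocks a \<subseteq> E"
  using W(2) lam by (auto simp: blocks_def)

lemma tower_E: "tower J c \<subseteq> E"
  using W(2) lam by (auto simp: tower_def)

lemma blocks_mono: "(\<And>g. g < L \<Longrightarrow> a g \<le> b g) \<Longrightarrow> blocks a \<subseteq> blocks b"
  by (force simp: blocks_def)

lemma card_blocks_le: "card (blocks a) \<le> card W + (\<Sum>g<L. a g * card (lam g))"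
proof -
  have "card (blocks a) \<le> card W + card (\<Union>g\<in>{..<L}. (\<lambda>(n, x). (pos g n, x)) ` ({..<a g} \<times> lam g))"
    unfolding blocks_eq by (rule card_Un_le)
  also have "card (\<Union>g\<in>{..<L}. (\<lambda>(n, x). (pos g n, x)) ` ({..<a g} \<times> lam g))
      \<le> (\<Sum>g<L. card ((\<lambda>(n, x). (pos g n, x)) ` ({..<a g} \<times> lam g)))"
    by (rule card_UN_le) simp
  also have "\<dots> \<le> (\<Sum>g<L. card ({..<a g} \<times> lam g))"
    by (intro sum_mono card_image_le) (auto simp: finite_lam)
  finally show ?thesis by (simp add: card_cartesian_product)
qed

text \<open>In each block at most \<open>card S\<close> pieces meet \<open>S\<close>. A permutation
  of the block brings them to the front, and \<open>permutable\<close> makes it invisible to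
  types.\<close>

lemma push_blocks:
  assumes permutable "S \<subseteq> blocks a"
  shows "\<exists>\<pi>. bij_betw \<pi> (blocks a) (blocks a) \<and> \<pi> ` S \<subseteq> blocks (\<lambda>_. card S) \<and>
    (\<forall>X\<subseteq>blocks a. t (\<pi> ` X) = t X)"
proof -
  let ?D = "\<lambda>g. {n. n < a g \<and> pos g n \<in> fst ` S}"
  have "\<forall>g. \<exists>\<sigma>. bij_betw \<sigma> {..<a g} {..<a g} \<and> \<sigma> ` ?D g = {..<card (?D g)}"
  proof
    fix g show "\<exists>\<sigma>. bij_betw \<sigma> {..<a g} {..<a g} \<and> \<sigma> ` ?D g = {..<card (?D g)}"
      by (rule bij_betw_initial[of "?D g" "a g"]) auto
  qed
  from choice[OF this] obtain \<sigma> where \<sigma>: "\<And>g. bij_betw (\<sigma> g) {..<a g} {..<a g}"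
    "\<And>g. \<sigma> g ` ?D g = {..<card (?D g)}" by blast
  have finS: "finite S" using assms(2) finite_blocks finite_subset by blast
  have cardD: "card (?D g) \<le> card S" if g: "g < L" for g
  proof -
    have "card (?D g) = card (pos g ` ?D g)"
      by (rule card_image[symmetric]) (use pos_inj[OF g g] in \<open>auto simp: inj_on_def\<close>)
    also have "\<dots> \<le> card (fst ` S)" by (rule card_mono) (use finS in auto)
    also have "\<dots> \<le> card S" by (rule card_image_le[OF finS])
    finally show ?thesis .
  qed
  let ?P = "{..<L} \<times> (UNIV :: nat set)"
  let ?dec = "inv_into ?P (\<lambda>(g, n). pos g n)"
  have dec: "?dec (pos g n) = (g, n)" if "g < L" for g n
    using that pos_inj inv_into_f_f[of "\<lambda>(g, n). pos g n" ?P "(g, n)"] by (fastforce simp: inj_on_def)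
  \<comment> \<open>Moves of pieces act on indices, so the block permutations must be read through
    the decoder \<open>?dec\<close>; every other index, in particular those of \<open>W\<close>,
    stays fixed.\<close>
  define \<psi> where "\<psi> x = (if x \<in> (\<lambda>(g, n). pos g n) ` ?P
      then case ?dec x of (g, n) \<Rightarrow> if n < a g then pos g (\<sigma> g n) else x else x)" for x
  have \<psi>_pos: "\<psi> (pos g n) = pos g (\<sigma> g n)" if "g < L" "n < a g" for g n
  proof -
    have "pos g n \<in> (\<lambda>(g, n). pos g n) ` ?P" using that by force
    then show ?thesis using that by (simp add: \<psi>_def dec)
  qed
  have \<psi>_W: "\<psi> x = x" if "x \<in> fst ` W" for x
  proof -
    have "x \<notin> (\<lambda>(g, n). pos g n) ` ?P"
    proof
      assume "x \<in> (\<lambda>(g, n). pos g n) ` ?P"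
      then obtain g n where "g < L" "x = pos g n" by auto
      then show False using W(3)[of g n] that by simp
    qed
    then show ?thesis by (simp add: \<psi>_def)
  qed
  have \<sigma>_lt: "\<sigma> g n < a g" if "n < a g" for g n
    using \<sigma>(1)[of g] that by (auto simp: bij_betw_def)
  have \<sigma>_inj: "n = n'" if "\<sigma> g n = \<sigma> g n'" "n < a g" "n' < a g" for g n n'
    using \<sigma>(1)[of g] that by (auto simp: bij_betw_def inj_on_def)
  have idx: "x \<in> fst ` W \<or> (\<exists>g n. g < L \<and> n < a g \<and> x = pos g n)" if "x \<in> fst ` blocks a" for x
    using that by (force simp: blocks_def)
  have inj: "inj_on \<psi> (fst ` blocks a)"
  proof (rule inj_onI)
    fix x y assume xy: "x \<in> fst ` blocks a" "y \<in> fst ` blocks a" "\<psi> x = \<psi> y"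
    have *: "\<psi> x \<noteq> \<psi> y" if "x \<in> fst ` W" "g < L" "n < a g" "y = pos g n" for x y g n
      using that(1) W(3)[OF that(2), of "\<sigma> g n"] unfolding that(4)
      by (simp only: \<psi>_W[OF that(1)] \<psi>_pos[OF that(2,3)]) metis
    from idx[OF xy(1)] idx[OF xy(2)] show "x = y"
    proof (elim disjE exE conjE)
      fix g n g' n' assume gn: "g < L" "n < a g" "x = pos g n" "g' < L" "n' < a g'" "y = pos g' n'"
      then have "pos g (\<sigma> g n) = pos g' (\<sigma> g' n')" using xy(3) by (simp add: \<psi>_pos)
      then have "g = g' \<and> \<sigma> g n = \<sigma> g' n'" using gn pos_inj by blast
      then show "x = y" using gn \<sigma>_inj by auto
    qed (use xy(3) * \<psi>_W in \<open>metis+\<close>)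
  qed
  have "inj_on (\<lambda>(i, c). (\<psi> i, c)) (blocks a)" by (rule inj_on_mv[OF inj])
  moreover have sub: "mv \<psi> (blocks a) \<subseteq> blocks a"
  proof
    fix x assume "x \<in> mv \<psi> (blocks a)"
    then obtain i c where x: "(i, c) \<in> blocks a" "x = (\<psi> i, c)" by (auto simp: mv_def)
    show "x \<in> blocks a"
    proof (cases "(i, c) \<in> W")
      case True
      then have "i \<in> fst ` W" by force
      then show ?thesis using True x \<psi>_W by (simp add: blocks_def)
    next
      case False
      then obtain g n where "g < L" "n < a g" "c \<in> lam g" "i = pos g n"
        using x(1) by (auto simp: blocks_def)
      then show ?thesis using x \<sigma>_lt by (auto simp: blocks_def \<psi>_pos)
    qed
  qed
  ultimately have bij: "bij_betw (\<lambda>(i, c). (\<psi> i, c)) (blocks a) (blocks a)"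
    by (metis mv_def bij_betw_def endo_inj_surj finite_blocks)
  have "mv \<psi> S \<subseteq> blocks (\<lambda>_. card S)"
  proof
    fix x assume "x \<in> mv \<psi> S"
    then obtain i c where x: "(i, c) \<in> S" "x = (\<psi> i, c)" by (auto simp: mv_def)
    show "x \<in> blocks (\<lambda>_. card S)"
    proof (cases "(i, c) \<in> W")
      case True
      then have "i \<in> fst ` W" by force
      then show ?thesis using True x \<psi>_W by (simp add: blocks_def)
    next
      case False
      then obtain g n where g: "g < L" "n < a g" "c \<in> lam g" "i = pos g n"
        using x(1) assms(2) by (auto simp: blocks_def)
      have "pos g n \<in> fst ` S" using g x(1) by force
      then have "\<sigma> g n \<in> {..<card (?D g)}" using \<sigma>(2)[of g] g by blast
      then have "\<sigma> g n < card S" using cardD[OF g(1)] by auto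
      then show ?thesis using g x by (auto simp: blocks_def \<psi>_pos)
    qed
  qed
  moreover have "t (mv \<psi> X) = t X" if "X \<subseteq> blocks a" for X
  proof -
    have "\<forall>g n. g < L \<longrightarrow> n < a g \<longrightarrow> (\<exists>n'<a g. \<psi> (pos g n) = pos g n')"
      using \<psi>_pos \<sigma>_lt by blast
    then show ?thesis using assms(1) inj \<psi>_W that unfolding permutable_def by blast
  qed
  ultimately show ?thesis using bij unfolding mv_def by blast
qed

text \<open>The vectors that lie between \<open>c\<close> and \<open>c + M\<close> on
  \<open>J\<close> and equal \<open>c\<close> elsewhere give \<open>(M + 1) ^ card J\<close> sets of
  size affine in \<open>M\<close>. By \<open>bounded_to_one\<close> the number of them sharing a
  type is bounded independently of \<open>M\<close>.\<close>

lemma cnt_lower: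
  assumes permutable "distinguished J c" "J \<subseteq> {..<L}"
  shows "\<exists>K \<alpha> \<beta>. \<forall>M. (M + 1) ^ card J \<le> K * cnt (tower J c) (\<alpha> * M + \<beta>)"
proof -
  have finJ: "finite J" using assms(3) finite_subset by blast
  let ?f = "blocks c"
  let ?T = "blocks (\<lambda>_. card ?f)"
  let ?K = "card ?T ^ card ?f"
  let ?\<alpha> = "\<Sum>g<L. card (lam g)" and ?\<beta> = "card W + (\<Sum>g<L. c g * card (lam g))"
  have "(M + 1) ^ card J \<le> ?K * cnt (tower J c) (?\<alpha> * M + ?\<beta>)" for M
  proof -
    let ?A = "{a. \<forall>g. if g \<in> J then c g \<le> a g \<and> a g \<le> c g + M else a g = c g}"
    have A: "c g \<le> a g" "g \<notin> J \<Longrightarrow> a g = c g" "a g \<le> c g + M" if "a \<in> ?A" for a g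
      using that by (auto split: if_splits)
    have card_A: "card ?A = (M + 1) ^ card J" by (rule card_bounded_functions[OF finJ])
    then have finA: "finite ?A" by (intro card_ge_0_finite) simp
    have "card ?A \<le> card ((\<lambda>a. t (blocks a)) ` ?A) * ?K"
    proof (rule bounded_to_one)
      fix a S assume S: "a \<in> ?A" "S \<subseteq> blocks a" "card S \<le> card ?f"
      have "blocks (\<lambda>_. card S) \<subseteq> ?T" by (rule blocks_mono) (use S(3) in simp)
      then show "\<exists>\<pi>. bij_betw \<pi> (blocks a) (blocks a) \<and> \<pi> ` S \<subseteq> ?T \<and> (\<forall>X\<subseteq>blocks a. t (\<pi> ` X) = t X)"
        using push_blocks[OF assms(1) S(2)] by blast
    next
      fix a b \<theta> assume ab: "a \<in> ?A" "b \<in> ?A" "bij_betw \<theta> (blocks a) (blocks b)"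
        "\<forall>X\<subseteq>blocks a. t (\<theta> ` X) = t X" "\<forall>x\<in>?f. \<theta> x = x"
      have "\<forall>g. c g \<le> a g \<and> c g \<le> b g \<and> (g \<notin> J \<longrightarrow> a g = c g \<and> b g = c g)"
        using A(1,2)[OF ab(1)] A(1,2)[OF ab(2)] by simp
      from assms(2)[unfolded distinguished_def, THEN spec, THEN spec, THEN spec, THEN mp, OF this]
      show "a = b" using ab(3-5) by simp
    next
      fix a assume "a \<in> ?A"
      then have "blocks c \<subseteq> blocks a" by (intro blocks_mono A(1))
      then show "finite (blocks a) \<and> blocks a \<subseteq> E \<and> blocks c \<subseteq> blocks a"
        using finite_blocks blocks_E by blast
    qed (rule finite_blocks blocks_E finA)+
    moreover have "card ((\<lambda>a. t (blocks a)) ` ?A) \<le> cnt (tower J c) (?\<alpha> * M + ?\<beta>)"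
    proof (rule cnt_ge[OF tower_E])
      fix a assume a: "a \<in> ?A"
      have "blocks a \<subseteq> tower J c"
        using A(2)[OF a] by (force simp: blocks_def tower_def)
      moreover have "card (blocks a) \<le> ?\<alpha> * M + ?\<beta>"
      proof -
        have "(\<Sum>g<L. a g * card (lam g)) \<le> (\<Sum>g<L. (c g + M) * card (lam g))"
          by (intro sum_mono mult_right_mono A(3)[OF a]) simp
        also have "\<dots> = (\<Sum>g<L. c g * card (lam g)) + ?\<alpha> * M"
          by (simp add: sum.distrib algebra_simps sum_distrib_left)
        finally show ?thesis using card_blocks_le[of a] by linarith
      qed
      ultimately show "finite (blocks a) \<and> blocks a \<subseteq> tower J c \<and> card (blocks a) \<le> ?\<alpha> * M + ?\<beta>"
        using finite_blocks by blast
    qed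
    ultimately have "card ?A \<le> cnt (tower J c) (?\<alpha> * M + ?\<beta>) * ?K"
      by (meson mult_le_mono1 order_trans)
    then show ?thesis unfolding card_A by (simp only: mult.commute)
  qed
  then show ?thesis by blast
qed

text \<open>Towers over \<open>J\<close> with growing finite blocks exhaust the tower over
  \<open>J'\<close>. Each stage has growth of degree at most \<open>e\<close>, whereas the
  distinguished blocks \<open>K\<close> give the union degree \<open>card K > e\<close>. So no stage
  reaches the age of the union and \<open>R1_limit\<close> applies.\<close>

lemma R1_tower_step:
  assumes permutable "distinguished K c" "K \<subseteq> J'" "J \<subseteq> J'" "J' \<subseteq> {..<L}" "e < card K"
    and upper: "\<And>c'. (\<And>g. c g \<le> c' g) \<Longrightarrow> \<exists>B. \<forall>M. cnt (tower J c') M \<le> B * (M + 1) ^ e"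
    and d: "\<And>c'. (\<And>g. c g \<le> c' g) \<Longrightarrow> d \<le> R1 (ag (tower J c'))"
  shows "Suc d \<le> R1 (ag (tower J' c))"
proof -
  \<comment> \<open>Blocks of \<open>J'\<close> get at least \<open>x\<close> pieces, and no block
    drops below \<open>c\<close>, so \<open>upper\<close> and \<open>d\<close> are available at
    every stage.\<close>
  define c' where "c' x g = (if g \<in> J' then max x (c g) else c g)" for x g
  let ?X = "\<lambda>x. tower J (c' x)"
  have ge: "c g \<le> c' x g" for x g by (simp add: c'_def)
  have Un: "(\<Union>x. ?X x) = tower J' c"
  proof
    show "(\<Union>x. ?X x) \<subseteq> tower J' c"
      using assms(4) by (force simp: tower_def c'_def split: if_splits)
    show "tower J' c \<subseteq> (\<Union>x. ?X x)"
    proof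
      fix y assume "y \<in> tower J' c"
      then consider "y \<in> W" | g n x where "y = (pos g n, x)" "g < L" "x \<in> lam g" "g \<in> J' \<or> n < c g"
        by (auto simp: tower_def)
      then show "y \<in> (\<Union>x. ?X x)"
      proof cases
        case 2
        then have "n < c' (Suc n) g" by (auto simp: c'_def)
        then have "y \<in> ?X (Suc n)" using 2 by (auto simp: tower_def)
        then show ?thesis by blast
      qed (auto simp: tower_def)
    qed
  qed
  have "Suc d \<le> R1 (ag (\<Union>x. ?X x))"
  proof (rule R1_limit)
    fix x
    have "n < c' (Suc x) g" if "n < c' x g" for n g
      using that by (auto simp: c'_def split: if_splits)
    then show "?X x \<subseteq> ?X (Suc x)" by (fastforce simp: tower_def)
    show "?X x \<subseteq> E" by (rule tower_E)
    show "d \<le> R1 (ag (?X x))" by (rule d[OF ge])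
    show "ag (?X x) \<noteq> ag (\<Union>x. ?X x)"
    proof
      assume "ag (?X x) = ag (\<Union>x. ?X x)"
      then have eq: "cnt (?X x) M = cnt (tower J' c) M" for M
        unfolding Un by (rule cnt_cong[OF tower_E tower_E])
      obtain B where B: "\<And>M. cnt (?X x) M \<le> B * (M + 1) ^ e" using upper[of "c' x", OF ge] by blast
      have "K \<subseteq> {..<L}" using assms(3,5) by blast
      then obtain B' \<alpha> \<beta> where B': "\<And>M. (M + 1) ^ card K \<le> B' * cnt (tower K c) (\<alpha> * M + \<beta>)"
        using cnt_lower[OF assms(1,2)] by blast
      have "tower K c \<subseteq> tower J' c" using assms(3) by (auto simp: tower_def)
      then have cnt_K: "cnt (tower K c) M \<le> cnt (tower J' c) M" for M by (rule cnt_mono[OF _ tower_E])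
      have "(M + 1) ^ Suc e \<le> B' * B * (\<alpha> * M + \<beta> + 1) ^ e" for M
      proof -
        have "(M + 1) ^ Suc e \<le> (M + 1) ^ card K" by (rule power_increasing) (use assms(6) in auto)
        also have "\<dots> \<le> B' * cnt (tower K c) (\<alpha> * M + \<beta>)" by (rule B')
        also have "\<dots> \<le> B' * (B * (\<alpha> * M + \<beta> + 1) ^ e)"
          using B[of "\<alpha> * M + \<beta>"] cnt_K[of "\<alpha> * M + \<beta>"] unfolding eq by (intro mult_left_mono) auto
        finally show ?thesis by (simp only: mult.assoc)
      qed
      moreover obtain M where "B' * B * (\<alpha> * M + \<beta> + 1) ^ e < (M + 1) ^ Suc e"
        using growth_gap[of "B' * B" \<alpha> \<beta> e] by blast
      ultimately show False by (meson not_less)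
    qed
  qed
  then show ?thesis unfolding Un .
qed

end

subsection \<open>Free movement of pieces\<close>

text \<open>Indiscernibility is \<open>comm 1\<close>. The rank forces the step from \<open>b\<close> to \<open>Suc b\<close>, so all pieces
  move freely in the end.\<close>

definition (in type_system) comm :: "nat \<Rightarrow> bool" where
  "comm b \<longleftrightarrow> (\<forall>F g. finite F \<longrightarrow> F \<subseteq> E \<longrightarrow> inj_on g (fst ` F) \<longrightarrow>
     strict_mono_on {i \<in> fst ` F. b \<le> card (trace F i)} g \<longrightarrow> t (mv g F) = t F)"

text \<open>A piece \<open>\<beta>\<close> of size \<open>b\<close> that cannot be moved across a piece \<open>\<alpha>\<close> in the context \<open>V\<close>.
  Placing \<open>L\<close> copies of \<open>\<alpha>\<close> creates \<open>L\<close> gaps whose numbers of copies of \<open>\<beta>\<close> can be recovered, so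
  that the rank is large.\<close>

locale crossing = type_system +
  fixes b :: nat and \<alpha> \<beta> :: "nat set" and V :: "(rat \<times> nat) set" and lo hi x0 y0 y1 :: rat and L :: nat
  assumes comm_b: "comm b" and b: "1 \<le> b" "card \<beta> = b" "\<beta> \<subseteq> C" and \<alpha>: "\<alpha> \<subseteq> C"
    and V: "finite V" "V \<subseteq> E" "\<And>x. x \<in> fst ` V \<Longrightarrow> x < lo \<or> hi < x"
    and order: "lo \<le> y0" "y0 < x0" "x0 < y1" "y1 \<le> hi"
    and diff: "t (V \<union> {x0} \<times> \<alpha> \<union> {y0} \<times> \<beta>) \<noteq> t (V \<union> {x0} \<times> \<alpha> \<union> {y1} \<times> \<beta>)"
begin

text \<open>Affine, with -1 sent to \<open>lo\<close> and \<open>L + 2\<close> to \<open>hi\<close>: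
  arguments from 0 to below \<open>L + 1\<close>, the only ones used for copies and gaps, land
  strictly inside, away from \<open>V\<close>.\<close>

definition \<phi> :: "rat \<Rightarrow> rat" where "\<phi> x = lo + (hi - lo) / (of_nat L + 3) * (x + 1)"

text \<open>The places of gap \<open>g\<close> descend towards \<open>\<phi> g\<close> and stay
  below \<open>\<phi> (g + 1)\<close>, so infinitely many pieces fit between neighbouring copies of
  \<open>\<alpha>\<close>.\<close>

definition pos :: "nat \<Rightarrow> nat \<Rightarrow> rat" where "pos g n = \<phi> (of_nat g + 1 / (of_nat n + 2))"

definition W :: "(rat \<times> nat) set" where "W = V \<union> (\<Union>g<L. {\<phi> (of_nat g)} \<times> \<alpha>)"

lemma lo_hi: "lo < hi" using order by linarith

lemma \<phi>_less: "\<phi> x < \<phi> y \<longleftrightarrow> x < y"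
proof -
  have "0 < (hi - lo) / (of_nat L + 3)" using lo_hi by (intro divide_pos_pos) (auto intro: add_nonneg_pos)
  then show ?thesis unfolding \<phi>_def by (simp only: add_less_cancel_left mult_less_cancel_left_pos add_less_cancel_right)
qed

lemma \<phi>_bounds:
  assumes "0 \<le> x" "x < of_nat L + 1"
  shows "lo < \<phi> x" "\<phi> x < hi"
proof -
  have "\<phi> (- 1) = lo" by (simp add: \<phi>_def)
  then show "lo < \<phi> x" using \<phi>_less[of "- 1" x] assms by simp
  have "\<phi> (of_nat L + 2) = hi" by (simp add: \<phi>_def field_simps)
  then show "\<phi> x < hi" using \<phi>_less[of x "of_nat L + 2"] assms by simp
qed

lemma frac: "0 < 1 / (of_nat n + 2 :: rat)" "1 / (of_nat n + 2 :: rat) < 1"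
  by (auto simp: divide_simps)

lemma pos_bounds: "\<phi> (of_nat g) < pos g n" "pos g n < \<phi> (of_nat g + 1)"
  using frac[of n] by (simp_all add: pos_def \<phi>_less)

lemma pos_less: "g < g' \<Longrightarrow> pos g n < pos g' n'"
proof -
  assume "g < g'"
  then have "of_nat g + 1 \<le> (of_nat g' :: rat)"
    by (metis Suc_leI add.commute of_nat_Suc of_nat_mono)
  then have "\<phi> (of_nat g + 1) \<le> \<phi> (of_nat g')" using \<phi>_less by (meson not_le)
  then show ?thesis using pos_bounds(2)[of g n] pos_bounds(1)[of g' n'] by linarith
qed

lemma pos_less_\<phi>: "pos g n < \<phi> (of_nat g') \<longleftrightarrow> g < g'" "\<phi> (of_nat g') < pos g n \<longleftrightarrow> g' \<le> g"
proof -
  have 1: "pos g n < \<phi> (of_nat g')" if "g < g'"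
  proof -
    have "of_nat g + 1 \<le> (of_nat g' :: rat)"
      using that by (metis Suc_leI add.commute of_nat_Suc of_nat_mono)
    then have "\<phi> (of_nat g + 1) \<le> \<phi> (of_nat g')" using \<phi>_less by (meson not_le)
    then show ?thesis using pos_bounds(2)[of g n] by linarith
  qed
  have 2: "\<phi> (of_nat g') < pos g n" if "g' \<le> g"
  proof -
    have "\<phi> (of_nat g') \<le> \<phi> (of_nat g)" using \<phi>_less that by (meson not_le of_nat_le_iff)
    then show ?thesis using pos_bounds(1)[of g n] by linarith
  qed
  show "pos g n < \<phi> (of_nat g') \<longleftrightarrow> g < g'" "\<phi> (of_nat g') < pos g n \<longleftrightarrow> g' \<le> g"
    using 1 2 by (meson not_le order_less_asym)+
qed

lemma pos_bnd: "g < L \<Longrightarrow> lo < pos g n" "g < L \<Longrightarrow> pos g n < hi"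
proof -
  assume "g < L"
  then have "(of_nat g :: rat) < of_nat L" by simp
  then have "0 \<le> of_nat g + 1 / (of_nat n + 2 :: rat)" "of_nat g + 1 / (of_nat n + 2 :: rat) < of_nat L + 1"
    using frac[of n] by linarith+
  then show "lo < pos g n" "pos g n < hi" unfolding pos_def by (rule \<phi>_bounds)+
qed

lemma \<phi>_bnd: "g < L \<Longrightarrow> lo < \<phi> (of_nat g)" "g < L \<Longrightarrow> \<phi> (of_nat g) < hi"
proof -
  assume "g < L"
  then have "(of_nat g :: rat) < of_nat L" by simp
  then show "lo < \<phi> (of_nat g)" "\<phi> (of_nat g) < hi" by (auto intro!: \<phi>_bounds)
qed

lemma fst_W: "x \<in> fst ` W \<Longrightarrow> x \<in> fst ` V \<or> (\<exists>g<L. x = \<phi> (of_nat g))"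
  by (auto simp: W_def)

lemma W_pos: "w \<in> fst ` W \<Longrightarrow> g < L \<Longrightarrow> w < pos g n \<longleftrightarrow> w < pos g n'"
  "w \<in> fst ` W \<Longrightarrow> g < L \<Longrightarrow> w \<noteq> pos g n"
proof -
  assume w: "w \<in> fst ` W" "g < L"
  from fst_W[OF w(1)] have "(w < pos g n \<longleftrightarrow> w < pos g n') \<and> w \<noteq> pos g n"
  proof (elim disjE exE conjE)
    assume "w \<in> fst ` V"
    then have "w < lo \<or> hi < w" by (rule V)
    then show ?thesis
      using pos_bnd[OF w(2), of n] pos_bnd[OF w(2), of n'] by (auto dest: less_trans)
  next
    fix g' assume "w = \<phi> (of_nat g')"
    then show ?thesis
      using pos_less_\<phi>(2)[of g' g n] pos_less_\<phi>(2)[of g' g n'] pos_less_\<phi>(1)[of g n g'] by fastforce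
  qed
  then show "w < pos g n \<longleftrightarrow> w < pos g n'" "w \<noteq> pos g n" by blast+
qed

end

sublocale crossing \<subseteq> block_system C t R1 R2 \<kappa> L "\<lambda>_. \<beta>" pos W
proof
  show "pos g n = pos g' n' \<Longrightarrow> g = g' \<and> n = n'" for g g' n n'
  proof -
    assume eq: "pos g n = pos g' n'"
    then have "g = g'" using pos_less[of g g' n n'] pos_less[of g' g n' n] by (metis less_irrefl neqE)
    moreover have "(of_nat n :: rat) = of_nat n'"
    proof -
      have "\<not> \<phi> (of_nat g + 1 / (of_nat n + 2)) < \<phi> (of_nat g + 1 / (of_nat n' + 2))"
        "\<not> \<phi> (of_nat g + 1 / (of_nat n' + 2)) < \<phi> (of_nat g + 1 / (of_nat n + 2))"
        using eq \<open>g = g'\<close> by (simp_all add: pos_def)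
      then have "1 / (of_nat n + 2) = 1 / (of_nat n' + 2 :: rat)" by (simp add: \<phi>_less)
      moreover have "(of_nat n + 2 :: rat) > 0" "(of_nat n' + 2 :: rat) > 0" by (simp_all add: add_nonneg_pos)
      ultimately show ?thesis by (simp add: frac_eq_eq)
    qed
    ultimately show ?thesis by simp
  qed
  show "finite W"
    unfolding W_def using V(1) finite_subset[OF \<alpha> fin_C] by auto
  show "W \<subseteq> E" unfolding W_def using V(2) \<alpha> by auto
  show "pos g n \<notin> fst ` W" if "g < L" for g n using W_pos(2)[of "pos g n" g n] that by blast
  show "\<beta> \<subseteq> C" by (rule b)
qed

context crossing
begin

definition full :: "(rat \<times> nat) set \<Rightarrow> nat \<Rightarrow> nat" where
  "full F g = card {x \<in> fst ` F. (\<exists>n. x = pos g n) \<and> trace F x = \<beta>}"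

text \<open>Used for proper subsets \<open>q\<close> of \<open>\<beta>\<close>. They have fewer than
  \<open>b\<close> points, so \<open>comm_b\<close> places them freely and their gap is not
  recorded.\<close>

definition small :: "(rat \<times> nat) set \<Rightarrow> nat set \<Rightarrow> nat" where
  "small F q = card {x \<in> fst ` F. x \<notin> fst ` W \<and> trace F x = q}"

definition all :: "(rat \<times> nat) set" where
  "all = W \<union> {(pos g n, c) |g n c. g < L \<and> c \<in> \<beta>}"

lemma all_E: "all \<subseteq> E"
  using W(2) b(3) by (auto simp: all_def)

lemma all_idx: "F \<subseteq> all \<Longrightarrow> x \<in> fst ` F \<Longrightarrow> x \<in> fst ` W \<or> (\<exists>g<L. \<exists>n. x = pos g n)"
  by (force simp: all_def)

lemma pos_notin_W: "g < L \<Longrightarrow> pos g n \<notin> fst ` W"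
  using W_pos(2)[of "pos g n" g n] by blast

lemma trace_W: "F \<subseteq> all \<Longrightarrow> x \<in> fst ` W \<Longrightarrow> trace F x = trace (F \<inter> W) x"
proof -
  assume F: "F \<subseteq> all" "x \<in> fst ` W"
  have "(x, c) \<in> W" if "(x, c) \<in> F" for c
  proof (rule ccontr)
    assume "(x, c) \<notin> W"
    moreover have "(x, c) \<in> all" using F(1) that by blast
    ultimately obtain g n where "g < L" "x = pos g n" by (auto simp: all_def)
    then show False using F(2) pos_notin_W by blast
  qed
  then show ?thesis by auto
qed

lemma trace_pos: "F \<subseteq> all \<Longrightarrow> g < L \<Longrightarrow> trace F (pos g n) \<subseteq> \<beta>"
proof -
  assume F: "F \<subseteq> all" "g < L"
  then have "(pos g n, c) \<notin> W" for c using pos_notin_W by (metis fst_conv image_eqI)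
  then show ?thesis using F by (auto simp: all_def)
qed

lemma finite_\<beta>: "finite \<beta>"
  using b(3) fin_C finite_subset by blast

text \<open>Equal data let \<open>regroup\<close> move \<open>F\<close> onto \<open>G\<close> with
  the indices of \<open>W\<close> fixed and each complete \<open>\<beta>\<close> kept in its gap.
  Gaps keep their order, and within a gap the move is increasing; so it is increasing on all pieces
  with at least \<open>b\<close> points and \<open>comm_b\<close> applies.\<close>

lemma t_eq_of_data:
  assumes F: "finite F" "F \<subseteq> all" and G: "finite G" "G \<subseteq> all"
    and W_eq: "F \<inter> W = G \<inter> W" and full: "\<And>g. g < L \<Longrightarrow> full F g = full G g"
    and small: "\<And>q. q \<subset> \<beta> \<Longrightarrow> small F q = small G q"
  shows "t F = t G"
proof -
  define blk where "blk x = (THE g. g < L \<and> (\<exists>n. x = pos g n))" for x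
  have blk: "blk (pos g n) = g" if "g < L" for g n
    unfolding blk_def using that pos_inj by (intro the_equality) blast+
  \<comment> \<open>Indices of \<open>W\<close> are kept one by one, complete pieces by their gap,
    incomplete ones by their trace only. The entries \<open>0\<close> and \<open>{}\<close> are
    fillers.\<close>
  define cl where "cl F x = (if x \<in> fst ` W then (Some x, 0, {})
    else if trace F x = \<beta> then (None, blk x, \<beta>) else (None, 0, trace F x))" for F x
  have W_idx: "{x \<in> fst ` F. x \<in> fst ` W} = fst ` (F \<inter> W)" if "F \<subseteq> all" for F
  proof
    show "{x \<in> fst ` F. x \<in> fst ` W} \<subseteq> fst ` (F \<inter> W)"
      using trace_W[OF that] trace_nonempty by (metis (no_types, lifting) mem_Collect_eq subsetI)
  qed auto
  have trace_eq: "trace F x = trace G y" if "x \<in> fst ` F" "y \<in> fst ` G" "cl F x = cl G y" for x y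
    using that trace_W[OF F(2), of x] trace_W[OF G(2), of y] W_eq
    by (auto simp: cl_def split: if_splits)
  have card_eq: "card {x \<in> fst ` F. cl F x = key} = card {x \<in> fst ` G. cl G x = key}" for key
  proof -
    obtain o1 g q where key: "key = (o1, g, q)" by (cases key)
    show ?thesis
    proof (cases o1)
      case (Some w)
      have *: "{x \<in> fst ` F. cl F x = key} = (if g = 0 \<and> q = {} then fst ` (F \<inter> W) \<inter> {w} else {})"
        if "F \<subseteq> all" for F
        unfolding W_idx[OF that, symmetric] by (auto simp: cl_def key Some split: if_splits)
      show ?thesis unfolding *[OF F(2)] *[OF G(2)] W_eq ..
    next
      case None
      show ?thesis
      proof (cases "q = \<beta>")
        case True
        have *: "{x \<in> fst ` F. cl F x = key} = (if g < L then {x \<in> fst ` F. (\<exists>n. x = pos g n) \<and> trace F x = \<beta>} else {})"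
          if "F \<subseteq> all" for F
        proof -
          have "cl F x = key \<longleftrightarrow> g < L \<and> (\<exists>n. x = pos g n) \<and> trace F x = \<beta>" if x: "x \<in> fst ` F" for x
          proof (cases "x \<in> fst ` W")
            case True
            moreover have "x \<noteq> pos g n" if "g < L" for n using True pos_notin_W[OF that] by blast
            ultimately show ?thesis by (auto simp: cl_def key None)
          next
            case False
            then obtain g' n' where g': "g' < L" "x = pos g' n'" using all_idx[OF \<open>F \<subseteq> all\<close> x] by blast
            show ?thesis
            proof
              assume "cl F x = key"
              then have "trace F x = \<beta>" "blk x = g"
                using False \<open>q = \<beta>\<close> by (auto simp: cl_def key None split: if_splits)
              then show "g < L \<and> (\<exists>n. x = pos g n) \<and> trace F x = \<beta>" using g' blk by auto
            next
              assume "g < L \<and> (\<exists>n. x = pos g n) \<and> trace F x = \<beta>"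
              then show "cl F x = key" using False \<open>q = \<beta>\<close> blk by (auto simp: cl_def key None)
            qed
          qed
          then show ?thesis by (cases "g < L") auto
        qed
        show ?thesis unfolding *[OF F(2)] *[OF G(2)] using full by (simp add: full_def)
      next
        case False
        have *: "{x \<in> fst ` F. cl F x = key} = (if g = 0 then {x \<in> fst ` F. x \<notin> fst ` W \<and> trace F x = q} else {})"
          if "F \<subseteq> all" for F
          using False by (auto simp: cl_def key None split: if_splits)
        have emp: "{x \<in> fst ` F. x \<notin> fst ` W \<and> trace F x = q} = {}" if "\<not> q \<subset> \<beta>" "F \<subseteq> all" for F
        proof -
          have "trace F x \<noteq> q" if x: "x \<in> fst ` F" "x \<notin> fst ` W" for x
          proof -
            obtain g n where "g < L" "x = pos g n" using all_idx[OF \<open>F \<subseteq> all\<close> x(1)] x(2) by blast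
            then have "trace F x \<subseteq> \<beta>" using trace_pos[OF \<open>F \<subseteq> all\<close>] by simp
            then show ?thesis using \<open>\<not> q \<subset> \<beta>\<close> False by auto
          qed
          then show ?thesis by auto
        qed
        have "small F q = small G q"
        proof (cases "q \<subset> \<beta>")
          case False
          show ?thesis unfolding small_def emp[OF False F(2)] emp[OF False G(2)] ..
        qed (rule small)
        then show ?thesis unfolding *[OF F(2)] *[OF G(2)] by (simp add: small_def)
      qed
    qed
  qed
  obtain h where h: "inj_on h (fst ` F)" "mv h F = G" "\<And>x. x \<in> fst ` F \<Longrightarrow> h x \<in> fst ` G"
    "\<And>x. x \<in> fst ` F \<Longrightarrow> cl G (h x) = cl F x"
    "\<And>x y. x \<in> fst ` F \<Longrightarrow> y \<in> fst ` F \<Longrightarrow> cl F x = cl F y \<Longrightarrow> x < y \<Longrightarrow> h x < h y"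
    by (rule regroup[where F = F and F' = G and cl = "cl F" and cl' = "cl G"])
      (use F(1) G(1) trace_eq card_eq in auto)
  have hW: "h x = x" if "x \<in> fst ` F" "x \<in> fst ` W" for x
    using h(4)[OF that(1)] that(2) by (auto simp: cl_def split: if_splits)
  have hpos: "\<exists>g n n'. g < L \<and> x = pos g n \<and> h x = pos g n' \<and> cl F x = (None, g, \<beta>)"
    if x: "x \<in> fst ` F" "x \<notin> fst ` W" "b \<le> card (trace F x)" for x
  proof -
    obtain g n where g: "g < L" "x = pos g n" using all_idx[OF F(2) x(1)] x(2) by blast
    then have tr: "trace F x = \<beta>"
      using card_seteq[OF finite_\<beta> trace_pos[OF F(2) g(1)]] x(3) b(2) by simp
    then have cl: "cl F x = (None, g, \<beta>)" using g x(2) blk by (simp add: cl_def)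
    then have cl': "cl G (h x) = (None, g, \<beta>)" using h(4)[OF x(1)] by simp
    then have "h x \<notin> fst ` W" by (auto simp: cl_def split: if_splits)
    then obtain g' n' where g': "g' < L" "h x = pos g' n'" using all_idx[OF G(2) h(3)[OF x(1)]] by blast
    have "g' = g" using cl' g' blk \<open>h x \<notin> fst ` W\<close> by (auto simp: cl_def split: if_splits)
    then show ?thesis using g g' cl by blast
  qed
  have "strict_mono_on {x \<in> fst ` F. b \<le> card (trace F x)} h"
  proof (rule strict_mono_onI)
    fix x y assume xy: "x \<in> {x \<in> fst ` F. b \<le> card (trace F x)}" "y \<in> {x \<in> fst ` F. b \<le> card (trace F x)}" "x < y"
    show "h x < h y"
    proof (cases "x \<in> fst ` W"; cases "y \<in> fst ` W")
      assume "x \<in> fst ` W" "y \<in> fst ` W"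
      then show ?thesis using xy hW by auto
    next
      assume w: "x \<in> fst ` W" "y \<notin> fst ` W"
      then obtain g n n' where "g < L" "y = pos g n" "h y = pos g n'" using hpos[of y] xy by blast
      then show ?thesis using xy w hW[of x] W_pos(1)[of x g n n'] by auto
    next
      assume w: "x \<notin> fst ` W" "y \<in> fst ` W"
      then obtain g n n' where g: "g < L" "x = pos g n" "h x = pos g n'" using hpos[of x] xy by blast
      have "\<not> y < pos g n'" "y \<noteq> pos g n'"
        using W_pos(1)[OF w(2) g(1), of n n'] W_pos(2)[OF w(2) g(1), of n'] xy(3) g(2) by auto
      then show ?thesis using xy w hW[of y] g(3) by auto
    next
      assume w: "x \<notin> fst ` W" "y \<notin> fst ` W"
      then obtain g n n' where g: "g < L" "x = pos g n" "h x = pos g n'" "cl F x = (None, g, \<beta>)"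
        using hpos[of x] xy by blast
      obtain g' m m' where g': "g' < L" "y = pos g' m" "h y = pos g' m'" "cl F y = (None, g', \<beta>)"
        using hpos[of y] xy w by blast
      have "g \<le> g'" using pos_less[of g' g m n] xy(3) g(2) g'(2) by (metis not_le order_less_asym)
      then consider "g < g'" | "g = g'" by linarith
      then show ?thesis
      proof cases
        case 1
        then show ?thesis using pos_less g(3) g'(3) by simp
      next
        case 2
        then show ?thesis using h(5)[of x y] xy g(4) g'(4) by auto
      qed
    qed
  qed
  then have "t (mv h F) = t F"
    using comm_b F all_E h(1) unfolding comm_def by blast
  then show ?thesis using h(2) by simp
qed

text \<open>By \<open>t_eq_of_data\<close> there is one unbounded counter for each infinite gap and
  one for each subset of \<open>\<beta>\<close>. The latter number \<open>2 ^ b\<close>, however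
  many gaps there are.\<close>

lemma cnt_upper:
  assumes "k \<le> L"
  shows "\<exists>K. \<forall>M. cnt (tower {..<k} c) M \<le> K * (M + 1) ^ (k + 2 ^ b)"
proof -
  let ?Y = "tower {..<k} c"
  let ?K = "2 ^ card W * (\<Prod>g<L. c g + 1)"
  have Y: "?Y \<subseteq> all" by (auto simp: tower_def all_def)
  have "cnt ?Y M \<le> ?K * (M + 1) ^ (k + 2 ^ b)" for M
  proof -
    let ?U = "\<lambda>g. {..if g < k then M else c g}"
    let ?S = "Pow W \<times> PiE {..<L} ?U \<times> PiE (Pow \<beta>) (\<lambda>_. {..M})"
    have "cnt ?Y M \<le> card ?S"
    proof (rule cnt_le[where D = "\<lambda>F. (F \<inter> W, restrict (full F) {..<L}, restrict (small F) (Pow \<beta>))"])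
      show "finite ?S" using W(1) finite_\<beta> by (auto intro!: finite_PiE)
    next
      fix F assume F: "finite F" "F \<subseteq> ?Y" "card F \<le> M"
      have le: "card A \<le> M" if "A \<subseteq> fst ` F" for A
      proof -
        have "card A \<le> card (fst ` F)" by (rule card_mono) (use F(1) that in auto)
        also have "\<dots> \<le> card F" by (rule card_image_le[OF F(1)])
        finally show ?thesis using F(3) by linarith
      qed
      have "full F g \<le> M" for g unfolding full_def by (rule le) auto
      moreover have "full F g \<le> c g" if g: "g < L" "\<not> g < k" for g
      proof -
        have "n < c g" if n: "pos g n \<in> fst ` F" for n
        proof -
          obtain x where "(pos g n, x) \<in> F" using n by (auto simp: image_iff)
          then have "(pos g n, x) \<in> ?Y" using F(2) by blast
          moreover have "(pos g n, x) \<notin> W" using pos_notin_W[OF g(1)] by (metis fst_conv image_eqI)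
          ultimately obtain g' n' where gn: "pos g n = pos g' n'" "g' < L" "g' < k \<or> n' < c g'"
            by (auto simp: tower_def)
          have "g = g' \<and> n = n'" by (rule pos_inj[OF g(1) gn(2,1)])
          then show ?thesis using gn(3) g(2) by auto
        qed
        then have "x \<in> pos g ` {..<c g}" if "x \<in> fst ` F" "x = pos g n" for x n
          using that by simp
        then have "{x \<in> fst ` F. (\<exists>n. x = pos g n) \<and> trace F x = \<beta>} \<subseteq> pos g ` {..<c g}" by blast
        then have "full F g \<le> card (pos g ` {..<c g})" unfolding full_def by (rule card_mono[rotated]) simp
        also have "\<dots> \<le> c g" using card_image_le[of "{..<c g}" "pos g"] by simp
        finally show ?thesis .
      qed
      moreover have "small F q \<le> M" for q unfolding small_def by (rule le) auto
      ultimately show "(F \<inter> W, restrict (full F) {..<L}, restrict (small F) (Pow \<beta>)) \<in> ?S"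
        by auto
    next
      fix F G assume F: "finite F" "F \<subseteq> ?Y" and G: "finite G" "G \<subseteq> ?Y"
        and eq: "(F \<inter> W, restrict (full F) {..<L}, restrict (small F) (Pow \<beta>)) =
          (G \<inter> W, restrict (full G) {..<L}, restrict (small G) (Pow \<beta>))"
      show "t F = t G"
      proof (rule t_eq_of_data)
        show "full F g = full G g" if "g < L" for g
          using eq that by (metis lessThan_iff prod.inject restrict_apply')
        show "small F q = small G q" if "q \<subset> \<beta>" for q
          using eq that by (metis PowI prod.inject psubset_imp_subset restrict_apply')
      qed (use F G Y eq in auto)
    qed
    also have "card ?S = 2 ^ card W * ((\<Prod>g<L. (if g < k then M else c g) + 1) * (M + 1) ^ (2 ^ b))"
      using W(1) finite_\<beta> b(2) by (simp add: card_cartesian_product card_PiE card_Pow)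
    also have "\<dots> \<le> 2 ^ card W * (((M + 1) ^ k * (\<Prod>g<L. c g + 1)) * (M + 1) ^ (2 ^ b))"
    proof (intro mult_left_mono mult_right_mono)
      have "(\<Prod>g<L. (if g < k then M else c g) + 1) \<le> (\<Prod>g<L. (if g < k then M + 1 else 1) * (c g + 1))"
        by (rule prod_mono) auto
      also have "\<dots> = (\<Prod>g<L. if g < k then M + 1 else 1) * (\<Prod>g<L. c g + 1)" by (rule prod.distrib)
      also have "(\<Prod>g<L. if g < k then M + 1 else 1) = (\<Prod>g\<in>{g \<in> {..<L}. g < k}. M + 1)"
        by (rule prod.inter_filter[symmetric]) simp
      also have "{g \<in> {..<L}. g < k} = {..<k}" using assms by auto
      also have "(\<Prod>g<k. M + 1) = (M + 1) ^ k" by simp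
      finally show "(\<Prod>g<L. (if g < k then M else c g) + 1) \<le> (M + 1) ^ k * (\<Prod>g<L. c g + 1)" .
    qed auto
    also have "\<dots> = ?K * (M + 1) ^ (k + 2 ^ b)" by (simp only: power_add mult.assoc mult.left_commute)
    finally show ?thesis .
  qed
  then show ?thesis by blast
qed

end

lemma card_image_eq:
  assumes "inj_on f A" "f ` A = B"
  shows "card A = card B"
  using card_image[OF assms(1)] assms(2) by simp

lemma mem_mv: "z \<in> mv g F \<longleftrightarrow> (\<exists>i c. (i, c) \<in> F \<and> z = (g i, c))"
  by (force simp: mv_def)

lemma sum_tails_eq:
  fixes a b :: "nat \<Rightarrow> nat"
  assumes "\<And>g0. g0 < L \<Longrightarrow> (\<Sum>g\<in>{g0..<L}. a g) = (\<Sum>g\<in>{g0..<L}. b g)" "g < L"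
  shows "a g = b g"
proof (cases "Suc g < L")
  case True
  have "(\<Sum>g\<in>{g..<L}. f g) = f g + (\<Sum>g\<in>{Suc g..<L}. f g)" for f :: "nat \<Rightarrow> nat"
    using assms(2) by (rule sum.atLeast_Suc_lessThan)
  then show ?thesis using assms(1)[OF assms(2)] assms(1)[OF True] by simp
next
  case False
  then have "{g..<L} = {g}" using assms(2) by auto
  then show ?thesis using assms(1)[OF assms(2)] by simp
qed

context crossing
begin

lemma blocks_all: "blocks a \<subseteq> all"
  by (auto simp: blocks_def all_def)

text \<open>Permuting the pieces inside each gap leaves the data of \<open>t_eq_of_data\<close>
  unchanged.\<close>

lemma permutable: permutable
  unfolding permutable_def
proof (intro allI impI)
  fix a \<psi> X
  assume inj: "inj_on \<psi> (fst ` blocks a)" and \<psi>W: "\<forall>i\<in>fst ` W. \<psi> i = i"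
    and \<psi>pos: "\<forall>g n. g < L \<longrightarrow> n < a g \<longrightarrow> (\<exists>n'<a g. \<psi> (pos g n) = pos g n')" and X: "X \<subseteq> blocks a"
  have finX: "finite X" using X finite_blocks finite_subset by blast
  have injX: "inj_on \<psi> (fst ` X)" by (rule inj_on_subset[OF inj]) (use X in blast)
  have idx: "x \<in> fst ` W \<or> (\<exists>g n. g < L \<and> n < a g \<and> x = pos g n)" if "x \<in> fst ` X" for x
    using that X by (force simp: blocks_def)
  have \<psi>W_iff: "\<psi> x \<in> fst ` W \<longleftrightarrow> x \<in> fst ` W" if "x \<in> fst ` X" for x
    using idx[OF that] \<psi>W \<psi>pos pos_notin_W by metis
  have \<psi>pos_iff: "(\<exists>n. \<psi> x = pos g n) \<longleftrightarrow> (\<exists>n. x = pos g n)" if x: "x \<in> fst ` X" and g: "g < L" for x g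
    using idx[OF x]
  proof (elim disjE exE conjE)
    assume "x \<in> fst ` W"
    then have "\<psi> x = x" using \<psi>W by blast
    then show ?thesis by simp
  next
    fix g' n assume g': "g' < L" "n < a g'" "x = pos g' n"
    then obtain n' where "\<psi> x = pos g' n'" using \<psi>pos by blast
    then show ?thesis using pos_inj[OF g g'(1)] g'(3) by metis
  qed
  let ?Y = "mv \<psi> X"
  have Y: "?Y \<subseteq> all"
  proof
    fix y assume "y \<in> ?Y"
    then obtain x c where x: "(x, c) \<in> X" "y = (\<psi> x, c)" by (auto simp: mv_def)
    show "y \<in> all"
    proof (cases "(x, c) \<in> W")
      case True
      then have "\<psi> x = x" using \<psi>W by force
      then show ?thesis using x True by (simp add: all_def)
    next
      case False
      then obtain g n where g: "g < L" "n < a g" "x = pos g n" "c \<in> \<beta>"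
        using x(1) X by (auto simp: blocks_def)
      then obtain n' where "\<psi> x = pos g n'" using \<psi>pos by blast
      then show ?thesis using x g by (auto simp: all_def)
    qed
  qed
  have card: "card {y \<in> fst ` ?Y. P' y} = card {x \<in> fst ` X. P x}"
    if P: "\<And>x. x \<in> fst ` X \<Longrightarrow> P' (\<psi> x) \<longleftrightarrow> P x" for P P'
  proof (rule card_image_eq[symmetric, where f = \<psi>])
    show "inj_on \<psi> {x \<in> fst ` X. P x}" by (rule inj_on_subset[OF injX]) auto
    show "\<psi> ` {x \<in> fst ` X. P x} = {y \<in> fst ` ?Y. P' y}"
      unfolding fst_mv using P by (auto simp del: split_paired_All)
  qed
  have tr: "trace ?Y (\<psi> x) = trace X x" if "x \<in> fst ` X" for x
    by (rule trace_mv[OF injX that])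
  show "t ?Y = t X"
  proof (rule t_eq_of_data[OF finite_mv[OF finX] Y finX order_trans[OF X blocks_all]])
    show "?Y \<inter> W = X \<inter> W"
    proof
      show "X \<inter> W \<subseteq> ?Y \<inter> W"
      proof
        fix y assume y: "y \<in> X \<inter> W"
        obtain x c where x: "y = (x, c)" by (cases y)
        then have "x \<in> fst ` W" using y by force
        then have "\<psi> x = x" using \<psi>W by blast
        then have "y \<in> ?Y" unfolding mem_mv using x y by (intro exI[of _ x] exI[of _ c]) auto
        then show "y \<in> ?Y \<inter> W" using y by blast
      qed
      show "?Y \<inter> W \<subseteq> X \<inter> W"
      proof
        fix y assume y: "y \<in> ?Y \<inter> W"
        then obtain x c where x: "(x, c) \<in> X" "y = (\<psi> x, c)" by (auto simp: mv_def)
        then have "\<psi> x \<in> fst ` W" using y by force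
        then have "x \<in> fst ` W" using \<psi>W_iff x(1) by (metis fst_conv image_eqI)
        then show "y \<in> X \<inter> W" using x y \<psi>W by simp
      qed
    qed
    show "full ?Y g = full X g" if "g < L" for g
      unfolding full_def by (rule card) (use that \<psi>pos_iff tr in simp)
    show "small ?Y q = small X q" for q
      unfolding small_def by (rule card) (use \<psi>W_iff tr in simp)
  qed
qed

lemma t_before: "g' < g \<Longrightarrow> g < L \<Longrightarrow>
    t (V \<union> {\<phi> (of_nat g)} \<times> \<alpha> \<union> {pos g' n} \<times> \<beta>) = t (V \<union> {x0} \<times> \<alpha> \<union> {y0} \<times> \<beta>)"
  and t_after: "g \<le> g' \<Longrightarrow> g' < L \<Longrightarrow>
    t (V \<union> {\<phi> (of_nat g)} \<times> \<alpha> \<union> {pos g' n} \<times> \<beta>) = t (V \<union> {x0} \<times> \<alpha> \<union> {y1} \<times> \<beta>)"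
proof -
  \<comment> \<open>Only the two indices \<open>x\<close> and \<open>y\<close> lie between
    \<open>lo\<close> and \<open>hi\<close>, so by indiscernibility just their relative order
    matters.\<close>
  have *: "t (V \<union> {x} \<times> \<alpha> \<union> {y} \<times> \<beta>) = t (V \<union> {x0} \<times> \<alpha> \<union> {y'} \<times> \<beta>)"
    if xy: "lo \<le> x" "x \<le> hi" "lo \<le> y" "y \<le> hi" "lo \<le> y'" "y' \<le> hi" "y \<noteq> x" "y' \<noteq> x0" "x < y \<longleftrightarrow> x0 < y'" for x y y'
  proof -
    let ?F = "V \<union> {x0} \<times> \<alpha> \<union> {y'} \<times> \<beta>"
    let ?h = "\<lambda>i. if i = x0 then x else if i = y' then y else i"
    have Vx: "i \<in> fst ` V \<Longrightarrow> i \<noteq> x0 \<and> i \<noteq> y'" for i using V(3)[of i] order xy by auto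
    have mono: "strict_mono_on (fst ` ?F) ?h"
    proof (rule strict_mono_onI)
      fix i j assume ij: "i \<in> fst ` ?F" "j \<in> fst ` ?F" "i < j"
      have "i \<in> fst ` V \<or> i = x0 \<or> i = y'" "j \<in> fst ` V \<or> j = x0 \<or> j = y'" using ij by auto
      then have "(i < lo \<or> hi < i) \<and> i \<noteq> x0 \<and> i \<noteq> y' \<or> i = x0 \<or> i = y'"
        "(j < lo \<or> hi < j) \<and> j \<noteq> x0 \<and> j \<noteq> y' \<or> j = x0 \<or> j = y'"
        using V(3)[of i] V(3)[of j] Vx[of i] Vx[of j] by blast+
      then show "?h i < ?h j" using ij(3) order xy by auto
    qed
    have fin: "finite ?F" using V(1) finite_subset[OF \<alpha> fin_C] finite_\<beta> by simp
    have "?F \<subseteq> E" using V(2) \<alpha> b(3) by auto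
    from indisc[OF fin this mono] have "t (mv ?h ?F) = t ?F" .
    moreover have "mv ?h ?F = V \<union> {x} \<times> \<alpha> \<union> {y} \<times> \<beta>"
    proof -
      have "mv ?h V = V" by (rule mv_id) (simp only: Vx if_False)
      moreover have "mv ?h ({x0} \<times> \<alpha>) = {x} \<times> \<alpha>" "mv ?h ({y'} \<times> \<beta>) = {y} \<times> \<beta>"
        using xy(8) by (simp_all add: set_eq_iff mem_mv conj_commute)
      ultimately show ?thesis by (simp only: mv_Un)
    qed
    ultimately show ?thesis by simp
  qed
  show "t (V \<union> {\<phi> (of_nat g)} \<times> \<alpha> \<union> {pos g' n} \<times> \<beta>) = t (V \<union> {x0} \<times> \<alpha> \<union> {y0} \<times> \<beta>)"
    if "g' < g" "g < L"
    using that \<phi>_bnd[of g] pos_bnd[of g' n] pos_less_\<phi>(1)[of g' n g] order by (intro *) auto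
  show "t (V \<union> {\<phi> (of_nat g)} \<times> \<alpha> \<union> {pos g' n} \<times> \<beta>) = t (V \<union> {x0} \<times> \<alpha> \<union> {y1} \<times> \<beta>)"
    if "g \<le> g'" "g' < L"
    using that \<phi>_bnd[of g] pos_bnd[of g' n] pos_less_\<phi>(2)[of g g' n] order by (intro *) auto
qed

definition pieces :: "(nat \<Rightarrow> nat) \<Rightarrow> (rat \<times> nat) set" where
  "pieces a = {(pos g n, c) |g n c. g < L \<and> n < a g \<and> c \<in> \<beta>}"

definition idx :: "(nat \<Rightarrow> nat) \<Rightarrow> rat set" where
  "idx a = (\<lambda>(g, n). pos g n) ` (SIGMA g:{..<L}. {..<a g})"

lemma pieces_eq: "pieces a = idx a \<times> \<beta>"
  by (force simp: pieces_def idx_def)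

lemma blocks_pieces: "blocks a = W \<union> pieces a"
  by (simp add: blocks_def pieces_def)

lemma inj_on_pos: "inj_on (\<lambda>(g, n). pos g n) (SIGMA g:{..<L}. A g)"
  using pos_inj by (fastforce simp: inj_on_def)

lemma finite_idx: "finite (idx a)"
  by (simp add: idx_def)

lemma idx_W: "x \<in> idx a \<Longrightarrow> x \<notin> fst ` W"
  using pos_notin_W by (auto simp: idx_def)

lemma blocks_minus_W: "blocks a - W = pieces a"
  using idx_W by (force simp: blocks_pieces pieces_eq)

definition y :: "nat \<Rightarrow> (rat \<times> nat) set" where
  "y g0 = V \<union> {\<phi> (of_nat g0)} \<times> \<alpha>"

definition
  "target = t (V \<union> {x0} \<times> \<alpha> \<union> {y1} \<times> \<beta>)"

text \<open>Anchored at the copy of \<open>\<alpha>\<close> in place \<open>g0\<close>, this tests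
  which pieces lie to its right. It is preserved by isomorphisms fixing \<open>W\<close>, and up to
  scattered sets it yields a tail sum of \<open>a\<close>.\<close>

definition copies :: "nat \<Rightarrow> (nat \<Rightarrow> nat) \<Rightarrow> (rat \<times> nat) set set" where
  "copies g0 a = {G. G \<subseteq> pieces a \<and> card G = b \<and> t (y g0 \<union> G) = target}"

definition scattered :: "nat \<Rightarrow> (nat \<Rightarrow> nat) \<Rightarrow> (rat \<times> nat) set set" where
  "scattered g0 a = {G \<in> copies g0 a. \<forall>x. trace G x \<noteq> \<beta>}"

lemma y_W: "g0 < L \<Longrightarrow> y g0 \<subseteq> W"
  by (auto simp: y_def W_def)

lemma finite_copies: "finite (copies g0 a)"
proof -
  have "finite (Pow (pieces a))" using finite_idx finite_\<beta> by (simp add: pieces_eq)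
  then show ?thesis by (rule finite_subset[rotated]) (auto simp: copies_def)
qed

text \<open>In a scattered set every trace is a proper subset of \<open>\<beta>\<close>, with fewer
  than \<open>b\<close> points, and hence moves freely by \<open>comm_b\<close>. So only the number
  of available indices counts, not their distribution over the gaps.\<close>

lemma card_scattered_le:
  assumes g0: "g0 < L" and eq: "card (idx a) = card (idx a')"
  shows "card (scattered g0 a) \<le> card (scattered g0 a')"
proof -
  obtain h where h: "bij_betw h (idx a) (idx a')"
    using finite_same_card_bij[OF finite_idx finite_idx eq] by blast
  let ?g = "\<lambda>x. if x \<in> idx a then h x else x"
  have g_idx: "?g x \<in> idx a'" if "x \<in> idx a" for x
    using h that by (auto simp: bij_betw_def)
  have injI: "inj_on ?g (idx a)" using h by (auto simp: bij_betw_def inj_on_def)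
  have fstG: "fst ` G \<subseteq> idx a" if "G \<subseteq> pieces a" for G using that by (auto simp: pieces_eq)
  have "inj_on (mv ?g) (Pow (pieces a))"
    unfolding mv_def
    by (rule inj_on_image_Pow, rule inj_on_mv, rule inj_on_subset[OF injI]) (auto simp: pieces_eq)
  then have inj: "inj_on (mv ?g) (scattered g0 a)"
    by (rule inj_on_subset) (auto simp: scattered_def copies_def)
  have "mv ?g G \<in> scattered g0 a'" if "G \<in> scattered g0 a" for G
  proof -
    have G: "G \<subseteq> pieces a" "card G = b" "t (y g0 \<union> G) = target" "\<And>x. trace G x \<noteq> \<beta>"
      using that by (auto simp: scattered_def copies_def)
    have finG: "finite G" using G(2) b(1) card_ge_0_finite by force
    have injG: "inj_on ?g (fst ` G)" by (rule inj_on_subset[OF injI fstG[OF G(1)]])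
    have sub: "mv ?g G \<subseteq> pieces a'"
    proof
      fix z assume "z \<in> mv ?g G"
      then obtain i c where z: "(i, c) \<in> G" "z = (?g i, c)" unfolding mem_mv by blast
      then have ic: "i \<in> idx a" "c \<in> \<beta>" using G(1) by (auto simp: pieces_eq)
      have "(?g i, c) \<in> idx a' \<times> \<beta>" using g_idx[OF ic(1)] ic(2) by (rule SigmaI)
      then show "z \<in> pieces a'" unfolding z(2) pieces_eq .
    qed
    have tr: "trace (mv ?g G) x \<noteq> \<beta>" for x
    proof
      assume x: "trace (mv ?g G) x = \<beta>"
      have "\<beta> \<noteq> {}" using b by auto
      then have "x \<in> fst ` mv ?g G" using x unfolding trace_nonempty by simp
      then have "x \<in> ?g ` fst ` G" by (simp only: fst_mv)
      then obtain i where i: "x = ?g i" "i \<in> fst ` G" by (rule imageE)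
      then have "trace G i = \<beta>" using x trace_mv[OF injG i(2)] by (simp only:)
      then show False using G(4) by blast
    qed
    have ysub: "fst ` y g0 \<subseteq> fst ` W" using y_W[OF g0] by blast
    have y_idx: "x \<notin> idx a" "x \<notin> idx a'" if "x \<in> fst ` y g0" for x using that ysub idx_W by blast+
    have mvy: "mv ?g (y g0) = y g0" by (rule mv_id) (use y_idx in auto)
    have "t (mv ?g (y g0 \<union> G)) = t (y g0 \<union> G)"
    proof -
      have fin: "finite (y g0 \<union> G)" using finG finite_subset[OF y_W[OF g0] W(1)] by simp
      have E: "y g0 \<union> G \<subseteq> E" using y_W[OF g0] W(2) G(1) b(3) by (auto simp: pieces_eq)
      have "inj_on ?g (fst ` (y g0 \<union> G))"
        unfolding image_Un
      proof (subst inj_on_Un, intro conjI)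
        show "inj_on ?g (fst ` y g0)" using y_idx by (auto simp: inj_on_def)
        show "inj_on ?g (fst ` G)" by (rule injG)
        have "?g i \<noteq> ?g j" if "i \<in> fst ` y g0" "j \<in> fst ` G" for i j
          using y_idx[OF that(1)] fstG[OF G(1)] g_idx[of j] that(2) by auto
        then show "?g ` (fst ` y g0 - fst ` G) \<inter> ?g ` (fst ` G - fst ` y g0) = {}"
          by (auto simp del: if_image_distrib)
      qed
      moreover have "strict_mono_on {x \<in> fst ` (y g0 \<union> G). b \<le> card (trace (y g0 \<union> G) x)} ?g"
      proof -
        have "x \<in> fst ` y g0" if x: "x \<in> fst ` (y g0 \<union> G)" "b \<le> card (trace (y g0 \<union> G) x)" for x
        proof (rule ccontr)
          assume nx: "x \<notin> fst ` y g0"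
          then have "trace (y g0) x = {}" using trace_nonempty by metis
          then have "trace (y g0 \<union> G) x = trace G x" by (simp add: trace_Un)
          moreover have "trace G x \<subseteq> \<beta>" using G(1) by (auto simp: pieces_eq)
          ultimately have "trace G x = \<beta>"
            using card_seteq[OF finite_\<beta>, of "trace G x"] x(2) b(2) by simp
          then show False using G(4) by blast
        qed
        then show ?thesis using y_idx by (auto simp: strict_mono_on_def)
      qed
      ultimately show ?thesis
        using comm_b[unfolded comm_def, THEN spec, THEN spec, THEN mp, THEN mp, THEN mp, THEN mp, OF fin E]
        by (simp only:)
    qed
    then have "t (y g0 \<union> mv ?g G) = target" using G(3) by (simp add: mv_Un mvy)
    then show ?thesis using sub tr card_mv[OF injG] G(2) by (simp add: scattered_def copies_def)
  qed
  moreover have "finite (scattered g0 a')" using finite_copies by (simp add: scattered_def)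
  ultimately show ?thesis using card_inj_on_le[OF inj] by blast
qed

text \<open>A set of \<open>b\<close> points that contains a complete \<open>\<beta>\<close> equals
  it. By \<open>t_before\<close>, \<open>t_after\<close> and \<open>diff\<close> such a piece in gap
  \<open>g\<close> has the type \<open>target\<close> exactly if \<open>g0 \<le> g\<close>; all
  other copies are scattered.\<close>

lemma card_copies:
  assumes g0: "g0 < L"
  shows "card (copies g0 a) = (\<Sum>g\<in>{g0..<L}. a g) + card (scattered g0 a)"
proof -
  let ?P = "SIGMA g:{g0..<L}. {..<a g}"
  let ?one = "(\<lambda>(g, n). {pos g n} \<times> \<beta>) ` ?P"
  have "\<beta> \<noteq> {}" using b by auto
  have one: "{pos g n} \<times> \<beta> \<in> copies g0 a \<longleftrightarrow> g0 \<le> g" if "g < L" "n < a g" for g n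
  proof -
    have "{pos g n} \<times> \<beta> \<subseteq> pieces a" using that by (auto simp: pieces_def)
    moreover have "card ({pos g n} \<times> \<beta>) = b" using b(2) by (simp add: card_cartesian_product)
    moreover have "t (y g0 \<union> {pos g n} \<times> \<beta>) = target \<longleftrightarrow> g0 \<le> g"
      using t_before[of g g0 n] t_after[of g0 g n] diff g0 that(1) unfolding y_def target_def
      by (metis not_le)
    ultimately show ?thesis by (simp add: copies_def)
  qed
  have "copies g0 a = ?one \<union> scattered g0 a"
  proof
    show "?one \<union> scattered g0 a \<subseteq> copies g0 a" using one by (auto simp: scattered_def)
    show "copies g0 a \<subseteq> ?one \<union> scattered g0 a"
    proof
      fix G assume G: "G \<in> copies g0 a"
      show "G \<in> ?one \<union> scattered g0 a"
      proof (cases "\<exists>x. trace G x = \<beta>")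
        case True
        then obtain x where x: "trace G x = \<beta>" by blast
        have sub: "{x} \<times> \<beta> \<subseteq> G" using x by auto
        have "finite G" using G b(1) card_ge_0_finite by (force simp: copies_def)
        moreover have "card G \<le> card ({x} \<times> \<beta>)" using G b(2) by (simp add: copies_def card_cartesian_product)
        ultimately have Geq: "G = {x} \<times> \<beta>" using card_seteq[of G "{x} \<times> \<beta>"] sub by blast
        obtain c where "(x, c) \<in> G" using sub \<open>\<beta> \<noteq> {}\<close> by blast
        then have "(x, c) \<in> pieces a" using G by (auto simp: copies_def)
        then obtain g n where g: "g < L" "n < a g" "x = pos g n" by (auto simp: pieces_def)
        then have "g0 \<le> g" using one[OF g(1,2)] G Geq by simp
        then show ?thesis using g Geq by force
      qed (use G in \<open>simp add: scattered_def\<close>)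
    qed
  qed
  moreover have "?one \<inter> scattered g0 a = {}" by (auto simp: scattered_def trace_def)
  moreover have "finite (scattered g0 a)" using finite_copies by (simp add: scattered_def)
  ultimately have "card (copies g0 a) = card ?one + card (scattered g0 a)"
    by (simp add: card_Un_disjoint)
  moreover have "card ?one = card ?P"
  proof (rule card_image)
    have "inj_on (\<lambda>(g, n). pos g n) ?P"
      by (rule inj_on_subset[OF inj_on_pos[of "\<lambda>g. {..<a g}"]]) auto
    moreover have "x = x'" if "{x} \<times> \<beta> = {x'} \<times> \<beta>" for x x' :: rat using that \<open>\<beta> \<noteq> {}\<close> by auto
    ultimately show "inj_on (\<lambda>(g, n). {pos g n} \<times> \<beta>) ?P" unfolding inj_on_def by fastforce
  qed
  ultimately show ?thesis by simp
qed

text \<open>An isomorphism fixing \<open>W\<close> preserves all numbers of copies. It also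
  preserves the total number of pieces, hence the number of scattered copies. By
  \<open>card_copies\<close> all tail sums of the vector agree, and they determine it.\<close>

lemma distinguished: "J \<subseteq> {..<L} \<Longrightarrow> distinguished J c"
  unfolding distinguished_def
proof (intro allI impI)
  fix a a' \<theta>
  assume J: "J \<subseteq> {..<L}" and c: "\<forall>g. c g \<le> a g \<and> c g \<le> a' g \<and> (g \<notin> J \<longrightarrow> a g = c g \<and> a' g = c g)"
    and bij: "bij_betw \<theta> (blocks a) (blocks a')" and t\<theta>: "\<forall>X\<subseteq>blocks a. t (\<theta> ` X) = t X"
    and id: "\<forall>x\<in>blocks c. \<theta> x = x"
  have idW: "\<theta> x = x" if "x \<in> W" for x using id that by (auto simp: blocks_def)
  have "\<theta> ` W = W" using idW by force
  then have "bij_betw \<theta> (blocks a - W) (blocks a' - W)"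
    by (intro bij_betw_DiffI[OF bij]) (use idW in \<open>auto simp: bij_betw_def inj_on_def blocks_def\<close>)
  then have bijp: "bij_betw \<theta> (pieces a) (pieces a')" by (simp add: blocks_minus_W)
  have "card (pieces a) = card (pieces a')" by (rule bij_betw_same_card[OF bijp])
  then have cardI: "card (idx a) = card (idx a')" using b by (simp add: pieces_eq card_cartesian_product)
  have sums: "(\<Sum>g\<in>{g0..<L}. a g) = (\<Sum>g\<in>{g0..<L}. a' g)" if g0: "g0 < L" for g0
  proof -
    have "inj_on (image \<theta>) (Pow (pieces a))"
      by (rule inj_on_image_Pow) (use bijp in \<open>simp add: bij_betw_def\<close>)
    then have inj: "inj_on (image \<theta>) (copies g0 a)"
      by (rule inj_on_subset) (auto simp: copies_def)
    have iff: "\<theta> ` G \<in> copies g0 a' \<longleftrightarrow> G \<in> copies g0 a" if G: "G \<subseteq> pieces a" for G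
    proof -
      have "\<theta> ` (y g0 \<union> G) = y g0 \<union> \<theta> ` G" using idW y_W[OF g0] by (force simp: image_Un)
      moreover have "y g0 \<union> G \<subseteq> blocks a" using y_W[OF g0] G by (auto simp: blocks_pieces)
      ultimately have "t (y g0 \<union> \<theta> ` G) = t (y g0 \<union> G)" using t\<theta> by metis
      moreover have "card (\<theta> ` G) = card G"
        by (rule card_image) (meson G bijp bij_betw_def inj_on_subset)
      moreover have "\<theta> ` G \<subseteq> pieces a'" using G bijp by (auto simp: bij_betw_def)
      ultimately show ?thesis using G by (simp add: copies_def)
    qed
    have "image \<theta> ` copies g0 a = copies g0 a'"
    proof
      show "image \<theta> ` copies g0 a \<subseteq> copies g0 a'" using iff by (auto simp: copies_def)
      show "copies g0 a' \<subseteq> image \<theta> ` copies g0 a"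
      proof
        fix G assume G: "G \<in> copies g0 a'"
        then have "G \<subseteq> \<theta> ` pieces a" using bijp by (auto simp: copies_def bij_betw_def)
        then obtain G0 where "G0 \<subseteq> pieces a" "G = \<theta> ` G0" by (auto simp: subset_image_iff)
        then show "G \<in> image \<theta> ` copies g0 a" using iff G by blast
      qed
    qed
    then have "card (copies g0 a) = card (copies g0 a')" by (rule card_image_eq[OF inj])
    moreover have "card (scattered g0 a) = card (scattered g0 a')"
      using card_scattered_le[OF g0 cardI] card_scattered_le[OF g0 cardI[symmetric]] by simp
    ultimately show ?thesis using card_copies[OF g0] by simp
  qed
  show "a = a'"
  proof
    fix g show "a g = a' g"
    proof (cases "g < L")
      case True
      then show ?thesis using sum_tails_eq[OF sums] by blast
    next
      case False
      then have "g \<notin> J" using J by auto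
      then show ?thesis using c by metis
    qed
  qed
qed

text \<open>Incomplete pieces blur the degree of growth by up to \<open>2 ^ b\<close>, so
  \<open>2 ^ b + 1\<close> further infinite gaps are spent on each unit of
  \<open>R1\<close>.\<close>

lemma R1_tower: "(2 ^ b + 1) * i \<le> L \<Longrightarrow> i \<le> R1 (ag (tower {..<(2 ^ b + 1) * i} c))"
proof (induction i arbitrary: c)
  case (Suc i)
  have eq: "(2 ^ b + 1) * Suc i = (2 ^ b + 1) * i + 2 ^ b + 1" by simp
  have le: "(2 ^ b + 1) * i \<le> L" using Suc.prems unfolding eq by linarith
  show ?case
  proof (rule R1_tower_step[OF permutable distinguished _ _ _ _ _, where e = "(2 ^ b + 1) * i + 2 ^ b"
        and J = "{..<(2 ^ b + 1) * i}" and K = "{..<(2 ^ b + 1) * Suc i}"])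
    show "\<exists>K. \<forall>M. cnt (tower {..<(2 ^ b + 1) * i} c') M \<le> K * (M + 1) ^ ((2 ^ b + 1) * i + 2 ^ b)" for c'
      by (rule cnt_upper[OF le])
    show "i \<le> R1 (ag (tower {..<(2 ^ b + 1) * i} c'))" for c' by (rule Suc.IH[OF le])
  qed (use Suc.prems eq in auto)
qed simp

end

section \<open>From the bound on \<open>R1\<close> to free movement of all pieces\<close>

lemma mv_upd: "mv (id(s := x)) F = (F - {s} \<times> UNIV) \<union> {x} \<times> trace F s"
proof (rule set_eqI)
  fix z :: "'a \<times> 'b"
  obtain j c where z: "z = (j, c)" by (cases z)
  show "z \<in> mv (id(s := x)) F \<longleftrightarrow> z \<in> (F - {s} \<times> UNIV) \<union> {x} \<times> trace F s"
    unfolding mem_mv z by (auto split: if_splits)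
qed

context type_system
begin

lemma finite_column_set: "\<beta> \<subseteq> C \<Longrightarrow> finite \<beta>"
  using fin_C finite_subset by blast

text \<open>A piece that could not pass the index \<open>k\<close> would give a
  \<open>crossing\<close> with \<open>(2 ^ b + 1) * Suc \<kappa>\<close> gaps, whose tower has
  \<open>R1\<close> above the bound \<open>\<kappa>\<close>.\<close>

lemma cross:
  assumes comm: "comm b" "1 \<le> b" and \<beta>: "card \<beta> = b" "\<beta> \<subseteq> C"
    and F: "finite F" "F \<subseteq> E" and k: "lo < k" "k < hi" "\<And>x. x \<in> fst ` F \<Longrightarrow> lo \<le> x \<Longrightarrow> x \<le> hi \<Longrightarrow> x = k"
  shows "t (F \<union> {lo} \<times> \<beta>) = t (F \<union> {hi} \<times> \<beta>)"
proof (rule ccontr)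
  assume ne: "\<not> ?thesis"
  let ?V = "F - {k} \<times> UNIV" and ?L = "(2 ^ b + 1) * Suc \<kappa>"
  have F_eq: "?V \<union> {k} \<times> trace F k = F" by auto
  interpret crossing C t R1 R2 \<kappa> b "trace F k" \<beta> ?V lo hi k lo hi ?L
  proof unfold_locales
    show "x < lo \<or> hi < x" if "x \<in> fst ` ?V" for x
    proof -
      have "x \<in> fst ` F" "x \<noteq> k" using that by auto
      then show ?thesis using k(3)[of x] by linarith
    qed
    show "t (?V \<union> {k} \<times> trace F k \<union> {lo} \<times> \<beta>) \<noteq> t (?V \<union> {k} \<times> trace F k \<union> {hi} \<times> \<beta>)"
      unfolding F_eq using ne by blast
  qed (use assms in auto)
  have "Suc \<kappa> \<le> R1 (ag (tower {..<(2 ^ b + 1) * Suc \<kappa>} (\<lambda>_. 0)))" by (rule R1_tower) simp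
  moreover have "R1 (ag (tower {..<(2 ^ b + 1) * Suc \<kappa>} (\<lambda>_. 0))) \<le> \<kappa>"
    unfolding ag_def by (rule R1_le[OF tower_E])
  ultimately show False by simp
qed

lemma move_piece:
  assumes comm: "comm b" "1 \<le> b" and \<beta>: "card \<beta> = b" "\<beta> \<subseteq> C"
    and F: "finite F" "F \<subseteq> E" and ij: "i \<notin> fst ` F" "j \<notin> fst ` F"
  shows "t (F \<union> {i} \<times> \<beta>) = t (F \<union> {j} \<times> \<beta>)"
proof -
  have less: "t (F \<union> {i} \<times> \<beta>) = t (F \<union> {j} \<times> \<beta>)"
    if "i < j" "i \<notin> fst ` F" "j \<notin> fst ` F" for i j
    using that
  proof (induction "card (fst ` F \<inter> {i<..<j})" arbitrary: i rule: less_induct)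
    case less
    have fin: "finite (fst ` F \<inter> {i<..<j})" using F(1) by simp
    show ?case
    proof (cases "fst ` F \<inter> {i<..<j} = {}")
      case True
      let ?G = "F \<union> {i} \<times> \<beta>"
      have "strict_mono_on (fst ` ?G) (id(i := j))"
      proof (rule strict_mono_onI)
        fix x y assume xy: "x \<in> fst ` ?G" "y \<in> fst ` ?G" "x < y"
        then have "x \<in> fst ` F \<or> x = i" "y \<in> fst ` F \<or> y = i" by auto
        moreover have "y \<in> fst ` F \<Longrightarrow> i < y \<Longrightarrow> j < y"
          using True less.prems(3) by (metis IntI empty_iff greaterThanLessThan_iff linorder_neqE)
        ultimately show "(id(i := j)) x < (id(i := j)) y"
          using xy(3) less.prems by auto
      qed
      moreover have "finite ?G" using F finite_column_set[OF \<beta>(2)] by simp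
      moreover have "?G \<subseteq> E" using F \<beta> by auto
      ultimately have "t (mv (id(i := j)) ?G) = t ?G" using indisc by blast
      moreover have "mv (id(i := j)) ?G = F \<union> {j} \<times> \<beta>"
      proof -
        have "trace F i = {}" using less.prems(2) trace_nonempty by metis
        then have "trace ?G i = \<beta>" by auto
        moreover have "?G - {i} \<times> UNIV = F" using less.prems(2) by force
        ultimately show ?thesis by (simp only: mv_upd)
      qed
      ultimately show ?thesis by simp
    next
      case False
      define k where "k = Min (fst ` F \<inter> {i<..<j})"
      have k: "k \<in> fst ` F" "i < k" "k < j" and k_le: "\<And>x. x \<in> fst ` F \<Longrightarrow> i < x \<Longrightarrow> x < j \<Longrightarrow> k \<le> x"
        using Min_in[OF fin False] Min_le[OF fin] by (auto simp: k_def)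
      let ?A = "insert j {x \<in> fst ` F. k < x}"
      define m where "m = Min ?A"
      have finA: "finite ?A" using F(1) by simp
      have m: "m \<in> ?A" unfolding m_def by (rule Min_in[OF finA]) simp
      have m_le: "\<And>x. x \<in> ?A \<Longrightarrow> m \<le> x" unfolding m_def by (rule Min_le[OF finA])
      have km: "k < m" "m \<le> j" using m m_le[of j] k(3) by auto
      \<comment> \<open>A free place just beyond \<open>k\<close>, before the next occupied index
        and before \<open>j\<close>, so that exactly one index is crossed at a time.\<close>
      define j' where "j' = (k + m) / 2"
      have j': "k < j'" "j' < m" using km by (auto simp: j'_def)
      have "j' \<notin> fst ` F" using m_le[of j'] j' by auto
      have "t (F \<union> {i} \<times> \<beta>) = t (F \<union> {j'} \<times> \<beta>)"
      proof (rule cross[OF comm \<beta> F k(2) j'(1)])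
        fix x assume x: "x \<in> fst ` F" "i \<le> x" "x \<le> j'"
        then have "x \<noteq> i" using less.prems(2) by blast
        then have "k \<le> x" using k_le[OF x(1)] x j' km by auto
        moreover have "\<not> k < x" using m_le[of x] x j' by auto
        ultimately show "x = k" by simp
      qed
      also have "\<dots> = t (F \<union> {j} \<times> \<beta>)"
      proof (rule less.hyps)
        have "k \<in> fst ` F \<inter> {i<..<j}" "k \<notin> fst ` F \<inter> {j'<..<j}" using k j' by auto
        moreover have "{j'<..<j} \<subseteq> {i<..<j}" using k j' by auto
        ultimately have "fst ` F \<inter> {j'<..<j} \<subset> fst ` F \<inter> {i<..<j}" by blast
        then show "card (fst ` F \<inter> {j'<..<j}) < card (fst ` F \<inter> {i<..<j})"
          by (rule psubset_card_mono[OF fin])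
      qed (use \<open>j' \<notin> fst ` F\<close> j' km less.prems in auto)
      finally show ?thesis .
    qed
  qed
  consider "i < j" | "i = j" | "j < i" by linarith
  then show ?thesis
  proof cases
    case 1
    then show ?thesis by (rule less[OF _ ij])
  next
    case 3
    then show ?thesis by (rule less[OF _ ij(2,1), symmetric])
  qed simp
qed

lemma move_pieces:
  assumes comm: "comm b" "1 \<le> b" and F: "finite F" "F \<subseteq> E"
    and S: "finite S" "\<And>i. i \<in> S \<Longrightarrow> i \<in> fst ` F \<and> card (trace F i) = b \<and> h i \<notin> fst ` F" and inj: "inj_on h S"
  shows "t (mv (\<lambda>i. if i \<in> S then h i else i) F) = t F"
  using S(1) S(2) inj
proof (induction S rule: finite_induct)
  case empty
  have "mv (\<lambda>i. if i \<in> {} then h i else i) F = F" by (rule mv_id) simp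
  then show ?case by simp
next
  case (insert s S)
  let ?h = "\<lambda>i. if i \<in> S then h i else i"
  let ?F = "mv ?h F"
  have IH: "t ?F = t F" using insert by simp
  have F': "finite ?F" "?F \<subseteq> E" using finite_mv[OF F(1)] mv_columns[OF F(2)] by auto
  have s: "s \<in> fst ` F" "card (trace F s) = b" "h s \<notin> fst ` F" using insert.prems(1) by auto
  have hne: "h i \<noteq> s" if "i \<in> S" for i using insert.prems(1)[of i] that s(1) by auto
  have tr: "trace ?F s = trace F s"
    using hne insert.hyps(2) by (auto simp: trace_def mem_mv split: if_splits)
  have \<beta>: "trace F s \<subseteq> C" using F(2) by auto
  let ?D = "?F - {s} \<times> UNIV"
  have "?F = ?D \<union> {s} \<times> trace ?F s" by auto
  then have "?F = ?D \<union> {s} \<times> trace F s" by (simp only: tr)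
  then have "t ?F = t (?D \<union> {s} \<times> trace F s)" by (rule arg_cong)
  also have "\<dots> = t (?D \<union> {h s} \<times> trace F s)"
  proof (rule move_piece[OF comm s(2) \<beta>])
    show "s \<notin> fst ` ?D" by auto
    show "h s \<notin> fst ` ?D"
    proof
      assume "h s \<in> fst ` ?D"
      then have "h s \<in> fst ` ?F" by blast
      then have "h s \<in> ?h ` fst ` F" by (simp only: fst_mv)
      then obtain i where i: "h s = ?h i" "i \<in> fst ` F" by (rule imageE)
      show False
      proof (cases "i \<in> S")
        case True
        then have "h s = h i" using i by simp
        then have "s = i" using inj_onD[OF insert.prems(2), of s i] True by simp
        then show False using True insert.hyps(2) by simp
      next
        case False
        then show False using i s(3) by simp
      qed
    qed
  qed (use F' in auto)
  also have "?D \<union> {h s} \<times> trace F s = mv (id(s := h s)) ?F" by (simp only: mv_upd tr)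
  also have "\<dots> = mv (\<lambda>i. if i \<in> insert s S then h i else i) F"
    unfolding mv_mv by (rule mv_cong) (use hne insert.hyps(2) in auto)
  finally show ?case using IH by simp
qed

text \<open>The pieces of size \<open>b\<close> are sent far to the right, from \<open>F\<close> and
  from \<open>mv g F\<close> to the same places. The two results differ by a move that is
  \<open>g\<close> on the other pieces and the identity on the far ones. It is increasing on all
  pieces with at least \<open>b\<close> points, so \<open>comm b\<close> compares them.\<close>

lemma comm_Suc:
  assumes comm: "comm b" "1 \<le> b"
  shows "comm (Suc b)"
  unfolding comm_def
proof (intro allI impI)
  fix F :: "(rat \<times> nat) set" and g :: "rat \<Rightarrow> rat"
  assume F: "finite F" "F \<subseteq> E" and inj: "inj_on g (fst ` F)"
    and mono: "strict_mono_on {i \<in> fst ` F. Suc b \<le> card (trace F i)} g"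
  let ?I = "fst ` F"
  let ?S = "{i \<in> ?I. card (trace F i) = b}"
  let ?A = "?I \<union> g ` ?I"
  have finI: "finite ?I" using F by simp
  define B where "B = Max (abs ` insert 0 ?A)"
  have B: "\<bar>x\<bar> \<le> B" if "x \<in> ?A" for x
    unfolding B_def using finI that by (intro Max_ge) auto
  \<comment> \<open>All indices in play have absolute value at most \<open>B\<close>; a shift by
    \<open>2 * B + 1\<close> clears them and keeps the order of the shifted pieces.\<close>
  define far where "far i = i + (2 * B + 1)" for i :: rat
  have far_gt: "x < far i" if "x \<in> ?A" "i \<in> ?I" for x i
    using B[OF that(1)] B[of i] that(2) by (auto simp: far_def abs_le_iff)
  have far_notin: "far i \<notin> ?A" if "i \<in> ?I" for i using far_gt[of "far i" i] that by blast
  have far_inj: "far i = far j \<longleftrightarrow> i = j" for i j by (simp add: far_def)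
  let ?h = "\<lambda>i. if i \<in> ?S then far i else i"
  let ?F1 = "mv ?h F"
  have t1: "t ?F1 = t F"
    by (rule move_pieces[OF comm F]) (use finI far_notin in \<open>auto simp: inj_on_def far_inj\<close>)
  let ?F' = "mv g F"
  have F': "finite ?F'" "?F' \<subseteq> E" using finite_mv[OF F(1)] mv_columns[OF F(2)] by auto
  let ?k = "\<lambda>x. far (inv_into ?I g x)"
  let ?h' = "\<lambda>x. if x \<in> g ` ?S then ?k x else x"
  have k: "?k (g i) = far i" if "i \<in> ?I" for i using inv_into_f_f[OF inj that] by simp
  have t2: "t (mv ?h' ?F') = t ?F'"
  proof (rule move_pieces[OF comm F'])
    show "finite (g ` ?S)" using finI by simp
    fix x assume "x \<in> g ` ?S"
    then obtain i where i: "x = g i" "i \<in> ?I" "card (trace F i) = b" by blast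
    then have "?k x = far i" using k by simp
    moreover have "far i \<notin> g ` ?I" using far_notin[OF i(2)] by blast
    ultimately show "x \<in> fst ` ?F' \<and> card (trace ?F' x) = b \<and> ?k x \<notin> fst ` ?F'"
      unfolding fst_mv using i trace_mv[OF inj i(2)] by simp
  next
    show "inj_on ?k (g ` ?S)" using k by (auto simp: inj_on_def far_inj)
  qed
  let ?g2 = "\<lambda>x. if x \<in> far ` ?S then x else g x"

  have g2h: "?g2 (?h i) = (if i \<in> ?S then far i else g i)" if "i \<in> ?I" for i
  proof (cases "i \<in> ?S")
    case True
    then show ?thesis by simp
  next
    case False
    have "far j \<noteq> i" if "j \<in> ?S" for j using far_notin[of j] that \<open>i \<in> ?I\<close> by auto
    then have "i \<notin> far ` ?S" by blast
    then show ?thesis using False by (simp only: if_False)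
  qed
  have "mv ?h' ?F' = mv ?g2 ?F1"
    unfolding mv_mv
  proof (rule mv_cong)
    fix i assume i: "i \<in> ?I"
    have "g i \<in> g ` ?S \<longleftrightarrow> i \<in> ?S" using inj_on_image_mem_iff[OF inj i, of ?S] by blast
    then show "(?h' \<circ> g) i = (?g2 \<circ> ?h) i" unfolding o_apply g2h[OF i] using k[OF i] by simp
  qed
  moreover have "t (mv ?g2 ?F1) = t ?F1"
  proof -
    have inj_h: "inj_on ?h ?I"
    proof (rule inj_onI)
      fix i j assume ij: "i \<in> ?I" "j \<in> ?I" "?h i = ?h j"
      have "far i \<noteq> j" "far j \<noteq> i" using far_notin[OF ij(1)] far_notin[OF ij(2)] ij(1,2) by blast+
      then show "i = j" using ij(3) by (simp only: far_inj split: if_splits)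
    qed
    have I1: "fst ` ?F1 = ?h ` ?I" by (rule fst_mv)
    have "inj_on ?g2 (?h ` ?I)"
    proof (rule inj_onI)
      fix x y assume "x \<in> ?h ` ?I" "y \<in> ?h ` ?I" and eq: "?g2 x = ?g2 y"
      then obtain i j where i: "i \<in> ?I" "x = ?h i" and j: "j \<in> ?I" "y = ?h j" by blast
      have e: "(if i \<in> ?S then far i else g i) = (if j \<in> ?S then far j else g j)"
        using eq unfolding i(2) j(2) g2h[OF i(1)] g2h[OF j(1)] .
      have "i = j"
      proof (cases "i \<in> ?S"; cases "j \<in> ?S")
        assume "i \<notin> ?S" "j \<notin> ?S"
        then have "g i = g j" using e by (simp only: if_False)
        then show "i = j" using inj i(1) j(1) by (auto dest: inj_onD)
      next
        assume "i \<in> ?S" "j \<notin> ?S"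
        then have "far i = g j" using e by (simp only: if_False if_True)
        then show "i = j" using far_notin[OF i(1)] j(1) by auto
      next
        assume "i \<notin> ?S" "j \<in> ?S"
        then have "g i = far j" using e by (simp only: if_False if_True)
        then show "i = j" using far_notin[OF j(1)] i(1) by (metis UnCI imageI)
      next
        assume "i \<in> ?S" "j \<in> ?S"
        then have "far i = far j" using e by (simp only: if_True)
        then show "i = j" by (simp only: far_inj)
      qed
      then show "x = y" using i j by simp
    qed
    moreover have "strict_mono_on {x \<in> ?h ` ?I. b \<le> card (trace ?F1 x)} ?g2"
    proof (rule strict_mono_onI)
      fix x y assume xy: "x \<in> {x \<in> ?h ` ?I. b \<le> card (trace ?F1 x)}"
        "y \<in> {x \<in> ?h ` ?I. b \<le> card (trace ?F1 x)}" "x < y"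
      obtain i j where i: "i \<in> ?I" "x = ?h i" and j: "j \<in> ?I" "y = ?h j" using xy(1,2) by blast
      have bi: "b \<le> card (trace F i)" "b \<le> card (trace F j)"
        using xy(1,2) trace_mv[OF inj_h] i j by auto
      have lt: "(if i \<in> ?S then far i else i) < (if j \<in> ?S then far j else j)"
        using xy(3) i(2) j(2) by (simp only:)
      have "(if i \<in> ?S then far i else g i) < (if j \<in> ?S then far j else g j)"
      proof (cases "i \<in> ?S"; cases "j \<in> ?S")
        assume nS: "i \<notin> ?S" "j \<notin> ?S"
        then have "Suc b \<le> card (trace F i)" "Suc b \<le> card (trace F j)" using bi i j by auto
        moreover have "i < j" using lt nS by (simp only: if_False)
        ultimately have "g i < g j" using mono i(1) j(1) by (auto simp: strict_mono_on_def)
        then show ?thesis using nS by (simp only: if_False)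
      next
        assume nS: "i \<in> ?S" "j \<notin> ?S"
        then have "far i < j" using lt by (simp only: if_False if_True)
        then show ?thesis using far_gt[of j i] i(1) j(1) by auto
      next
        assume nS: "i \<notin> ?S" "j \<in> ?S"
        have "g i < far j" using far_gt[of "g i" j] i(1) j(1) by auto
        then show ?thesis using nS by (simp only: if_False if_True)
      next
        assume nS: "i \<in> ?S" "j \<in> ?S"
        then show ?thesis using lt by (simp only: if_True)
      qed
      then show "?g2 x < ?g2 y" unfolding i(2) j(2) g2h[OF i(1)] g2h[OF j(1)] .
    qed
    moreover have "finite ?F1" "?F1 \<subseteq> E" using finite_mv[OF F(1)] mv_columns[OF F(2)] by auto
    ultimately show ?thesis
      using comm(1)[unfolded comm_def, THEN spec[of _ ?F1], THEN spec[of _ ?g2]] unfolding I1 by blast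
  qed
  ultimately show "t (mv g F) = t F" using t1 t2 by simp
qed

text \<open>No piece has more than \<open>card C\<close> points, so in
  \<open>comm (Suc (card C))\<close> the monotonicity condition is empty.\<close>

theorem t_mv:
  assumes "finite F" "F \<subseteq> E" "inj_on g (fst ` F)"
  shows "t (mv g F) = t F"
proof -
  have "comm 1"
    unfolding comm_def
  proof (intro allI impI)
    fix F :: "(rat \<times> nat) set" and g :: "rat \<Rightarrow> rat"
    assume F: "finite F" "F \<subseteq> E" and mono: "strict_mono_on {i \<in> fst ` F. 1 \<le> card (trace F i)} g"
    have "1 \<le> card (trace F i)" if "i \<in> fst ` F" for i
      using that finite_trace[OF F(1)] trace_nonempty by (metis One_nat_def Suc_leI card_gt_0_iff)
    then have "{i \<in> fst ` F. 1 \<le> card (trace F i)} = fst ` F" by blast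
    then show "t (mv g F) = t F" using indisc[OF F] mono by simp
  qed
  then have "comm (Suc b)" for b
    by (induction b) (auto intro: comm_Suc)
  from this[of "card C"] have comm: "comm (Suc (card C))" .
  have "{i \<in> fst ` F. Suc (card C) \<le> card (trace F i)} = {}"
  proof -
    have "trace F i \<subseteq> C" for i using assms(2) by auto
    then have "card (trace F i) \<le> card C" for i by (rule card_mono[OF fin_C])
    then show ?thesis by (simp add: not_less_eq_eq[symmetric])
  qed
  then have "strict_mono_on {i \<in> fst ` F. Suc (card C) \<le> card (trace F i)} g"
    by (simp only: strict_mono_on_def empty_iff) blast
  then show ?thesis using assms comm unfolding comm_def by blast
qed

end

section \<open>Binary codes of finite sets and their order\<close>

lemma set_encode_mono:
  assumes "q \<subseteq> p" "finite p"
  shows "set_encode q \<le> set_encode p" and "q \<noteq> p \<Longrightarrow> set_encode q < set_encode p"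
proof -
  have "set_encode p = set_encode q + set_encode (p - q)"
    unfolding set_encode_def using assms by (metis add.commute sum.subset_diff)
  moreover have "q \<noteq> p \<Longrightarrow> p - q \<noteq> {}" using assms(1) by blast
  then have "q \<noteq> p \<Longrightarrow> set_encode (p - q) \<noteq> 0"
    using assms(2) by (metis finite_Diff set_encode_empty set_encode_inverse set_decode_zero)
  ultimately show "set_encode q \<le> set_encode p" "q \<noteq> p \<Longrightarrow> set_encode q < set_encode p" by auto
qed

lemma set_encode_less_power: "q \<subseteq> {..<m} \<Longrightarrow> set_encode q < 2 ^ m"
proof -
  assume "q \<subseteq> {..<m}"
  then have "set_encode q \<le> set_encode {..<m}" by (rule set_encode_mono) simp
  also have "\<dots> = 2 ^ m - 1" unfolding set_encode_def by (simp add: sum_power2 lessThan_atLeast0)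
  finally show ?thesis by (metis One_nat_def Suc_pred le_imp_less_Suc zero_less_numeral zero_less_power)
qed

lemma set_decode_less_power: "g < 2 ^ m \<Longrightarrow> set_decode g \<subseteq> {..<m}"
proof
  fix c assume g: "g < 2 ^ m" and c: "c \<in> set_decode g"
  have "2 ^ c \<le> g"
  proof -
    have "set_encode {c} \<le> set_encode (set_decode g)"
      by (rule set_encode_mono) (use c in \<open>simp_all add: finite_set_decode\<close>)
    then show ?thesis by simp
  qed
  then have "(2::nat) ^ c < 2 ^ m" using g by linarith
  then show "c \<in> {..<m}" by simp
qed

subsection \<open>Functions of bounded degree on vectors of naturals\<close>

fun diffs :: "(nat \<Rightarrow> nat) list \<Rightarrow> ((nat \<Rightarrow> nat) \<Rightarrow> int) \<Rightarrow> (nat \<Rightarrow> nat) \<Rightarrow> int" where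
  "diffs [] f = f"
| "diffs (z # zs) f = diffs zs (\<lambda>y. f (y + z) - f y)"

text \<open>The discrete analogue of a polynomial of degree below \<open>d\<close>; degree below 0
  means the zero function.\<close>

primrec degree_less :: "nat \<Rightarrow> ((nat \<Rightarrow> nat) \<Rightarrow> int) \<Rightarrow> bool" where
  "degree_less 0 f \<longleftrightarrow> (\<forall>y. f y = 0)"
| "degree_less (Suc d) f \<longleftrightarrow> (\<forall>z. degree_less d (\<lambda>y. f (y + z) - f y))"

lemma diffs_minus: "diffs zs (\<lambda>y. f y - g y) = (\<lambda>y. diffs zs f y - diffs zs g y)"
proof (induction zs arbitrary: f g)
  case (Cons z zs)
  have "(\<lambda>y. f (y + z) - g (y + z) - (f y - g y)) = (\<lambda>y. (f (y + z) - f y) - (g (y + z) - g y))"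
    by (simp add: fun_eq_iff)
  then show ?case by (simp add: Cons.IH)
qed simp

lemma diffs_shift: "diffs zs (\<lambda>y. f (y + u)) = (\<lambda>y. diffs zs f (y + u))"
proof (induction zs arbitrary: f)
  case (Cons z zs)
  have "(\<lambda>y. f (y + z + u) - f (y + u)) = (\<lambda>y. f (y + u + z) - f (y + u))"
    by (simp add: fun_eq_iff ac_simps)
  then show ?case using Cons.IH[of "\<lambda>y. f (y + z) - f y"] by (simp only: diffs.simps)
qed simp

lemma diffs_Cons: "diffs (z # zs) f y = diffs zs f (y + z) - diffs zs f y"
  by (simp add: diffs_minus diffs_shift)

lemma degree_less_diffs: "degree_less d f \<longleftrightarrow> (\<forall>zs. length zs = d \<longrightarrow> (\<forall>y. diffs zs f y = 0))"
proof (induction d arbitrary: f)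
  case (Suc d)
  show ?case
  proof
    assume "degree_less (Suc d) f"
    then show "\<forall>zs. length zs = Suc d \<longrightarrow> (\<forall>y. diffs zs f y = 0)"
      by (auto simp: Suc.IH length_Suc_conv)
  next
    assume *: "\<forall>zs. length zs = Suc d \<longrightarrow> (\<forall>y. diffs zs f y = 0)"
    show "degree_less (Suc d) f"
      unfolding degree_less.simps Suc.IH
    proof (intro allI impI)
      fix z and zs :: "(nat \<Rightarrow> nat) list" and y assume "length zs = d"
      then show "diffs zs (\<lambda>y. f (y + z) - f y) y = 0" using *[rule_format, of "z # zs" y] by simp
    qed
  qed
qed simp

lemma degree_less_shift: "degree_less d f \<Longrightarrow> degree_less d (\<lambda>y. f (y + u))"
  by (simp add: degree_less_diffs diffs_shift)

lemma degree_less_minus: "degree_less d f \<Longrightarrow> degree_less d g \<Longrightarrow> degree_less d (\<lambda>y. f y - g y)"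
  by (simp add: degree_less_diffs diffs_minus)

text \<open>The vanishing of such averages passes to differences, so by induction the function is constant.\<close>

lemma degree_less_sum_zero:
  assumes "degree_less d f" "0 < q" "\<And>y. (\<Sum>j<q. f (y + w (j::nat))) = 0"
  shows "f y = 0"
  using assms(1,3)
proof (induction d arbitrary: f y)
  case (Suc d)
  have "f (y + z) - f y = 0" for y z
  proof (rule Suc.IH[of "\<lambda>y. f (y + z) - f y"])
    show "degree_less d (\<lambda>y. f (y + z) - f y)" using Suc.prems(1) by simp
    fix y
    have "(\<Sum>j<q. f (y + w j + z) - f (y + w j)) = (\<Sum>j<q. f ((y + z) + w j)) - (\<Sum>j<q. f (y + w j))"
      by (simp add: sum_subtractf ac_simps)
    then show "(\<Sum>j<q. f (y + w j + z) - f (y + w j)) = 0" using Suc.prems(2) by simp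
  qed
  then have const: "f (0 + z) = f 0" for z by (metis eq_iff_diff_eq_0)
  then have const: "f z = f 0" for z by (metis add_0)
  have "(\<Sum>j<q. f (0 + w j)) = (\<Sum>j<q. f 0)" by (rule sum.cong[OF refl const])
  then have "f 0 = 0" using Suc.prems(2)[of 0] assms(2) by simp
  then show ?case using const[of y] by simp
qed simp

text \<open>The case of a single summand. An identity on the vectors above \<open>z\<close> extends
  to all vectors, which makes up for the lack of subtraction on vectors of naturals.\<close>

lemma degree_less_shift_zero:
  assumes "degree_less d f" "\<And>y. f (y + z) = 0"
  shows "f y = 0"
  by (rule degree_less_sum_zero[of d f 1 "\<lambda>_. z"]) (use assms in auto)

definition unit :: "nat \<Rightarrow> nat \<Rightarrow> nat" where
  "unit i j = (if j = i then 1 else 0)"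

text \<open>Differences along unit vectors have lower degree and vanish on the box shortened by one,
  hence everywhere by induction. So \<open>f\<close> is constant and equal to its value at
  0.\<close>

lemma degree_less_box_zero:
  assumes "degree_less d f" and I: "finite I" "\<And>y y'. (\<And>i. i \<in> I \<Longrightarrow> y i = y' i) \<Longrightarrow> f y = f y'"
    and "\<And>y. (\<And>i. y i \<le> d) \<Longrightarrow> f y = 0"
  shows "f y = 0"
  using assms(1,3,4)
proof (induction d arbitrary: f y)
  case (Suc d)
  have step: "f (y + unit i) = f y" for i y
  proof -
    have "f (y + unit i) - f y = 0"
    proof (rule Suc.IH[of "\<lambda>y. f (y + unit i) - f y"])
      show "degree_less d (\<lambda>y. f (y + unit i) - f y)" using Suc.prems(1) by simp
      fix y y' :: "nat \<Rightarrow> nat" assume "\<And>i. i \<in> I \<Longrightarrow> y i = y' i"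
      then have "f (y + unit i) = f (y' + unit i)" "f y = f y'" by (auto intro!: Suc.prems(2))
      then show "f (y + unit i) - f y = f (y' + unit i) - f y'" by simp
    next
      fix y :: "nat \<Rightarrow> nat" assume y: "\<And>i. y i \<le> d"
      have "f (y + unit i) = 0" "f y = 0"
        using y by (auto intro!: Suc.prems(3) simp: unit_def le_SucI)
      then show "f (y + unit i) - f y = 0" by simp
    qed
    then show ?thesis by simp
  qed
  have "f y = f 0" for y
  proof (induction "\<Sum>i\<in>I. y i" arbitrary: y)
    case 0
    then have "\<And>i. i \<in> I \<Longrightarrow> y i = 0" using I(1) by simp
    then show ?case by (intro Suc.prems(2)) simp
  next
    case (Suc n)
    then have "(\<Sum>i\<in>I. y i) \<noteq> 0" by simp
    then obtain i where i: "i \<in> I" "y i \<noteq> 0" by (meson sum.neutral)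
    define y' where "y' = y(i := y i - 1)"
    have y: "y = y' + unit i" using i(2) by (auto simp: y'_def unit_def fun_eq_iff)
    have "(\<Sum>i\<in>I. y i) = (\<Sum>i\<in>I. y' i) + (\<Sum>j\<in>I. unit i j)" unfolding y by (simp add: sum.distrib)
    also have "(\<Sum>j\<in>I. unit i j) = 1" using i(1) I(1) by (simp add: unit_def)
    finally have "n = (\<Sum>i\<in>I. y' i)" using Suc.hyps(2) by simp
    then show ?case using Suc.hyps(1)[of y'] step[of y' i] y by simp
  qed
  then show ?case using Suc.prems(3)[of 0] by simp
next
  case 0
  from 0(1) show ?case by (simp only: degree_less.simps)
qed

subsection \<open>Types of multisets of letters\<close>

text \<open>The letters are the non-empty subsets of \<open>{..<m}\<close>, coded by \<open>set_encode\<close> as the numbers from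
  \<open>1\<close> to \<open>2 ^ m - 1\<close>. This coding is strictly increasing with respect to inclusion.\<close>

locale letter_system = type_system "{..<m}" t R1 R2 \<kappa>
  for m :: nat and t :: "(rat \<times> nat) set \<Rightarrow> 'q" and R1 R2 \<kappa>
begin

definition len :: nat where "len = 2 ^ m"

text \<open>A standard set for the vector \<open>v\<close>. Different layers \<open>k\<close> use
  disjoint indices, which supplies the disjoint parts for iterated differences. The code 0 belongs
  to the empty set and adds no point.\<close>

definition lay :: "nat \<Rightarrow> (nat \<Rightarrow> nat) \<Rightarrow> (rat \<times> nat) set" where
  "lay k v = {(of_nat (prod_encode (k, prod_encode (g, n))), c) |g n c. g < len \<and> n < v g \<and> c \<in> set_decode g}"

definition vec :: "(rat \<times> nat) set \<Rightarrow> nat \<Rightarrow> nat" where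
  "vec F i = card {x \<in> fst ` F. set_encode (trace F x) = i}"

text \<open>Vectors are total functions, but only their entries at codes of letters are visible in a
  set of points.\<close>

definition clip :: "(nat \<Rightarrow> nat) \<Rightarrow> nat \<Rightarrow> nat" where
  "clip v i = (if 1 \<le> i \<and> i < len then v i else 0)"

definition copies :: "(rat \<times> nat) set \<Rightarrow> 'q \<Rightarrow> int" where
  "copies F s = int (card {X. X \<subseteq> F \<and> t X = s})"

lemma trace_sub: "F \<subseteq> E \<Longrightarrow> trace F x \<subseteq> {..<m}"
  by auto

lemma set_encode_trace: "F \<subseteq> E \<Longrightarrow> set_encode (trace F x) < len"
  unfolding len_def by (rule set_encode_less_power[OF trace_sub])

lemma set_encode_pos: "finite A \<Longrightarrow> A \<noteq> {} \<Longrightarrow> 1 \<le> set_encode A"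
  by (metis One_nat_def Suc_leI gr0I set_encode_inverse set_decode_zero)

lemma finite_trace_E: "F \<subseteq> E \<Longrightarrow> finite (trace F x)"
  by (rule finite_subset[OF trace_sub]) auto

lemma regroup_vec:
  assumes F: "finite F" "F \<subseteq> E" and G: "finite G" "G \<subseteq> E" and eq: "vec F = vec G"
  obtains g where "inj_on g (fst ` F)" "mv g F = G"
proof (rule regroup[OF F(1) G(1), of "\<lambda>x. set_encode (trace F x)" "\<lambda>x. set_encode (trace G x)"])
  show "trace F i = trace G j" if "set_encode (trace F i) = set_encode (trace G j)" for i j
    using that finite_trace_E[OF F(2)] finite_trace_E[OF G(2)] by (simp add: set_encode_eq)
  show "card {i \<in> fst ` F. set_encode (trace F i) = k} = card {j \<in> fst ` G. set_encode (trace G j) = k}" for k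
    using fun_cong[OF eq, of k] by (simp add: vec_def)
qed (rule that)

lemma t_vec:
  assumes "finite F" "F \<subseteq> E" "finite G" "G \<subseteq> E" "vec F = vec G"
  shows "t F = t G"
  using regroup_vec[OF assms] t_mv[OF assms(1,2)] by metis

lemma copies_t:
  assumes F: "finite F" "F \<subseteq> E" and G: "finite G" "G \<subseteq> E" and eq: "t F = t G"
  shows "copies F s = copies G s"
proof -
  obtain \<theta> where \<theta>: "bij_betw \<theta> F G" "\<forall>X\<subseteq>F. t (\<theta> ` X) = t X" using iso[OF F(1) G(1) F(2) G(2) eq] by blast
  have inj: "inj_on (image \<theta>) (Pow F)" by (rule inj_on_image_Pow) (use \<theta>(1) in \<open>simp add: bij_betw_def\<close>)
  have "card {X. X \<subseteq> F \<and> t X = s} = card {X. X \<subseteq> G \<and> t X = s}"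
  proof (rule card_image_eq)
    show "inj_on (image \<theta>) {X. X \<subseteq> F \<and> t X = s}" by (rule inj_on_subset[OF inj]) auto
    show "image \<theta> ` {X. X \<subseteq> F \<and> t X = s} = {X. X \<subseteq> G \<and> t X = s}"
    proof
      show "image \<theta> ` {X. X \<subseteq> F \<and> t X = s} \<subseteq> {X. X \<subseteq> G \<and> t X = s}"
        using \<theta> by (auto simp: bij_betw_def)
      show "{X. X \<subseteq> G \<and> t X = s} \<subseteq> image \<theta> ` {X. X \<subseteq> F \<and> t X = s}"
      proof
        fix Y assume Y: "Y \<in> {X. X \<subseteq> G \<and> t X = s}"
        then have "Y \<subseteq> \<theta> ` F" using \<theta>(1) by (auto simp: bij_betw_def)
        then obtain X where "X \<subseteq> F" "Y = \<theta> ` X" by (auto simp: subset_image_iff)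
        then show "Y \<in> image \<theta> ` {X. X \<subseteq> F \<and> t X = s}" using Y \<theta>(2) by auto
      qed
    qed
  qed
  then show ?thesis by (simp add: copies_def)
qed

lemma lay_eq: "lay k v = (\<Union>g\<in>{..<len}. (\<lambda>(n, c). (of_nat (prod_encode (k, prod_encode (g, n))), c)) `
    ({..<v g} \<times> set_decode g))"
  by (force simp: lay_def)

lemma finite_lay: "finite (lay k v)"
  by (auto simp: lay_eq finite_set_decode)

lemma lay_E: "lay k v \<subseteq> E"
  using set_decode_less_power unfolding lay_def len_def by fastforce

lemma trace_lay:
  "g < len \<Longrightarrow> n < v g \<Longrightarrow> trace (lay k v) (of_nat (prod_encode (k, prod_encode (g, n)))) = set_decode g"
  by (auto simp: lay_def trace_def)

lemma fst_lay: "x \<in> fst ` lay k v \<longleftrightarrow>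
    (\<exists>g n. 1 \<le> g \<and> g < len \<and> n < v g \<and> x = of_nat (prod_encode (k, prod_encode (g, n))))"
proof
  assume "x \<in> fst ` lay k v"
  then obtain g n c where "g < len" "n < v g" "c \<in> set_decode g" "x = of_nat (prod_encode (k, prod_encode (g, n)))"
    by (auto simp: lay_def)
  then show "\<exists>g n. 1 \<le> g \<and> g < len \<and> n < v g \<and> x = of_nat (prod_encode (k, prod_encode (g, n)))"
    by (metis One_nat_def Suc_leI empty_iff gr0I set_decode_zero)
next
  assume "\<exists>g n. 1 \<le> g \<and> g < len \<and> n < v g \<and> x = of_nat (prod_encode (k, prod_encode (g, n)))"
  then obtain g n where g: "1 \<le> g" "g < len" "n < v g" "x = of_nat (prod_encode (k, prod_encode (g, n)))" by blast
  have "set_decode g \<noteq> {}" using g(1) by (metis not_one_le_zero set_decode_inverse set_encode_empty)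
  then show "x \<in> fst ` lay k v" unfolding trace_nonempty g(4) by (simp add: trace_lay g)
qed

lemma vec_lay: "vec (lay k v) = clip v"
proof
  fix i
  have "{x \<in> fst ` lay k v. set_encode (trace (lay k v) x) = i} =
      (if 1 \<le> i \<and> i < len then (\<lambda>n. of_nat (prod_encode (k, prod_encode (i, n)))) ` {..<v i} else {})"
    by (auto simp: fst_lay trace_lay)
  moreover have "card ((\<lambda>n. of_nat (prod_encode (k, prod_encode (i, n))) :: rat) ` {..<v i}) = v i"
    by (subst card_image) (auto simp: inj_on_def)
  ultimately show "vec (lay k v) i = clip v i" by (simp add: vec_def clip_def)
qed

lemma vec_clip: "F \<subseteq> E \<Longrightarrow> clip (vec F) = vec F"
proof
  fix i assume F: "F \<subseteq> E"
  show "clip (vec F) i = vec F i"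
  proof (cases "1 \<le> i \<and> i < len")
    case False
    have "set_encode (trace F x) \<noteq> i" if "x \<in> fst ` F" for x
    proof -
      have "trace F x \<noteq> {}" using that unfolding trace_nonempty .
      then have "1 \<le> set_encode (trace F x)" by (rule set_encode_pos[OF finite_trace_E[OF F]])
      then show ?thesis using set_encode_trace[OF F, of x] False by auto
    qed
    then have "{x \<in> fst ` F. set_encode (trace F x) = i} = {}" by blast
    then have "vec F i = 0" unfolding vec_def by (simp only: card.empty)
    then show ?thesis by (simp add: clip_def)
  qed (simp add: clip_def)
qed

lemma clip_clip [simp]: "clip (clip v) = clip v"
  by (auto simp: clip_def fun_eq_iff)

lemma clip_add: "clip (u + v) = clip u + clip v"
  by (auto simp: clip_def fun_eq_iff)

lemma vec_Un:
  assumes "finite F" "finite G" "fst ` F \<inter> fst ` G = {}"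
  shows "vec (F \<union> G) = vec F + vec G"
proof
  fix i
  have tr: "x \<in> fst ` F \<Longrightarrow> trace (F \<union> G) x = trace F x" "x \<in> fst ` G \<Longrightarrow> trace (F \<union> G) x = trace G x" for x
    using assms(3) trace_nonempty[of x F] trace_nonempty[of x G] unfolding trace_Un by blast+
  have "{x \<in> fst ` (F \<union> G). set_encode (trace (F \<union> G) x) = i} =
      {x \<in> fst ` F. set_encode (trace F x) = i} \<union> {x \<in> fst ` G. set_encode (trace G x) = i}"
  proof (rule set_eqI)
    fix x
    show "x \<in> {x \<in> fst ` (F \<union> G). set_encode (trace (F \<union> G) x) = i} \<longleftrightarrow>
        x \<in> {x \<in> fst ` F. set_encode (trace F x) = i} \<union> {x \<in> fst ` G. set_encode (trace G x) = i}"
      using tr[of x] assms(3) unfolding image_Un Un_iff mem_Collect_eq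
      by (cases "x \<in> fst ` F"; cases "x \<in> fst ` G") simp_all
  qed
  then show "vec (F \<union> G) i = (vec F + vec G) i"
    unfolding vec_def using assms by (simp add: card_Un_disjoint disjoint_iff)
qed

lemma t_lay: "F \<subseteq> E \<Longrightarrow> finite F \<Longrightarrow> t (lay k (vec F)) = t F"
  by (rule t_vec) (simp_all add: finite_lay lay_E vec_lay vec_clip)

definition N :: "'q \<Rightarrow> (nat \<Rightarrow> nat) \<Rightarrow> int" where
  "N s v = copies (lay 0 v) s"

lemma copies_N: "finite F \<Longrightarrow> F \<subseteq> E \<Longrightarrow> vec F = clip v \<Longrightarrow> copies F s = N s v"
  unfolding N_def by (intro copies_t t_vec) (simp_all add: finite_lay lay_E vec_lay)

lemma N_clip: "N s (clip v) = N s v"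
  using copies_N[of "lay 0 (clip v)" v s] by (simp add: finite_lay lay_E vec_lay N_def)

lemma N_cong: "(\<And>i. 1 \<le> i \<Longrightarrow> i < len \<Longrightarrow> u i = v i) \<Longrightarrow> N s u = N s v"
proof -
  assume "\<And>i. 1 \<le> i \<Longrightarrow> i < len \<Longrightarrow> u i = v i"
  then have "clip u = clip v" by (auto simp: clip_def)
  then show ?thesis using N_clip by metis
qed

text \<open>Iterated differences of the counting functions count the copies that meet all the added parts.\<close>

lemma diffs_N:
  assumes "finite F" "F \<subseteq> E" "\<And>Z. Z \<in> set Zs \<Longrightarrow> finite Z \<and> Z \<subseteq> E \<and> fst ` Z \<inter> fst ` F = {}"
    and "sorted_wrt (\<lambda>Z Z'. fst ` Z \<inter> fst ` Z' = {}) Zs" and "vec F = clip y"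
  shows "int (card {X. X \<subseteq> F \<union> \<Union> (set Zs) \<and> t X = s \<and> (\<forall>Z\<in>set Zs. X \<inter> Z \<noteq> {})}) = diffs (map vec Zs) (N s) y"
  using assms
proof (induction Zs arbitrary: F y)
  case Nil
  then show ?case using copies_N[of F y s] by (simp add: copies_def)
next
  case (Cons Z Zs)
  let ?R = "\<Union> (set Zs)"
  let ?A = "\<lambda>F. {X. X \<subseteq> F \<union> ?R \<and> t X = s \<and> (\<forall>Z\<in>set Zs. X \<inter> Z \<noteq> {})}"
  have Z: "finite Z" "Z \<subseteq> E" "fst ` Z \<inter> fst ` F = {}" using Cons.prems(3) by auto
  have ZR: "Z \<inter> ?R = {}" using Cons.prems(4) by fastforce
  have ZF: "Z \<inter> F = {}" using Z(3) by blast
  have IH1: "int (card (?A F)) = diffs (map vec Zs) (N s) y"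
    by (rule Cons.IH) (use Cons.prems in auto)
  have IH2: "int (card (?A (F \<union> Z))) = diffs (map vec Zs) (N s) (y + vec Z)"
  proof (rule Cons.IH)
    show "vec (F \<union> Z) = clip (y + vec Z)"
      using vec_Un[OF Cons.prems(1) Z(1)] Z(3) Cons.prems(5) vec_clip[OF Z(2)] by (auto simp: clip_add)
    show "finite Z' \<and> Z' \<subseteq> E \<and> fst ` Z' \<inter> fst ` (F \<union> Z) = {}" if "Z' \<in> set Zs" for Z'
    proof -
      have "fst ` Z \<inter> fst ` Z' = {}" using Cons.prems(4) that by simp
      moreover have "finite Z' \<and> Z' \<subseteq> E \<and> fst ` Z' \<inter> fst ` F = {}" using Cons.prems(3) that by simp
      ultimately show ?thesis unfolding image_Un by blast
    qed
  qed (use Cons.prems Z in auto)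
  \<comment> \<open>The copies that meet \<open>Z\<close> are those inside
    \<open>F \<union> Z\<close> and the rest, minus those avoiding \<open>Z\<close>: this is the
    recursion \<open>diffs_Cons\<close>.\<close>
  have "{X. X \<subseteq> F \<union> \<Union> (set (Z # Zs)) \<and> t X = s \<and> (\<forall>Z\<in>set (Z # Zs). X \<inter> Z \<noteq> {})} = ?A (F \<union> Z) - ?A F"
  proof (rule set_eqI)
    fix X
    have "X \<inter> Z = {} \<and> X \<subseteq> F \<union> Z \<union> ?R \<longleftrightarrow> X \<subseteq> F \<union> ?R" using ZR ZF by blast
    then show "X \<in> {X. X \<subseteq> F \<union> \<Union> (set (Z # Zs)) \<and> t X = s \<and> (\<forall>Z\<in>set (Z # Zs). X \<inter> Z \<noteq> {})} \<longleftrightarrow>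
        X \<in> ?A (F \<union> Z) - ?A F"
      by (simp add: Un_assoc) blast
  qed
  moreover have "?A F \<subseteq> ?A (F \<union> Z)" by auto
  moreover have "finite (?A (F \<union> Z))"
  proof -
    have "finite (F \<union> Z \<union> ?R)" using Cons.prems Z by auto
    then have "finite (Pow (F \<union> Z \<union> ?R))" by simp
    then show ?thesis by (rule finite_subset[rotated]) auto
  qed
  ultimately have "int (card {X. X \<subseteq> F \<union> \<Union> (set (Z # Zs)) \<and> t X = s \<and> (\<forall>Z\<in>set (Z # Zs). X \<inter> Z \<noteq> {})})
      = int (card (?A (F \<union> Z))) - int (card (?A F))"
    by (simp add: card_Diff_subset finite_subset card_mono of_nat_diff)
  then show ?case unfolding IH1 IH2 by (simp only: list.map diffs_Cons)
qed

lemma fst_lay_disjoint: "k \<noteq> k' \<Longrightarrow> fst ` lay k v \<inter> fst ` lay k' v' = {}"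
  by (auto simp: fst_lay disjoint_iff)

lemma diffs_N_clip: "diffs (map clip zs) (N s) y = diffs zs (N s) y"
proof (induction zs arbitrary: y)
  case (Cons z zs)
  have "diffs zs (N s) (y + clip z) = diffs zs (N s) (y + z)"
  proof -
    have "(\<lambda>x. N s (x + clip z)) = (\<lambda>x. N s (x + z))" by (intro ext N_cong) (simp add: clip_def)
    then have "diffs zs (\<lambda>x. N s (x + clip z)) y = diffs zs (\<lambda>x. N s (x + z)) y" by simp
    then show ?thesis by (simp add: diffs_shift)
  qed
  then show ?case by (simp only: list.map diffs_Cons Cons.IH)
qed simp

text \<open>A copy of \<open>S\<close> has only \<open>card S\<close> points and cannot meet
  \<open>card S + 1\<close> disjoint parts, so the difference of that order counts nothing.\<close>

lemma degree_N:
  assumes S: "finite S" "S \<subseteq> E"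
  shows "degree_less (Suc (card S)) (N (t S))"
  unfolding degree_less_diffs
proof (intro allI impI)
  fix zs :: "(nat \<Rightarrow> nat) list" and y assume len: "length zs = Suc (card S)"
  define Zs where "Zs = map (\<lambda>j. lay (Suc j) (zs ! j)) [0..<length zs]"
  have vec_Zs: "map vec Zs = map clip zs"
    by (rule nth_equalityI) (simp_all add: Zs_def vec_lay)
  have sorted: "sorted_wrt (\<lambda>Z Z'. fst ` Z \<inter> fst ` Z' = {}) Zs"
    unfolding sorted_wrt_iff_nth_less Zs_def by (auto intro!: fst_lay_disjoint)
  have disj0: "finite Z \<and> Z \<subseteq> E \<and> fst ` Z \<inter> fst ` lay 0 y = {}" if "Z \<in> set Zs" for Z
  proof -
    obtain j where "Z = lay (Suc j) (zs ! j)" using \<open>Z \<in> set Zs\<close> by (auto simp: Zs_def)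
    then show ?thesis using finite_lay lay_E fst_lay_disjoint[of "Suc j" 0] by simp
  qed
  have "diffs (map vec Zs) (N (t S)) y = int (card {X. X \<subseteq> lay 0 y \<union> \<Union> (set Zs) \<and> t X = t S \<and> (\<forall>Z\<in>set Zs. X \<inter> Z \<noteq> {})})"
    using diffs_N[OF finite_lay lay_E disj0 sorted vec_lay] by metis
  also have "{X. X \<subseteq> lay 0 y \<union> \<Union> (set Zs) \<and> t X = t S \<and> (\<forall>Z\<in>set Zs. X \<inter> Z \<noteq> {})} = {}"
  proof (rule ccontr)
    assume "\<not> ?thesis"
    then obtain X where X: "X \<subseteq> lay 0 y \<union> \<Union> (set Zs)" "t X = t S" "\<forall>Z\<in>set Zs. X \<inter> Z \<noteq> {}" by blast
    have finU: "finite (lay 0 y \<union> \<Union> (set Zs))" using disj0 finite_lay by auto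
    have "lay 0 y \<union> \<Union> (set Zs) \<subseteq> E" using disj0 lay_E[of 0 y] by blast
    then have XE: "finite X" "X \<subseteq> E" using X(1) finU finite_subset by blast+
    have "card X = card S" using card_eq_of_t_eq XE S X(2) by blast
    have "\<forall>j<length zs. \<exists>p. p \<in> X \<and> p \<in> Zs ! j" using X(3) by (fastforce simp: Zs_def)
    then obtain p where p: "\<And>j. j < length zs \<Longrightarrow> p j \<in> X \<and> p j \<in> Zs ! j" by metis
    have "inj_on p {..<length zs}"
    proof (rule inj_onI)
      fix i j assume ij: "i \<in> {..<length zs}" "j \<in> {..<length zs}" "p i = p j"
      then have "fst (p i) \<in> fst ` lay (Suc i) (zs ! i)" "fst (p i) \<in> fst ` lay (Suc j) (zs ! j)"
        using p[of i] p[of j] by (auto simp: Zs_def)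
      then show "i = j" using fst_lay_disjoint[of "Suc i" "Suc j"] by blast
    qed
    then have "card {..<length zs} \<le> card X"
      by (rule card_inj_on_le) (use p XE in auto)
    then show False using len \<open>card X = card S\<close> by simp
  qed
  finally show "diffs zs (N (t S)) y = 0" unfolding vec_Zs diffs_N_clip by simp
qed

end

sublocale letter_system \<subseteq> block_system "{..<m}" t R1 R2 \<kappa> len set_decode
  "\<lambda>g n. of_nat (prod_encode (0, prod_encode (g, n)))" "{}"
  by unfold_locales (auto simp: len_def dest: set_decode_less_power)

section \<open>The group of invisible shifts\<close>

context letter_system
begin

lemma blocks_lay: "blocks a = lay 0 a"
  by (simp add: blocks_def lay_def)

lemma permutable: permutable
  unfolding permutable_def
proof (intro allI impI)
  fix a X and \<psi> :: "rat \<Rightarrow> rat" assume inj: "inj_on \<psi> (fst ` blocks a)" and X: "X \<subseteq> blocks a"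
  show "t (mv \<psi> X) = t X"
  proof (rule t_mv)
    show "finite X" by (rule finite_subset[OF X finite_blocks])
    show "X \<subseteq> E" using X blocks_E by blast
    show "inj_on \<psi> (fst ` X)" by (rule inj_on_subset[OF inj image_mono[OF X]])
  qed
qed

text \<open>Entries of \<open>h\<close> may be negative, so invariance is required for each pair of
  vectors of naturals that differ by \<open>h\<close>. Only types with at most \<open>d\<close>
  points are tested; \<open>H\<close> is the group reached for large \<open>d\<close>.\<close>

definition shifts :: "nat \<Rightarrow> (nat \<Rightarrow> int) set" where
  "shifts d = {h. (\<forall>i. h i \<noteq> 0 \<longrightarrow> 1 \<le> i \<and> i < len) \<and>
     (\<forall>y y'. (\<forall>i. int (y' i) = int (y i) + h i) \<longrightarrow>
        (\<forall>S. finite S \<longrightarrow> S \<subseteq> E \<longrightarrow> card S \<le> d \<longrightarrow> N (t S) y = N (t S) y'))}"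

text \<open>The difference of two translated counting functions has bounded degree. Its vanishing on
  all translates of a single pair \<open>u\<close>, \<open>u'\<close> therefore extends, by
  \<open>degree_less_shift_zero\<close>, to every pair with difference \<open>h\<close>.\<close>

lemma shifts_I:
  assumes supp: "\<And>i. h i \<noteq> 0 \<Longrightarrow> 1 \<le> i \<and> i < len" and u: "\<And>i. int (u' i) = int (u i) + h i"
    and eq: "\<And>S y. finite S \<Longrightarrow> S \<subseteq> E \<Longrightarrow> card S \<le> d \<Longrightarrow> N (t S) (y + u) = N (t S) (y + u')"
  shows "h \<in> shifts d"
  unfolding shifts_def mem_Collect_eq
proof (intro conjI allI impI)
  fix y y' S assume y: "\<forall>i. int (y' i) = int (y i) + h i" and S: "finite S" "S \<subseteq> E" "card S \<le> d"
  have yu: "y + u' = y' + u"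
  proof
    fix i have "int (y i + u' i) = int (y' i + u i)" using y u[of i] by simp
    then show "(y + u') i = (y' + u) i" by (simp only: of_nat_eq_iff plus_fun_apply)
  qed
  let ?f = "\<lambda>x. N (t S) (x + y) - N (t S) (x + y')"
  have "?f 0 = 0"
  proof (rule degree_less_shift_zero[where f = ?f and z = u and d = "Suc (card S)"])
    show "degree_less (Suc (card S)) ?f"
      by (intro degree_less_minus degree_less_shift degree_N S)
    fix x
    have "x + u + y' = x + (y' + u)" by (simp add: ac_simps)
    also have "\<dots> = (x + y) + u'" unfolding yu[symmetric] by (simp add: ac_simps)
    finally have "x + u + y = (x + y) + u" "x + u + y' = (x + y) + u'" by (simp_all add: ac_simps)
    then show "N (t S) (x + u + y) - N (t S) (x + u + y') = 0" using eq[OF S, of "x + y"] by simp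
  qed
  then show "N (t S) y = N (t S) y'" by simp
qed (use supp in auto)

lemma shifts_supp: "h \<in> shifts d \<Longrightarrow> h i \<noteq> 0 \<Longrightarrow> 1 \<le> i \<and> i < len"
  by (auto simp: shifts_def)

lemma shifts_D:
  assumes "h \<in> shifts d" "\<And>i. int (u' i) = int (u i) + h i" "finite S" "S \<subseteq> E" "card S \<le> d"
  shows "N (t S) (y + u) = N (t S) (y + u')"
proof -
  have "\<forall>i. int ((y + u') i) = int ((y + u) i) + h i" using assms(2) by simp
  then show ?thesis using assms unfolding shifts_def by blast
qed

definition pos_part :: "(nat \<Rightarrow> int) \<Rightarrow> nat \<Rightarrow> nat" where "pos_part h i = nat (h i)"

definition neg_part :: "(nat \<Rightarrow> int) \<Rightarrow> nat \<Rightarrow> nat" where "neg_part h i = nat (- h i)"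

lemma parts: "int (pos_part h i) = int (neg_part h i) + h i"
  by (simp add: pos_part_def neg_part_def)

lemma shifts_parts:
  assumes "h \<in> shifts d" "finite S" "S \<subseteq> E" "card S \<le> d"
  shows "N (t S) (y + neg_part h) = N (t S) (y + pos_part h)"
  by (rule shifts_D[where h = h]) (use assms parts in auto)

text \<open>Applying \<open>h\<close> and then \<open>k\<close> may pass through negative entries.
  Starting from the sum of the negative parts leaves room for both steps, and
  \<open>shifts_I\<close> removes the restriction.\<close>

lemma shifts_add:
  assumes h: "h \<in> shifts d" "k \<in> shifts d"
  shows "h + k \<in> shifts d"
proof (rule shifts_I[where u = "neg_part h + neg_part k" and u' = "pos_part h + pos_part k"])
  fix i show "int ((pos_part h + pos_part k) i) = int ((neg_part h + neg_part k) i) + (h + k) i"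
    using parts[of h i] parts[of k i] by simp
  show "1 \<le> i \<and> i < len" if "(h + k) i \<noteq> 0"
  proof -
    have "h i \<noteq> 0 \<or> k i \<noteq> 0" using that by auto
    then show ?thesis using shifts_supp h by blast
  qed
next
  fix S y assume S: "finite S" "S \<subseteq> E" "card S \<le> d"
  have "N (t S) (y + (neg_part h + neg_part k)) = N (t S) ((y + neg_part k) + neg_part h)"
    by (simp add: ac_simps)
  also have "\<dots> = N (t S) ((y + neg_part k) + pos_part h)" by (rule shifts_parts[OF h(1) S])
  also have "\<dots> = N (t S) ((y + pos_part h) + neg_part k)" by (simp add: ac_simps)
  also have "\<dots> = N (t S) ((y + pos_part h) + pos_part k)" by (rule shifts_parts[OF h(2) S])
  finally show "N (t S) (y + (neg_part h + neg_part k)) = N (t S) (y + (pos_part h + pos_part k))"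
    by (simp add: ac_simps)
qed

lemma shifts_uminus:
  assumes h: "h \<in> shifts d"
  shows "- h \<in> shifts d"
proof (rule shifts_I[where u = "pos_part h" and u' = "neg_part h"])
  show "int (neg_part h i) = int (pos_part h i) + (- h) i" for i using parts[of h i] by simp
  show "1 \<le> i \<and> i < len" if "(- h) i \<noteq> 0" for i using that shifts_supp[OF h, of i] by auto
  show "N (t S) (y + pos_part h) = N (t S) (y + neg_part h)"
    if "finite S" "S \<subseteq> E" "card S \<le> d" for S y
    by (rule shifts_parts[OF h that, symmetric])
qed

lemma shifts_0: "0 \<in> shifts d"
  by (rule shifts_I[of _ 0 0]) auto

lemma shifts_scale:
  assumes h: "h \<in> shifts d"
  shows "(\<lambda>i. q * h i) \<in> shifts d"
proof -
  have nat: "(\<lambda>i. int n * h i) \<in> shifts d" for n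
  proof (induction n)
    case 0
    have "(\<lambda>i. int 0 * h i) = 0" by (simp add: fun_eq_iff)
    then show ?case using shifts_0 by simp
  next
    case (Suc n)
    have "(\<lambda>i. int (Suc n) * h i) = (\<lambda>i. int n * h i) + h" by (simp add: fun_eq_iff algebra_simps)
    then show ?case using shifts_add[OF Suc h] by simp
  qed
  show ?thesis
  proof (cases "0 \<le> q")
    case True
    then show ?thesis using nat[of "nat q"] by simp
  next
    case False
    have "(\<lambda>i. q * h i) = - (\<lambda>i. int (nat (- q)) * h i)" using False by (simp add: fun_eq_iff)
    then show ?thesis using shifts_uminus[OF nat[of "nat (- q)"]] by simp
  qed
qed

text \<open>The group is pure. A shift by \<open>q * h\<close> consists of \<open>q\<close> steps by
  \<open>h\<close>; the changes along them add up to zero, and \<open>degree_less_sum_zero\<close>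
  makes each of them vanish.\<close>

lemma shifts_divide:
  assumes qh: "(\<lambda>i. int q * h i) \<in> shifts d" and q: "0 < q"
  shows "h \<in> shifts d"
proof (rule shifts_I[where u = "neg_part h" and u' = "pos_part h", OF _ parts])
  show "1 \<le> i \<and> i < len" if "h i \<noteq> 0" for i using shifts_supp[OF qh, of i] that q by simp
  fix S y assume S: "finite S" "S \<subseteq> E" "card S \<le> d"
  let ?u = "neg_part h" and ?u' = "pos_part h"
  \<comment> \<open>The common part of the points \<open>j\<close> and \<open>j + 1\<close> on the
    path from \<open>q * ?u'\<close> to \<open>q * ?u\<close>: adding \<open>?u'\<close> or
    \<open>?u\<close> gives these points, so the sum telescopes.\<close>
  let ?w = "\<lambda>j i. j * ?u i + (q - 1 - j) * ?u' i"
  have "N (t S) (y + ?u) - N (t S) (y + ?u') = 0"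
  proof (rule degree_less_sum_zero[OF _ q, where f = "\<lambda>y. N (t S) (y + ?u) - N (t S) (y + ?u')" and w = ?w
        and d = "Suc (card S)"])
    show "degree_less (Suc (card S)) (\<lambda>y. N (t S) (y + ?u) - N (t S) (y + ?u'))"
      by (intro degree_less_minus degree_less_shift degree_N S)
    fix y
    let ?f = "\<lambda>j. N (t S) (y + (\<lambda>i. j * ?u i + (q - j) * ?u' i))"
    have "(\<Sum>j<q. N (t S) (y + ?w j + ?u) - N (t S) (y + ?w j + ?u')) = (\<Sum>j<q. ?f (Suc j) - ?f j)"
    proof (rule sum.cong[OF refl])
      fix j assume "j \<in> {..<q}"
      then have j: "q - j = Suc (q - 1 - j)" "q - Suc j = q - 1 - j" by auto
      have "y + ?w j + ?u = y + (\<lambda>i. Suc j * ?u i + (q - Suc j) * ?u' i)"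
        unfolding j by (simp add: fun_eq_iff)
      moreover have "y + ?w j + ?u' = y + (\<lambda>i. j * ?u i + (q - j) * ?u' i)"
        unfolding j(1) by (simp add: fun_eq_iff)
      ultimately show "N (t S) (y + ?w j + ?u) - N (t S) (y + ?w j + ?u') = ?f (Suc j) - ?f j" by simp
    qed
    also have "\<dots> = ?f q - ?f 0" by (rule sum_lessThan_telescope)
    also have "\<dots> = 0"
    proof -
      have "N (t S) (y + (\<lambda>i. q * ?u i)) = N (t S) (y + (\<lambda>i. q * ?u' i))"
      proof (rule shifts_D[OF qh _ S])
        show "int (q * ?u' i) = int (q * ?u i) + int q * h i" for i
          using parts[of h i] by (simp add: algebra_simps)
      qed
      then show ?thesis by simp
    qed
    finally show "(\<Sum>j<q. N (t S) (y + ?w j + ?u) - N (t S) (y + ?w j + ?u')) = 0" .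
  qed
  then show "N (t S) (y + ?u) = N (t S) (y + ?u')" by simp
qed

text \<open>Positions of leading entries, the analogue of pivots in an echelon form.\<close>

definition tops :: "nat \<Rightarrow> nat set" where
  "tops d = {i. \<exists>h\<in>shifts d. h i \<noteq> 0 \<and> (\<forall>j>i. h j = 0)}"

lemma shifts_antimono: "d \<le> d' \<Longrightarrow> shifts d' \<subseteq> shifts d"
proof
  fix h assume d: "d \<le> d'" and h: "h \<in> shifts d'"
  show "h \<in> shifts d"
    by (rule shifts_I[where u = "neg_part h" and u' = "pos_part h", OF shifts_supp[OF h] parts])
      (use shifts_parts[OF h] d in auto)
qed

lemma tops_sub: "tops d \<subseteq> {1..<len}"
  using shifts_supp by (fastforce simp: tops_def)

lemma tops_antimono: "d \<le> d' \<Longrightarrow> tops d' \<subseteq> tops d"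
  using shifts_antimono unfolding tops_def by blast

text \<open>Gaussian elimination from the top: the leading entry of \<open>h\<close> is cancelled
  against a shift with the same leading position, and the integer factor that this introduces is
  removed by \<open>shifts_divide\<close>.\<close>

lemma shifts_eq_of_tops_eq:
  assumes "d \<le> d'" "tops d' = tops d"
  shows "shifts d = shifts d'"
proof
  have "h \<in> shifts d'" if "h \<in> shifts d" "\<forall>j\<ge>n. h j = 0" for h n
    using that
  proof (induction n arbitrary: h)
    case 0
    then have "h = 0" by (simp add: fun_eq_iff)
    then show ?case by (simp only: shifts_0)
  next
    case (Suc n)
    show ?case
    proof (cases "h n = 0")
      case True
      then have "\<forall>j\<ge>n. h j = 0" using Suc.prems(2) by (metis le_antisym not_less_eq_eq)
      then show ?thesis by (rule Suc.IH[OF Suc.prems(1)])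
    next
      case False
      then have "n \<in> tops d" using Suc.prems unfolding tops_def by (auto simp: Suc_le_eq)
      then have "n \<in> tops d'" using assms(2) by simp
      then obtain k where k: "k \<in> shifts d'" "k n \<noteq> 0" "\<forall>j>n. k j = 0"
        by (auto simp: tops_def)
      define w where "w = (\<lambda>i. k n * h i) + - (\<lambda>i. h n * k i)"
      have "w \<in> shifts d"
        unfolding w_def using k(1) shifts_antimono[OF assms(1)]
        by (intro shifts_add shifts_uminus shifts_scale Suc.prems(1)) blast
      moreover have "\<forall>j\<ge>n. w j = 0"
      proof (intro allI impI)
        fix j assume "n \<le> j"
        then consider "j = n" | "n < j" by linarith
        then show "w j = 0" using Suc.prems(2) k(3) by cases (auto simp: w_def Suc_le_eq)
      qed
      ultimately have "w \<in> shifts d'" by (rule Suc.IH)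
      then have "w + (\<lambda>i. h n * k i) \<in> shifts d'" by (intro shifts_add shifts_scale k(1))
      moreover have "w + (\<lambda>i. h n * k i) = (\<lambda>i. k n * h i)" by (simp add: w_def fun_eq_iff)
      ultimately have kh: "(\<lambda>i. k n * h i) \<in> shifts d'" by simp
      have "(\<lambda>i. int (nat \<bar>k n\<bar>) * h i) \<in> shifts d'"
      proof (cases "0 \<le> k n")
        case True
        then show ?thesis using kh by simp
      next
        case False
        then have "(\<lambda>i. int (nat \<bar>k n\<bar>) * h i) = - (\<lambda>i. k n * h i)" by (simp add: fun_eq_iff)
        then show ?thesis using shifts_uminus[OF kh] by simp
      qed
      then show ?thesis by (rule shifts_divide) (use k(2) in simp)
    qed
  qed
  moreover have "\<forall>j\<ge>len. h j = 0" if "h \<in> shifts d" for h using shifts_supp[OF that] by (metis not_le)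
  ultimately show "shifts d \<subseteq> shifts d'" by blast
qed (rule shifts_antimono[OF assms(1)])

text \<open>As \<open>d\<close> grows, the leading positions form a decreasing sequence of subsets
  of a finite set; once it is constant, so are the groups.\<close>

lemma shifts_stable: "\<exists>d. \<forall>d'\<ge>d. shifts d' = shifts d"
proof -
  obtain d where d: "\<And>d'. card (tops d) \<le> card (tops d')"
    using ex_has_least_nat[of "\<lambda>_. True" 0 "\<lambda>d. card (tops d)"] by auto
  have "shifts d' = shifts d" if "d \<le> d'" for d'
  proof (rule shifts_eq_of_tops_eq[OF that, symmetric])
    have "finite (tops d)" by (rule finite_subset[OF tops_sub]) simp
    then show "tops d' = tops d" using tops_antimono[OF that] d[of d'] by (intro card_seteq)
  qed
  then show ?thesis by blast
qed

definition d\<^sub>0 :: nat where "d\<^sub>0 = (SOME d. \<forall>d'\<ge>d. shifts d' = shifts d)"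

definition H :: "(nat \<Rightarrow> int) set" where "H = shifts d\<^sub>0"

text \<open>The letters that are no pivots: since \<open>H\<close> is pure, \<open>card Q\<close> is
  the rank of the integer vectors on letters modulo \<open>H\<close>.\<close>

definition Q :: "nat set" where "Q = {1..<len} - tops d\<^sub>0"

lemma H_shifts: "h \<in> H \<Longrightarrow> h \<in> shifts d"
proof -
  assume "h \<in> H"
  moreover have "\<forall>d'\<ge>d\<^sub>0. shifts d' = shifts d\<^sub>0" unfolding d\<^sub>0_def by (rule someI_ex[OF shifts_stable])
  then have "shifts (max d d\<^sub>0) = shifts d\<^sub>0" by (rule allE[of _ "max d d\<^sub>0"]) (simp only: max.cobounded2)
  ultimately have "h \<in> shifts (max d d\<^sub>0)" by (simp only: H_def)
  then show ?thesis using shifts_antimono[of d "max d d\<^sub>0"] by auto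
qed

text \<open>A shift in \<open>H\<close> is invisible to types of every size, in particular to those
  of the two layers themselves. So each layer contains a copy of the other, and by comparison of
  sizes the copy is everything.\<close>

lemma t_lay_H:
  assumes "h \<in> H" "\<And>i. int (y' i) = int (y i) + h i"
  shows "t (lay 0 y) = t (lay 0 y')"
proof -
  have *: "\<exists>X\<subseteq>lay 0 y'. t X = t (lay 0 y) \<and> card X = card (lay 0 y)"
    if h: "h \<in> H" "\<And>i. int (y' i) = int (y i) + h i" for h y y'
  proof -
    let ?S = "lay 0 y"
    have "N (t ?S) (0 + y) = N (t ?S) (0 + y')"
      by (rule shifts_D[OF H_shifts[OF h(1)] h(2) finite_lay lay_E order_refl])
    moreover have "N (t ?S) y \<noteq> 0"
    proof -
      have "finite {X. X \<subseteq> ?S \<and> t X = t ?S}"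
        by (rule finite_subset[of _ "Pow ?S"]) (auto simp: finite_lay)
      moreover have "?S \<in> {X. X \<subseteq> ?S \<and> t X = t ?S}" by simp
      ultimately have "card {X. X \<subseteq> ?S \<and> t X = t ?S} \<noteq> 0" by (metis card_0_eq empty_iff)
      then show ?thesis by (simp add: N_def copies_def)
    qed
    ultimately have "card {X. X \<subseteq> lay 0 y' \<and> t X = t ?S} \<noteq> 0" by (simp add: N_def copies_def)
    then have "{X. X \<subseteq> lay 0 y' \<and> t X = t ?S} \<noteq> {}" by (metis card.empty)
    then obtain X where X: "X \<subseteq> lay 0 y'" "t X = t ?S" by auto
    have "finite X" "X \<subseteq> E" using finite_subset[OF X(1) finite_lay] order_trans[OF X(1) lay_E] by auto
    then have "card X = card ?S" by (intro card_eq_of_t_eq finite_lay lay_E X(2))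
    then show ?thesis using X by blast
  qed
  obtain X where X: "X \<subseteq> lay 0 y'" "t X = t (lay 0 y)" "card X = card (lay 0 y)" using *[OF assms] by blast
  have "- h \<in> H" unfolding H_def by (rule shifts_uminus) (use assms(1) H_def in simp)
  then obtain X' where X': "X' \<subseteq> lay 0 y" "card X' = card (lay 0 y')"
    using *[of "- h" y y'] assms(2) by auto
  have "card (lay 0 y') \<le> card X" using card_mono[OF finite_lay X'(1)] X(3) X'(2) by simp
  then have "X = lay 0 y'" by (rule card_seteq[OF finite_lay X(1)])
  then show ?thesis using X(2) by simp
qed

lemma t_eq_of_H:
  assumes F: "finite F" "F \<subseteq> E" and G: "finite G" "G \<subseteq> E"
    and h: "(\<lambda>i. int (vec F i) - int (vec G i)) \<in> H"
  shows "t F = t G"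
proof -
  have "t (lay 0 (vec G)) = t (lay 0 (vec F))" by (rule t_lay_H[OF h]) simp
  then show ?thesis using t_lay F G by simp
qed

subsection \<open>Counting the types of a given size\<close>

text \<open>This weight increases when a piece is replaced by a smaller one or is split.\<close>

definition wt :: "(rat \<times> nat) set \<Rightarrow> nat" where
  "wt F = (\<Sum>x\<in>fst ` F. len - set_encode (trace F x))"

lemma wt_Un:
  assumes "finite F" "finite G" "fst ` F \<inter> fst ` G = {}"
  shows "wt (F \<union> G) = wt F + wt G"
proof -
  have tr: "x \<in> fst ` F \<Longrightarrow> trace (F \<union> G) x = trace F x" "x \<in> fst ` G \<Longrightarrow> trace (F \<union> G) x = trace G x" for x
    using assms(3) trace_nonempty[of x F] trace_nonempty[of x G] unfolding trace_Un by blast+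
  have "wt (F \<union> G) = (\<Sum>x\<in>fst ` F \<union> fst ` G. len - set_encode (trace (F \<union> G) x))"
    by (simp add: wt_def image_Un)
  also have "\<dots> = (\<Sum>x\<in>fst ` F. len - set_encode (trace (F \<union> G) x)) + (\<Sum>x\<in>fst ` G. len - set_encode (trace (F \<union> G) x))"
    by (rule sum.union_disjoint) (use assms in auto)
  finally show ?thesis using tr by (simp add: wt_def)
qed

lemma vec_piece:
  assumes "1 \<le> i"
  shows "vec ({x} \<times> set_decode i) = unit i"
proof
  fix j
  have "set_decode i \<noteq> {}" using assms by (metis not_one_le_zero set_decode_inverse set_encode_empty)
  then have f: "fst ` ({x} \<times> set_decode i) = {x}" by auto
  have "trace ({x} \<times> set_decode i) x = set_decode i" by auto
  then have "{y \<in> fst ` ({x} \<times> set_decode i). set_encode (trace ({x} \<times> set_decode i) y) = j} = (if j = i then {x} else {})"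
    unfolding f by auto
  then show "vec ({x} \<times> set_decode i) j = unit i j" by (simp add: vec_def unit_def)
qed

lemma wt_piece: "1 \<le> i \<Longrightarrow> wt ({x} \<times> set_decode i) = len - i"
proof -
  assume "1 \<le> i"
  then have "set_decode i \<noteq> {}" by (metis not_one_le_zero set_decode_inverse set_encode_empty)
  then have "fst ` ({x} \<times> set_decode i) = {x}" by auto
  moreover have "trace ({x} \<times> set_decode i) x = set_decode i" by auto
  ultimately show ?thesis by (simp add: wt_def)
qed

lemma wt_vec:
  assumes "finite F" "F \<subseteq> E"
  shows "wt F = (\<Sum>i\<in>{1..<len}. (len - i) * vec F i)"
proof -
  have enc: "set_encode (trace F x) \<in> {1..<len}" if "x \<in> fst ` F" for x
    using that set_encode_trace[OF assms(2), of x] set_encode_pos[OF finite_trace_E[OF assms(2), of x]]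
    unfolding trace_nonempty by simp
  have "wt F = (\<Sum>i\<in>{1..<len}. \<Sum>x\<in>{x \<in> fst ` F. set_encode (trace F x) = i}. len - set_encode (trace F x))"
    unfolding wt_def by (rule sum.group[symmetric]) (use assms(1) enc in \<open>simp_all add: image_subsetI\<close>)
  also have "\<dots> = (\<Sum>i\<in>{1..<len}. (len - i) * vec F i)"
    by (intro sum.cong refl) (simp add: vec_def)
  finally show ?thesis .
qed

lemma card_vec:
  assumes "finite F" "F \<subseteq> E"
  shows "card F = (\<Sum>i\<in>{1..<len}. card (set_decode i) * vec F i)"
proof -
  have enc: "set_encode (trace F x) \<in> {1..<len}" if "x \<in> fst ` F" for x
    using that set_encode_trace[OF assms(2), of x] set_encode_pos[OF finite_trace_E[OF assms(2), of x]]
    unfolding trace_nonempty by simp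
  have F_eq: "F = (SIGMA x:fst ` F. trace F x)" by force
  have "card F = (\<Sum>x\<in>fst ` F. card (trace F x))"
    by (subst F_eq, subst card_SigmaI) (use assms(1) finite_trace_E[OF assms(2)] in auto)
  also have "\<dots> = (\<Sum>i\<in>{1..<len}. \<Sum>x\<in>{x \<in> fst ` F. set_encode (trace F x) = i}. card (trace F x))"
    by (rule sum.group[symmetric]) (use assms(1) enc in \<open>simp_all add: image_subsetI\<close>)
  also have "\<dots> = (\<Sum>i\<in>{1..<len}. card (set_decode i) * vec F i)"
  proof (intro sum.cong refl)
    fix i
    have "(\<Sum>x\<in>{x \<in> fst ` F. set_encode (trace F x) = i}. card (trace F x)) =
        (\<Sum>x\<in>{x \<in> fst ` F. set_encode (trace F x) = i}. card (set_decode i))"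
      by (intro sum.cong refl) (use finite_trace_E[OF assms(2)] in auto)
    then show "(\<Sum>x\<in>{x \<in> fst ` F. set_encode (trace F x) = i}. card (trace F x)) = card (set_decode i) * vec F i"
      by (simp add: vec_def)
  qed
  finally show ?thesis .
qed

text \<open>If all copies of \<open>s\<close> weigh at most as much as \<open>v = v' + unit i\<close>, then in
  \<open>v' + u\<close> the only copies meeting all pieces of \<open>v'\<close> are \<open>v'\<close> plus one of the \<open>u i\<close> pieces \<open>i\<close>.\<close>

lemma diffs_maximal:
  assumes v: "s = t (lay 0 (v' + unit i))" and i: "1 \<le> i" "i < len"
    and max: "\<And>F. finite F \<Longrightarrow> F \<subseteq> E \<Longrightarrow> t F = s \<Longrightarrow> wt F \<le> wt (lay 0 (v' + unit i))"
    and u: "\<And>j. i < j \<Longrightarrow> u j = 0"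
    and Zs: "set Zs = (\<lambda>x. {x} \<times> trace (lay 0 v') x) ` fst ` lay 0 v'" "distinct Zs"
  shows "diffs (map vec Zs) (N s) u = int (u i)"
proof -
  let ?V = "lay 0 v'" and ?U = "lay 1 u"
  have UV: "fst ` ?V \<inter> fst ` ?U = {}" by (rule fst_lay_disjoint) simp
  have V_eq: "\<Union> (set Zs) = ?V" unfolding Zs(1) by force
  have finV: "finite (fst ` ?V)" using finite_lay by simp
  have ZsD: "finite Z \<and> Z \<subseteq> E \<and> fst ` Z \<inter> fst ` ?U = {}" if "Z \<in> set Zs" for Z
  proof -
    have "Z \<subseteq> ?V" using that V_eq by blast
    then show ?thesis using finite_subset[OF _ finite_lay] lay_E UV by blast
  qed
  have sorted: "sorted_wrt (\<lambda>Z Z'. fst ` Z \<inter> fst ` Z' = {}) Zs"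
    unfolding sorted_wrt_iff_nth_less
  proof (intro allI impI)
    fix a b assume ab: "a < b" "b < length Zs"
    then have "Zs ! a \<noteq> Zs ! b" using Zs(2) by (simp add: nth_eq_iff_index_eq)
    moreover have "Zs ! a \<in> set Zs" "Zs ! b \<in> set Zs" using ab by simp_all
    then obtain x y where "Zs ! a = {x} \<times> trace ?V x" "Zs ! b = {y} \<times> trace ?V y" unfolding Zs(1) by blast
    ultimately show "fst ` (Zs ! a) \<inter> fst ` (Zs ! b) = {}" by auto
  qed
  let ?A = "{X. X \<subseteq> ?U \<union> ?V \<and> t X = s \<and> (\<forall>Z\<in>set Zs. X \<inter> Z \<noteq> {})}"
  have "diffs (map vec Zs) (N s) u = int (card ?A)"
    using diffs_N[OF finite_lay lay_E ZsD sorted vec_lay, of s] unfolding V_eq by simp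
  also have "?A = (\<lambda>n. ?V \<union> {of_nat (prod_encode (1, prod_encode (i, n)))} \<times> set_decode i) ` {..<u i}"
    (is "_ = ?p ` _")
  proof
    have vec_p: "vec (?p n) = clip (v' + unit i)" and p_E: "finite (?p n)" "?p n \<subseteq> E"
      and wt_p: "wt (?p n) = wt ?V + (len - i)" for n
    proof -
      let ?P = "{of_nat (prod_encode (1, prod_encode (i, n)))} \<times> set_decode i :: (rat \<times> nat) set"
      have P: "finite ?P" "?P \<subseteq> E"
        using i set_decode_less_power[of i m] by (auto simp: finite_set_decode len_def)
      then show "finite (?p n)" "?p n \<subseteq> E" using finite_lay lay_E[of 0 v'] by auto
      have disj: "fst ` ?V \<inter> fst ` ?P = {}" by (auto simp: fst_lay)
      have "clip (unit i) = unit i" using i by (auto simp: clip_def unit_def)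
      then show "vec (?p n) = clip (v' + unit i)"
        using vec_Un[OF finite_lay P(1) disj] vec_piece[OF i(1)] by (simp add: vec_lay clip_add)
      show "wt (?p n) = wt ?V + (len - i)"
        using wt_Un[OF finite_lay P(1) disj] wt_piece[OF i(1)] by simp
    qed
    have t_p: "t (?p n) = s" for n
      unfolding v by (rule t_vec[OF p_E finite_lay lay_E]) (simp only: vec_p vec_lay)
    have wt_v: "wt (lay 0 (v' + unit i)) = wt ?V + (len - i)"
    proof -
      have "wt (lay 0 (v' + unit i)) = wt (?p 0)"
        by (simp only: wt_vec[OF finite_lay lay_E] wt_vec[OF p_E] vec_p vec_lay)
      then show ?thesis using wt_p by simp
    qed
    have card_v: "card (lay 0 (v' + unit i)) = card ?V + card (set_decode i)"
    proof -
      let ?P = "{of_nat (prod_encode (1, prod_encode (i, 0)))} \<times> set_decode i :: (rat \<times> nat) set"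
      have "card (lay 0 (v' + unit i)) = card (?p 0)"
        by (simp only: card_vec[OF finite_lay lay_E] card_vec[OF p_E] vec_p vec_lay)
      also have "\<dots> = card ?V + card ?P"
        by (rule card_Un_disjoint[OF finite_lay]) (auto simp: finite_set_decode lay_def)
      finally show ?thesis by (simp add: card_cartesian_product)
    qed
    show "?p ` {..<u i} \<subseteq> ?A"
    proof
      fix X assume "X \<in> ?p ` {..<u i}"
      then obtain n where n: "X = ?p n" "n < u i" by blast
      have "{of_nat (prod_encode (1, prod_encode (i, n)))} \<times> set_decode i \<subseteq> ?U"
        using n(2) i by (auto simp: lay_def)
      then have "X \<subseteq> ?U \<union> ?V" using n(1) by blast
      moreover have "X \<inter> Z \<noteq> {}" if Z: "Z \<in> set Zs" for Z
      proof -
        obtain x where "x \<in> fst ` ?V" "Z = {x} \<times> trace ?V x" using Z unfolding Zs(1) by blast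
        then have "Z \<noteq> {}" unfolding trace_nonempty by blast
        moreover have "Z \<subseteq> X" using Z V_eq n(1) by blast
        ultimately show ?thesis by blast
      qed
      ultimately show "X \<in> ?A" using t_p n(1) by simp
    qed
    show "?A \<subseteq> ?p ` {..<u i}"
    proof
      fix X assume "X \<in> ?A"
      then have X: "X \<subseteq> ?U \<union> ?V" "t X = s" "\<And>Z. Z \<in> set Zs \<Longrightarrow> X \<inter> Z \<noteq> {}" by auto
      let ?T = "X \<inter> ?V" and ?G = "X \<inter> ?U"
      have fin: "finite ?T" "finite ?G" using finite_lay by auto
      have TE: "?T \<subseteq> E" "?G \<subseteq> E" using lay_E by blast+
      have X_eq: "X = ?T \<union> ?G" using X(1) by blast
      have disj: "fst ` ?T \<inter> fst ` ?G = {}" using UV by blast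
      have XE: "finite X" "X \<subseteq> E" using X_eq fin TE by (metis finite_UnI, blast)
      have fst_T: "fst ` ?T = fst ` ?V"
      proof
        show "fst ` ?V \<subseteq> fst ` ?T"
        proof
          fix x assume x: "x \<in> fst ` ?V"
          then have "{x} \<times> trace ?V x \<in> set Zs" unfolding Zs(1) by blast
          then obtain c where "(x, c) \<in> X" "(x, c) \<in> ?V" using X(3) by force
          then show "x \<in> fst ` ?T" by force
        qed
      qed blast
      \<comment> \<open>A copy that meets every piece of \<open>?V\<close> keeps all its indices
        with possibly smaller traces, which can only raise the weight. This leaves weight at most
        \<open>len - i\<close> for \<open>?G\<close>.\<close>
      have "wt ?V \<le> wt ?T"
        unfolding wt_def fst_T
      proof (intro sum_mono diff_le_mono2 set_encode_mono)
        show "trace ?T x \<subseteq> trace ?V x" "finite (trace ?V x)" for x using finite_trace[OF finite_lay] by auto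
      qed
      moreover have "wt X \<le> wt ?V + (len - i)" using max[OF XE X(2)] wt_v by simp
      moreover have "wt X = wt ?T + wt ?G" using wt_Un[OF fin disj] X_eq by simp
      ultimately have wt_G: "wt ?G \<le> len - i" by linarith
      \<comment> \<open>Letters of \<open>u\<close> do not exceed \<open>i\<close>, so each index of
        \<open>?G\<close> weighs at least \<open>len - i\<close>. Hence there is just one, and its
        trace has code exactly \<open>i\<close>.\<close>
      have enc_le: "set_encode (trace ?G x) \<le> i" for x
      proof (cases "x \<in> fst ` ?G")
        case True
        then have "x \<in> fst ` ?U" by blast
        then obtain g n where g: "1 \<le> g" "g < len" "n < u g" "x = of_nat (prod_encode (1, prod_encode (g, n)))"
          unfolding fst_lay by blast
        have "g \<le> i" using u[of g] g(3) by (metis not_less not_less_zero)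
        have "trace ?G x \<subseteq> trace ?U x" by auto
        then have "trace ?G x \<subseteq> set_decode g" unfolding g(4) trace_lay[of g n u 1, OF g(2,3)] .
        then have "set_encode (trace ?G x) \<le> g" using set_encode_mono(1)[OF _ finite_set_decode, of _ g] by simp
        then show ?thesis using \<open>g \<le> i\<close> by simp
      next
        case False
        then have "trace ?G x = {}" unfolding trace_nonempty by simp
        then show ?thesis by simp
      qed
      have "card X = card (lay 0 (v' + unit i))"
        using card_eq_of_t_eq[OF XE(1) finite_lay XE(2) lay_E] X(2) v by blast
      then have card_X: "card X = card ?V + card (set_decode i)" using card_v by simp
      have card_TG: "card X = card ?T + card ?G"
        using card_Un_disjoint[OF fin] UV X_eq by (metis (no_types, lifting) disj disjoint_iff imageI)
      have card_T: "card ?T \<le> card ?V" by (rule card_mono[OF finite_lay]) blast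
      have "set_decode i \<noteq> {}" using i by (metis not_one_le_zero set_decode_inverse set_encode_empty)
      then have "0 < card (set_decode i)" by (simp add: card_gt_0_iff finite_set_decode)
      then have "?G \<noteq> {}" using card_X card_TG card_T by auto
      then obtain x where x: "x \<in> fst ` ?G" by blast
      have finG: "finite (fst ` ?G)" using fin by simp
      have fst_G: "fst ` ?G = {x}"
      proof (rule ccontr)
        assume "fst ` ?G \<noteq> {x}"
        then obtain x' where x': "x' \<in> fst ` ?G" "x' \<noteq> x" using x by blast
        have "(\<Sum>z\<in>{x, x'}. len - set_encode (trace ?G z)) \<le> wt ?G"
          unfolding wt_def by (rule sum_mono2[OF finG]) (use x x' in auto)
        moreover have "len - i \<le> len - set_encode (trace ?G z)" for z using enc_le[of z] by simp
        then have "2 * (len - i) \<le> (\<Sum>z\<in>{x, x'}. len - set_encode (trace ?G z))"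
          using x'(2) by (auto simp: mult_2 add_mono)
        ultimately show False using wt_G i by linarith
      qed
      then have "wt ?G = len - set_encode (trace ?G x)" by (simp add: wt_def)
      then have enc: "set_encode (trace ?G x) = i" using wt_G enc_le[of x] i by linarith
      have trG: "trace ?G x = set_decode i"
        using enc finite_trace_E[OF TE(2), of x] by (metis set_encode_inverse)
      have G_eq: "?G = {x} \<times> set_decode i" using fst_G trG by force
      have "card ?G = card (set_decode i)" unfolding G_eq by (simp add: card_cartesian_product)
      \<comment> \<open>The single new piece accounts for \<open>card (set_decode i)\<close> points,
        so no point of \<open>?V\<close> can be missing from the copy.\<close>
      then have "card ?V \<le> card ?T" using card_X card_TG by linarith
      then have T_eq: "?T = ?V" by (rule card_seteq[OF finite_lay, rotated]) blast
      obtain g n where g: "1 \<le> g" "g < len" "n < u g" "x = of_nat (prod_encode (1, prod_encode (g, n)))"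
      proof -
        have "x \<in> fst ` ?U" using x by blast
        then show ?thesis using that unfolding fst_lay by blast
      qed
      have "g \<le> i" using u[of g] g(3) by (metis not_less not_less_zero)
      moreover have "i \<le> g"
      proof -
        have "trace ?U x = set_decode g" unfolding g(4) by (rule trace_lay; rule g)
        moreover have "trace ?G x \<subseteq> trace ?U x" by auto
        ultimately have "set_decode i \<subseteq> set_decode g" by (simp only: trG)
        then have "set_encode (set_decode i) \<le> set_encode (set_decode g)"
          by (rule set_encode_mono) (rule finite_set_decode)
        then show ?thesis by simp
      qed
      ultimately have "g = i" by simp
      then have "X = ?p n" using X_eq T_eq G_eq g(4) by simp
      then show "X \<in> ?p ` {..<u i}" using g(3) \<open>g = i\<close> by blast
    qed
  qed
  also have "card (?p ` {..<u i}) = u i"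
  proof -
    have "inj_on ?p {..<u i}"
    proof (rule inj_onI)
      fix n n' assume eq: "?p n = ?p n'"
      have "set_decode i \<noteq> {}" using i by (metis not_one_le_zero set_decode_inverse set_encode_empty)
      then obtain c where "c \<in> set_decode i" by blast
      then have "(of_nat (prod_encode (1, prod_encode (i, n))), c) \<in> ?p n'" using eq by blast
      moreover have "(of_nat (prod_encode (1, prod_encode (i, n))) :: rat, c) \<notin> ?V" by (auto simp: lay_def)
      ultimately show "n = n'" by auto
    qed
    then show ?thesis by (simp add: card_image)
  qed
  finally show ?thesis .
qed

end

section \<open>Arithmetic of quotients and of weighted vectors\<close>

lemma abs_div_le:
  fixes z k :: int
  assumes "0 < k"
  shows "\<bar>z div k\<bar> \<le> \<bar>z\<bar>"
proof -
  define q r where "q = z div k" and "r = z mod k"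
  define p where "p = q * (k - 1)"
  have z: "z = p + q + r" by (simp add: p_def q_def r_def algebra_simps)
  have r: "0 \<le> r" "r < k" using assms by (simp_all add: r_def)
  have "\<bar>q\<bar> \<le> \<bar>z\<bar>"
  proof (cases "0 \<le> q")
    case True
    then have "0 \<le> p" using assms by (simp add: p_def)
    then show ?thesis using z r True by linarith
  next
    case False
    then have "p \<le> - 1 * (k - 1)" unfolding p_def using assms by (intro mult_right_mono) auto
    then have "z \<le> q" using z r by auto
    then show ?thesis using False by simp
  qed
  then show ?thesis by (simp add: q_def)
qed

text \<open>As \<open>w q\<close> is positive, different values of the entry at \<open>q\<close>
  leave different remainders \<open>j \<le> n\<close> for the other coordinates. The induction thus
  sums binomials over distinct \<open>j\<close>, and the hockey-stick identity gives the
  bound.\<close>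

lemma card_weighted_vectors:
  fixes w :: "nat \<Rightarrow> nat"
  assumes "finite Q" "\<And>i. i \<in> Q \<Longrightarrow> 1 \<le> w i" "card Q \<le> Suc k"
  shows "finite {v. (\<forall>i. i \<notin> Q \<longrightarrow> v i = 0) \<and> (\<Sum>i\<in>Q. w i * v i) = n} \<and>
    card {v. (\<forall>i. i \<notin> Q \<longrightarrow> v i = 0) \<and> (\<Sum>i\<in>Q. w i * v i) = n} \<le> (n + k) choose n"
  using assms
proof (induction Q arbitrary: k n rule: finite_induct)
  case empty
  have sub: "{v. (\<forall>i. i \<notin> ({} :: nat set) \<longrightarrow> v i = 0) \<and> (\<Sum>i\<in>{}. w i * v i) = n} \<subseteq> {\<lambda>_. 0 :: nat}" by auto
  then have "card {v. (\<forall>i. i \<notin> ({} :: nat set) \<longrightarrow> v i = (0::nat)) \<and> (\<Sum>i\<in>{}. w i * v i) = n} \<le> 1"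
    using card_mono[OF _ sub] by simp
  moreover have "1 \<le> (n + k) choose n" by (simp add: Suc_le_eq)
  ultimately show ?case using finite_subset[OF sub] by simp
next
  case (insert q Q)
  let ?S = "\<lambda>Q n. {v. (\<forall>i. i \<notin> Q \<longrightarrow> v i = 0) \<and> (\<Sum>i\<in>Q. w i * v i) = n}"
  let ?A = "{a. w q * a \<le> n}"
  have wq: "1 \<le> w q" using insert.prems(1) by simp
  have "a \<le> n" if "w q * a \<le> n" for a
  proof -
    have "a \<le> w q * a" using mult_le_mono1[OF wq, of a] by (simp only: mult_1)
    then show ?thesis using that by (rule order_trans)
  qed
  then have finA: "finite ?A" by (intro finite_subset[of ?A "{..n}"]) auto
  have sub: "?S (insert q Q) n \<subseteq> (\<Union>a\<in>?A. (\<lambda>v. v(q := a)) ` ?S Q (n - w q * a))"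
  proof
    fix v assume v: "v \<in> ?S (insert q Q) n"
    then have sum: "w q * v q + (\<Sum>i\<in>Q. w i * v i) = n" using insert.hyps by simp
    have "(\<Sum>i\<in>Q. w i * (v(q := 0)) i) = (\<Sum>i\<in>Q. w i * v i)"
      by (rule sum.cong) (use insert.hyps in auto)
    then have "v(q := 0) \<in> ?S Q (n - w q * v q)" using v sum by auto
    then have "v \<in> (\<lambda>x. x(q := v q)) ` ?S Q (n - w q * v q)" by (intro image_eqI[of _ _ "v(q := 0)"]) simp_all
    moreover have "v q \<in> ?A" using sum by simp
    ultimately show "v \<in> (\<Union>a\<in>?A. (\<lambda>v. v(q := a)) ` ?S Q (n - w q * a))" by (intro UN_I[of "v q"])
  qed
  show ?case
  proof (cases k)
    case 0
    then have "Q = {}" using insert by simp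
    have sub1: "?S (insert q Q) n \<subseteq> {\<lambda>i. if i = q then n div w q else 0}"
      using wq unfolding \<open>Q = {}\<close> by (auto simp: fun_eq_iff)
    have "card (?S (insert q Q) n) \<le> 1" using card_mono[OF _ sub1] by simp
    moreover have "finite (?S (insert q Q) n)" by (rule finite_subset[OF sub1]) simp
    ultimately show ?thesis using 0 by simp
  next
    case (Suc k')
    have IH: "finite (?S Q n')" "card (?S Q n') \<le> (n' + k') choose n'" for n'
      using insert.IH[of k' n'] insert.prems insert.hyps Suc by auto
    have fin: "finite (\<Union>a\<in>?A. (\<lambda>v. v(q := a)) ` ?S Q (n - w q * a))"
      using finA IH(1) by blast
    have "card (?S (insert q Q) n) \<le> card (\<Union>a\<in>?A. (\<lambda>v. v(q := a)) ` ?S Q (n - w q * a))"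
      by (rule card_mono[OF fin sub])
    also have "\<dots> \<le> (\<Sum>a\<in>?A. card ((\<lambda>v. v(q := a)) ` ?S Q (n - w q * a)))"
      by (rule card_UN_le[OF finA])
    also have "\<dots> \<le> (\<Sum>a\<in>?A. (n - w q * a + k') choose (n - w q * a))"
      by (intro sum_mono order_trans[OF card_image_le[OF IH(1)] IH(2)])
    also have "\<dots> = (\<Sum>j\<in>(\<lambda>a. n - w q * a) ` ?A. (j + k') choose j)"
    proof (rule sum.reindex_cong[symmetric, where l = "\<lambda>a. n - w q * a"])
      show "inj_on (\<lambda>a. n - w q * a) ?A"
      proof (rule inj_onI)
        fix a b assume "a \<in> ?A" "b \<in> ?A" "n - w q * a = n - w q * b"
        then have "w q * a = w q * b" unfolding mem_Collect_eq by linarith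
        then show "a = b" using wq by simp
      qed
    qed auto
    also have "\<dots> \<le> (\<Sum>j\<le>n. (j + k') choose j)"
      by (rule sum_mono2) auto
    also have "\<dots> = (\<Sum>j\<le>n. (k' + j) choose j)" by (simp only: add.commute)
    also have "\<dots> = Suc (k' + n) choose n" by (rule sum_choose_lower)
    also have "\<dots> = (n + k) choose n" using Suc by (simp add: add.commute)
    finally show ?thesis using finite_subset[OF sub fin] by blast
  qed
qed

context letter_system
begin

text \<open>Otherwise \<open>i\<close> leads some \<open>h\<close> in \<open>H\<close>, and the
  counting function of the type cannot tell \<open>neg_part h\<close> from
  \<open>pos_part h\<close>. But its differences in \<open>diffs_maximal\<close> read off the entry
  at \<open>i\<close>, where the two parts differ.\<close>

lemma maximal_supp:
  assumes F: "finite F" "F \<subseteq> E" and max: "\<And>G. finite G \<Longrightarrow> G \<subseteq> E \<Longrightarrow> t G = t F \<Longrightarrow> wt G \<le> wt F"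
    and i: "vec F i \<noteq> 0"
  shows "i \<in> Q"
proof (rule ccontr)
  assume nQ: "i \<notin> Q"
  have "clip (vec F) i \<noteq> 0" using i vec_clip[OF F(2)] by simp
  then have i_range: "1 \<le> i" "i < len" by (auto simp: clip_def split: if_splits)
  then have "i \<in> tops d\<^sub>0" using nQ by (simp add: Q_def)
  then obtain h where h: "h \<in> H" "h i \<noteq> 0" "\<forall>j>i. h j = 0" unfolding tops_def H_def by blast
  define v' where "v' = (vec F)(i := vec F i - 1)"
  have v': "v' + unit i = vec F" using i by (auto simp: v'_def unit_def fun_eq_iff)
  have s: "t F = t (lay 0 (v' + unit i))" unfolding v' by (rule t_lay[symmetric]) (use F in auto)
  have wtF: "wt F = wt (lay 0 (v' + unit i))"
    unfolding v' using wt_vec[OF F] wt_vec[OF finite_lay lay_E] vec_clip[OF F(2)] by (simp add: vec_lay)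
  have fin: "finite ((\<lambda>x. {x} \<times> trace (lay 0 v') x) ` fst ` lay 0 v')" using finite_lay by simp
  from finite_distinct_list[OF fin] obtain Zs
    where Zs: "set Zs = (\<lambda>x. {x} \<times> trace (lay 0 v') x) ` fst ` lay 0 v'" "distinct Zs"
    by (elim exE conjE)
  have diffs: "diffs (map vec Zs) (N (t F)) u = int (u i)" if "\<And>j. i < j \<Longrightarrow> u j = 0" for u
    by (rule diffs_maximal[OF s i_range _ that Zs]) (use max wtF in auto)
  let ?u = "neg_part h" and ?u' = "pos_part h"
  have "(\<lambda>y. N (t F) (y + ?u)) = (\<lambda>y. N (t F) (y + ?u'))"
    using shifts_parts[OF H_shifts[OF h(1)] F order_refl] by blast
  then have "diffs (map vec Zs) (\<lambda>y. N (t F) (y + ?u)) 0 = diffs (map vec Zs) (\<lambda>y. N (t F) (y + ?u')) 0"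
    by simp
  then have "diffs (map vec Zs) (N (t F)) ?u = diffs (map vec Zs) (N (t F)) ?u'"
    by (simp add: diffs_shift)
  moreover have "?u j = 0" "?u' j = 0" if "i < j" for j using h(3) that by (simp_all add: neg_part_def pos_part_def)
  ultimately have "int (?u i) = int (?u' i)" using diffs[of ?u] diffs[of ?u'] by simp
  then show False using parts[of h i] h(2) by simp
qed

lemma maximal_exists:
  assumes F: "finite F" "F \<subseteq> E"
  obtains G where "finite G" "G \<subseteq> E" "t G = t F" "\<And>G'. finite G' \<Longrightarrow> G' \<subseteq> E \<Longrightarrow> t G' = t G \<Longrightarrow> wt G' \<le> wt G"
proof -
  let ?P = "\<lambda>G. finite G \<and> G \<subseteq> E \<and> t G = t F"
  have bound: "wt G < Suc (card F * len)" if "?P G" for G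
  proof -
    have "wt G \<le> (\<Sum>x\<in>fst ` G. len)" unfolding wt_def by (rule sum_mono) simp
    also have "\<dots> = card (fst ` G) * len" by simp
    also have "\<dots> \<le> card G * len" by (intro mult_right_mono card_image_le) (use that in auto)
    also have "card G = card F" by (rule card_eq_of_t_eq) (use that F in auto)
    finally show ?thesis by simp
  qed
  obtain G where G: "?P G" "\<And>G'. ?P G' \<Longrightarrow> wt G' \<le> wt G"
    using ex_has_greatest_nat[of ?P F wt "Suc (card F * len)"] bound F by (auto simp: less_imp_le)
  then show ?thesis using that[of G] by auto
qed

lemma types_count:
  assumes T: "T \<subseteq> {t F |F. finite F \<and> F \<subseteq> E \<and> card F = n}" and Q: "card Q \<le> Suc k"
  shows "card T \<le> (n + k) choose n"
proof -
  let ?V = "{v. (\<forall>i. i \<notin> Q \<longrightarrow> v i = 0) \<and> (\<Sum>i\<in>Q. card (set_decode i) * v i) = n}"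
  have finQ: "finite Q" by (simp add: Q_def)
  have ne: "1 \<le> card (set_decode i)" if "i \<in> Q" for i
  proof -
    have "set_decode i \<noteq> {}" using that by (metis Q_def DiffD1 atLeastLessThan_iff not_one_le_zero set_decode_inverse set_encode_empty)
    then show ?thesis by (simp add: Suc_le_eq card_gt_0_iff finite_set_decode)
  qed
  have "\<forall>s\<in>T. \<exists>v. v \<in> ?V \<and> t (lay 0 v) = s"
  proof
    fix s assume "s \<in> T"
    then obtain F where F: "finite F" "F \<subseteq> E" "card F = n" "s = t F" using T by blast
    obtain G where G: "finite G" "G \<subseteq> E" "t G = t F"
      "\<And>G'. finite G' \<Longrightarrow> G' \<subseteq> E \<Longrightarrow> t G' = t G \<Longrightarrow> wt G' \<le> wt G"
      using maximal_exists[OF F(1,2)] by blast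
    have supp: "vec G i = 0" if "i \<notin> Q" for i using maximal_supp[OF G(1,2,4)] that by blast
    have "card G = n" using card_eq_of_t_eq[OF G(1) F(1) G(2) F(2) G(3)] F(3) by simp
    then have "(\<Sum>i\<in>{1..<len}. card (set_decode i) * vec G i) = n" using card_vec[OF G(1,2)] by simp
    moreover have "(\<Sum>i\<in>{1..<len}. card (set_decode i) * vec G i) = (\<Sum>i\<in>Q. card (set_decode i) * vec G i)"
      by (rule sum.mono_neutral_right) (use supp in \<open>auto simp: Q_def\<close>)
    ultimately have "vec G \<in> ?V" using supp by simp
    moreover have "t (lay 0 (vec G)) = s" using t_lay[OF G(2,1), of 0] G(3) F(4) by simp
    ultimately show "\<exists>v. v \<in> ?V \<and> t (lay 0 v) = s" by (intro exI[of _ "vec G"] conjI)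
  qed
  from bchoice[OF this] obtain v where v: "\<forall>s\<in>T. v s \<in> ?V \<and> t (lay 0 (v s)) = s" ..
  have "inj_on v T" by (rule inj_on_inverseI[of _ "\<lambda>x. t (lay 0 x)"]) (use v in blast)
  moreover have "v ` T \<subseteq> ?V" by (rule image_subsetI) (use v in simp)
  moreover have "finite ?V" by (rule conjunct1[OF card_weighted_vectors[OF finQ ne Q]])
  ultimately have "card T \<le> card ?V" by (rule card_inj_on_le)
  also have "\<dots> \<le> (n + k) choose n" by (rule conjunct2[OF card_weighted_vectors[OF finQ ne Q]])
  finally show ?thesis .
qed

subsection \<open>The number of letters in \<open>Q\<close> is bounded by the rank\<close>

text \<open>For \<open>y \<le> c\<close> the isomorphism fixes \<open>lay 0 y\<close> and takes the
  points added to \<open>lay 0 c\<close> for \<open>a\<close> to those added for \<open>b\<close>,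
  so the counts agree on a box. Its sides are at least \<open>Suc d\<^sub>0\<close>, enough for the
  degrees in question, so the difference of the vectors lies in \<open>H\<close>. Being supported on
  \<open>Q\<close>, it has no leading entry and vanishes.\<close>

lemma distinguished:
  assumes c: "\<And>g. Suc d\<^sub>0 \<le> c g" and K: "K \<subseteq> Q"
  shows "distinguished K c"
  unfolding distinguished_def blocks_lay
proof (intro allI impI)
  fix a b \<theta>
  assume ab: "\<forall>g. c g \<le> a g \<and> c g \<le> b g \<and> (g \<notin> K \<longrightarrow> a g = c g \<and> b g = c g)"
    and bij: "bij_betw \<theta> (lay 0 a) (lay 0 b)" and t\<theta>: "\<forall>X\<subseteq>lay 0 a. t (\<theta> ` X) = t X"
    and id: "\<forall>x\<in>lay 0 c. \<theta> x = x"
  define u where "u g = a g - c g" for g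
  define u' where "u' g = b g - c g" for g
  define h where "h g = int (u' g) - int (u g)" for g
  have lay_mono: "lay 0 x \<subseteq> lay 0 z" if "\<And>g. x g \<le> z g" for x z
    using less_le_trans[OF _ that] unfolding lay_def by blast
  have vec_part: "vec (lay 0 y \<union> (lay 0 z - lay 0 c)) = clip (y + (\<lambda>g. z g - c g))"
    and part_E: "finite (lay 0 y \<union> (lay 0 z - lay 0 c))" "lay 0 y \<union> (lay 0 z - lay 0 c) \<subseteq> E"
    if y: "\<And>g. y g \<le> c g" and z: "\<And>g. c g \<le> z g" for y z
  proof -
    have fin: "finite (lay 0 z - lay 0 c)" using finite_lay by simp
    have idx: "x \<notin> fst ` lay 0 c" if x: "x \<in> fst ` (lay 0 z - lay 0 c)" for x
    proof -
      obtain p where p: "(x, p) \<in> lay 0 z" "(x, p) \<notin> lay 0 c" using x by auto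
      then obtain g n where g: "g < len" "n < z g" "p \<in> set_decode g" "x = of_nat (prod_encode (0, prod_encode (g, n)))"
        by (auto simp: lay_def)
      then have "\<not> n < c g" using p(2) by (auto simp: lay_def)
      then show ?thesis using g(4) by (auto simp: fst_lay)
    qed
    have c_z: "lay 0 c \<union> (lay 0 z - lay 0 c) = lay 0 z" using lay_mono[of c z] z by blast
    have "vec (lay 0 c \<union> (lay 0 z - lay 0 c)) = vec (lay 0 c) + vec (lay 0 z - lay 0 c)"
      by (rule vec_Un[OF finite_lay fin]) (use idx in blast)
    then have cz: "clip z = clip c + vec (lay 0 z - lay 0 c)" unfolding c_z vec_lay .
    have v: "vec (lay 0 z - lay 0 c) = clip (\<lambda>g. z g - c g)"
    proof
      fix g show "vec (lay 0 z - lay 0 c) g = clip (\<lambda>g. z g - c g) g"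
        using fun_cong[OF cz, of g] by (auto simp: clip_def split: if_splits)
    qed
    have "fst ` lay 0 y \<subseteq> fst ` lay 0 c" using lay_mono[of y c] y by blast
    then have "vec (lay 0 y \<union> (lay 0 z - lay 0 c)) = vec (lay 0 y) + vec (lay 0 z - lay 0 c)"
      by (intro vec_Un[OF finite_lay fin]) (use idx in blast)
    then show "vec (lay 0 y \<union> (lay 0 z - lay 0 c)) = clip (y + (\<lambda>g. z g - c g))"
      by (simp add: v vec_lay clip_add)
    show "finite (lay 0 y \<union> (lay 0 z - lay 0 c))" "lay 0 y \<union> (lay 0 z - lay 0 c) \<subseteq> E"
      using finite_lay lay_E[of 0 y] lay_E[of 0 z] by (simp, blast)
  qed
  have small: "N s (y + u) = N s (y + u')" if y: "\<And>g. y g \<le> c g" for s y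
  proof -
    let ?A = "lay 0 y \<union> (lay 0 a - lay 0 c)" and ?B = "lay 0 y \<union> (lay 0 b - lay 0 c)"
    have y_c: "lay 0 y \<subseteq> lay 0 c" by (rule lay_mono[OF y])
    have c_a: "lay 0 c \<subseteq> lay 0 a" by (rule lay_mono) (use ab in blast)
    have inj: "inj_on \<theta> (lay 0 a)" using bij by (simp add: bij_betw_def)
    have "\<theta> ` (lay 0 a - lay 0 c) = \<theta> ` lay 0 a - \<theta> ` lay 0 c"
      by (rule inj_on_image_set_diff[OF inj]) (use c_a in auto)
    moreover have "\<theta> ` lay 0 a = lay 0 b" using bij by (simp add: bij_betw_def)
    moreover have "\<theta> ` X = X" if "X \<subseteq> lay 0 c" for X using id that by (force simp: subset_iff)
    ultimately have "\<theta> ` ?A = ?B" using y_c by (simp add: image_Un)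
    moreover have "?A \<subseteq> lay 0 a" using y_c c_a by blast
    ultimately have "t ?A = t ?B" using t\<theta> by metis
    have A: "finite ?A" "?A \<subseteq> E" "vec ?A = clip (y + u)"
      using part_E[of y a] vec_part[of y a] y ab unfolding u_def by blast+
    have B: "finite ?B" "?B \<subseteq> E" "vec ?B = clip (y + u')"
      using part_E[of y b] vec_part[of y b] y ab unfolding u'_def by blast+
    have "N s (y + u) = copies ?A s" by (rule copies_N[OF A, symmetric])
    also have "\<dots> = copies ?B s" by (rule copies_t[OF A(1,2) B(1,2) \<open>t ?A = t ?B\<close>])
    also have "\<dots> = N s (y + u')" by (rule copies_N[OF B])
    finally show ?thesis .
  qed
  have h_K: "g \<in> K" if "h g \<noteq> 0" for g using that ab by (auto simp: h_def u_def u'_def)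
  have "h \<in> H"
    unfolding H_def
  proof (rule shifts_I[where u = u and u' = u'])
    show "1 \<le> i \<and> i < len" if "h i \<noteq> 0" for i using h_K[OF that] K by (auto simp: Q_def)
    show "int (u' i) = int (u i) + h i" for i by (simp add: h_def)
    fix S y assume S: "finite S" "S \<subseteq> E" "card S \<le> d\<^sub>0"
    let ?f = "\<lambda>y. N (t S) (y + u) - N (t S) (y + u')"
    have "?f y = 0"
    proof (rule degree_less_box_zero[where f = ?f and d = "Suc (card S)" and I = "{1..<len}"])
      show "degree_less (Suc (card S)) ?f"
        by (intro degree_less_minus degree_less_shift degree_N S(1,2))
      show "finite {1..<len}" by simp
      fix y y' :: "nat \<Rightarrow> nat" assume eq: "\<And>i. i \<in> {1..<len} \<Longrightarrow> y i = y' i"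
      have "N (t S) (y + u) = N (t S) (y' + u)" "N (t S) (y + u') = N (t S) (y' + u')"
        by (rule N_cong; use eq in simp)+
      then show "?f y = ?f y'" by simp
    next
      fix y :: "nat \<Rightarrow> nat" assume "\<And>i. y i \<le> Suc (card S)"
      then have "y i \<le> c i" for i using c[of i] S(3) by (meson Suc_le_mono order_trans)
      then show "?f y = 0" using small by simp
    qed
    then show "N (t S) (y + u) = N (t S) (y + u')" by simp
  qed
  have "h g = 0" for g
  proof (rule ccontr)
    assume "h g \<noteq> 0"
    let ?I = "{g. h g \<noteq> 0}"
    have "finite ?I" by (rule finite_subset[of _ Q]) (use h_K K in \<open>auto simp: Q_def\<close>)
    moreover have "?I \<noteq> {}" using \<open>h g \<noteq> 0\<close> by blast
    ultimately have "Max ?I \<in> ?I" "\<And>j. j \<in> ?I \<Longrightarrow> j \<le> Max ?I" using Max_in Max_ge by blast+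
    then have "Max ?I \<in> tops d\<^sub>0" using \<open>h \<in> H\<close> unfolding tops_def H_def by (auto simp: not_le[symmetric])
    moreover have "Max ?I \<in> Q" using \<open>Max ?I \<in> ?I\<close> h_K K by blast
    ultimately show False by (simp add: Q_def)
  qed
  then have "u = u'" by (simp add: h_def fun_eq_iff)
  show "a = b"
  proof
    fix g show "a g = b g" using fun_cong[OF \<open>u = u'\<close>, of g] ab by (auto simp: u_def u'_def eq_diff_iff)
  qed
qed

text \<open>Modulo \<open>H\<close>, the coordinates outside \<open>Q\<close> can be reduced to finitely many values.\<close>

lemma cosets:
  "\<exists>K. \<forall>B. \<exists>\<rho> :: (nat \<Rightarrow> int) \<Rightarrow> nat. \<forall>z z'.
     (\<forall>j. (z j \<noteq> 0 \<longrightarrow> 1 \<le> j \<and> j < i) \<and> \<bar>z j\<bar> \<le> int B) \<longrightarrow>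
     \<rho> z < K * (B + 1) ^ card (Q \<inter> {..<i}) \<and>
     ((\<forall>j. (z' j \<noteq> 0 \<longrightarrow> 1 \<le> j \<and> j < i) \<and> \<bar>z' j\<bar> \<le> int B) \<longrightarrow> \<rho> z = \<rho> z' \<longrightarrow> (\<lambda>j. z j - z' j) \<in> H)"
  if "i \<le> len"
  using that
proof (induction i)
  case 0
  show ?case
  proof (rule exI[of _ 1], rule allI, rule exI[of _ "\<lambda>_. 0"], intro allI impI conjI)
    fix B and z z' :: "nat \<Rightarrow> int" assume "\<forall>j. (z j \<noteq> 0 \<longrightarrow> 1 \<le> j \<and> j < 0) \<and> \<bar>z j\<bar> \<le> int B"
      "\<forall>j. (z' j \<noteq> 0 \<longrightarrow> 1 \<le> j \<and> j < (0::nat)) \<and> \<bar>z' j\<bar> \<le> int B"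
    then have "(\<lambda>j. z j - z' j) = 0" by (simp add: fun_eq_iff)
    then show "(\<lambda>j. z j - z' j) \<in> H" unfolding H_def by (simp only: shifts_0)
  qed simp
next
  case (Suc i)
  let ?box = "\<lambda>i B z. \<forall>j. (z j \<noteq> 0 \<longrightarrow> 1 \<le> j \<and> j < i) \<and> \<bar>z j :: int\<bar> \<le> int B"
  obtain K where "\<forall>B. \<exists>\<rho> :: (nat \<Rightarrow> int) \<Rightarrow> nat. \<forall>z z'. ?box i B z \<longrightarrow> \<rho> z < K * (B + 1) ^ card (Q \<inter> {..<i}) \<and>
      (?box i B z' \<longrightarrow> \<rho> z = \<rho> z' \<longrightarrow> (\<lambda>j. z j - z' j) \<in> H)"
    using Suc.IH Suc.prems by auto
  from choice[OF this] obtain \<rho> :: "nat \<Rightarrow> (nat \<Rightarrow> int) \<Rightarrow> nat" where \<rho>: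
    "\<forall>B. \<forall>z z'. ?box i B z \<longrightarrow> \<rho> B z < K * (B + 1) ^ card (Q \<inter> {..<i}) \<and>
      (?box i B z' \<longrightarrow> \<rho> B z = \<rho> B z' \<longrightarrow> (\<lambda>j. z j - z' j) \<in> H)" ..
  have \<rho>1: "\<rho> B z < K * (B + 1) ^ card (Q \<inter> {..<i})" if "?box i B z" for B z using \<rho> that by blast
  have \<rho>2: "(\<lambda>j. z j - z' j) \<in> H" if "?box i B z" "?box i B z'" "\<rho> B z = \<rho> B z'" for B z z'
    using \<rho> that by blast
  have int_split: "\<lbrakk>a * n + r = a' * n + r'; r < n; r' < n\<rbrakk> \<Longrightarrow> a = a' \<and> r = r'" for a a' n r r' :: nat
    by (metis add.commute div_mult_self3 div_less mod_mult_self3 mod_less add_0 gr_implies_not0)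
  have bound: "a * n + r < A * n" if "a < A" "r < n" for a A n r :: nat
  proof -
    have "a * n + r < Suc a * n" using that by simp
    also have "\<dots> \<le> A * n" using that by (intro mult_right_mono) auto
    finally show ?thesis .
  qed
  show ?case
  proof (cases "i \<in> Q")
    case True
    have cardS: "card (Q \<inter> {..<Suc i}) = Suc (card (Q \<inter> {..<i}))"
    proof -
      have "Q \<inter> {..<Suc i} = insert i (Q \<inter> {..<i})" using True by (auto simp: less_Suc_eq)
      then show ?thesis by simp
    qed
    show ?thesis
    proof (intro exI[of _ "2 * K"] allI)
      fix B
      let ?n = "K * (B + 1) ^ card (Q \<inter> {..<i})"
      \<comment> \<open>A mixed-radix code: the entry at \<open>i\<close>, shifted to be
        nonnegative, is the high digit, and the code of the other entries the low one.\<close>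
      let ?\<rho> = "\<lambda>z. nat (z i + int B) * ?n + \<rho> B (z(i := 0))"
      have box: "?box i B (z(i := 0))" if "?box (Suc i) B z" for z using that by (auto simp: less_Suc_eq)
      show "\<exists>\<rho> :: (nat \<Rightarrow> int) \<Rightarrow> nat. \<forall>z z'. ?box (Suc i) B z \<longrightarrow>
          \<rho> z < 2 * K * (B + 1) ^ card (Q \<inter> {..<Suc i}) \<and>
          (?box (Suc i) B z' \<longrightarrow> \<rho> z = \<rho> z' \<longrightarrow> (\<lambda>j. z j - z' j) \<in> H)"
      proof (rule exI[of _ ?\<rho>], intro allI impI conjI)
        fix z z' assume z: "?box (Suc i) B z"
        have "nat (z i + int B) < 2 * (B + 1)" using z[rule_format, of i] by auto
        then have "?\<rho> z < 2 * (B + 1) * ?n" by (rule bound[OF _ \<rho>1[OF box[OF z]]])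
        also have "\<dots> = 2 * K * (B + 1) ^ card (Q \<inter> {..<Suc i})" unfolding cardS by (simp add: algebra_simps)
        finally show "?\<rho> z < 2 * K * (B + 1) ^ card (Q \<inter> {..<Suc i})" .
        assume z': "?box (Suc i) B z'" and eq: "?\<rho> z = ?\<rho> z'"
        have "nat (z i + int B) = nat (z' i + int B) \<and> \<rho> B (z(i := 0)) = \<rho> B (z'(i := 0))"
          by (rule int_split[OF eq \<rho>1[OF box[OF z]] \<rho>1[OF box[OF z']]])
        then have e: "z i = z' i" "\<rho> B (z(i := 0)) = \<rho> B (z'(i := 0))"
          using z[rule_format, of i] z'[rule_format, of i] by auto
        have "(\<lambda>j. z j - z' j) = (\<lambda>j. (z(i := 0)) j - (z'(i := 0)) j)" using e(1) by (auto simp: fun_eq_iff)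
        then show "(\<lambda>j. z j - z' j) \<in> H" using \<rho>2[OF box[OF z] box[OF z'] e(2)] by simp
      qed
    qed
  next
    case False
    have cardS: "card (Q \<inter> {..<Suc i}) = card (Q \<inter> {..<i})"
    proof -
      have "Q \<inter> {..<Suc i} = Q \<inter> {..<i}" using False by (auto simp: less_Suc_eq)
      then show ?thesis by simp
    qed
    show ?thesis
    proof (cases "i = 0")
      case True
      then have "?box (Suc i) B z = ?box i B z" for B z by auto
      show ?thesis
        unfolding cardS \<open>\<And>z B. ?box (Suc i) B z = ?box i B z\<close>
      proof (rule exI[of _ K], rule allI)
        fix B
        show "\<exists>\<rho> :: (nat \<Rightarrow> int) \<Rightarrow> nat. \<forall>z z'. ?box i B z \<longrightarrow> \<rho> z < K * (B + 1) ^ card (Q \<inter> {..<i}) \<and>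
            (?box i B z' \<longrightarrow> \<rho> z = \<rho> z' \<longrightarrow> (\<lambda>j. z j - z' j) \<in> H)"
          using \<rho> by (intro exI[of _ "\<rho> B"]) blast
      qed
    next
      case pos: False
      then have "i \<in> tops d\<^sub>0" using False Suc.prems by (simp add: Q_def)
      then obtain h where h: "h \<in> H" "h i \<noteq> 0" "\<forall>j>i. h j = 0" unfolding tops_def H_def by blast
      define k where "k = (\<lambda>j. sgn (h i) * h j)"
      have k: "k \<in> H" "0 < k i" "\<forall>j>i. k j = 0" "\<And>j. k j \<noteq> 0 \<Longrightarrow> 1 \<le> j"
        using h shifts_scale[of h d\<^sub>0] shifts_supp[of h d\<^sub>0]
        by (auto simp: k_def H_def sgn_if split: if_splits)
      define \<eta> where "\<eta> = (\<Sum>j\<le>i. nat \<bar>k j\<bar>)"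
      have \<eta>: "\<bar>k j\<bar> \<le> int \<eta>" for j
      proof (cases "j \<le> i")
        case True
        have "nat \<bar>k j\<bar> \<le> \<eta>" unfolding \<eta>_def by (rule member_le_sum) (use True in auto)
        then show ?thesis by linarith
      next
        case False
        then show ?thesis using k(3) by simp
      qed
      \<comment> \<open>Subtracting a multiple of \<open>k\<close> leaves at \<open>i\<close> the
        residue modulo \<open>k i\<close>. The residue takes boundedly many values and is stored by
        \<open>?\<rho>\<close>, so the entry is set to 0.\<close>
      define red where "red z j = (if j = i then 0 else z j - (z i div k i) * k j)" for z :: "nat \<Rightarrow> int" and j
      let ?K = "nat (k i) * (K * (1 + \<eta>) ^ card (Q \<inter> {..<i}))"
      show ?thesis
      proof (intro exI[of _ ?K] allI)
        fix B
        \<comment> \<open>The quotient is at most \<open>B\<close> and the entries of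
          \<open>k\<close> at most \<open>\<eta>\<close> in absolute value; the box thus grows by a
          constant factor, which keeps the exponent.\<close>
        let ?B = "B + B * \<eta>"
        let ?n = "K * (?B + 1) ^ card (Q \<inter> {..<i})"
        let ?\<rho> = "\<lambda>z. nat (z i mod k i) * ?n + \<rho> ?B (red z)"
        have box: "?box i ?B (red z)" if z: "?box (Suc i) B z" for z
        proof (intro allI conjI impI)
          fix j
          have "\<bar>z i div k i\<bar> \<le> int B"
          proof -
            have "\<bar>z i\<bar> \<le> int B" using z by blast
            moreover have "\<bar>z i div k i\<bar> \<le> \<bar>z i\<bar>" by (rule abs_div_le[OF k(2)])
            ultimately show ?thesis by linarith
          qed
          then have "\<bar>z i div k i\<bar> * \<bar>k j\<bar> \<le> int B * int \<eta>" by (intro mult_mono \<eta>) auto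
          then have "\<bar>(z i div k i) * k j\<bar> \<le> int (B * \<eta>)" by (simp add: abs_mult)
          moreover have "\<bar>z j\<bar> \<le> int B" using z by blast
          ultimately show "\<bar>red z j\<bar> \<le> int ?B" by (auto simp: red_def)
          assume nz: "red z j \<noteq> 0"
          then have "j \<noteq> i" "z j \<noteq> 0 \<or> k j \<noteq> 0" by (auto simp: red_def split: if_splits)
          then show "1 \<le> j" "j < i" using z k(3,4) by (metis linorder_neqE_nat less_Suc_eq)+
        qed
        show "\<exists>\<rho> :: (nat \<Rightarrow> int) \<Rightarrow> nat. \<forall>z z'. ?box (Suc i) B z \<longrightarrow>
            \<rho> z < ?K * (B + 1) ^ card (Q \<inter> {..<Suc i}) \<and>
            (?box (Suc i) B z' \<longrightarrow> \<rho> z = \<rho> z' \<longrightarrow> (\<lambda>j. z j - z' j) \<in> H)"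
        proof (rule exI[of _ ?\<rho>], intro allI impI conjI)
          fix z z' assume z: "?box (Suc i) B z"
          have "nat (z i mod k i) < nat (k i)" using k(2) by simp
          then have "?\<rho> z < nat (k i) * ?n" by (rule bound[OF _ \<rho>1[OF box[OF z]]])
          also have "\<dots> \<le> nat (k i) * (K * ((1 + \<eta>) * (B + 1)) ^ card (Q \<inter> {..<i}))"
            by (intro mult_left_mono power_mono) (auto simp: algebra_simps)
          also have "\<dots> = ?K * (B + 1) ^ card (Q \<inter> {..<Suc i})" unfolding cardS by (simp only: power_mult_distrib mult.assoc)
          finally show "?\<rho> z < ?K * (B + 1) ^ card (Q \<inter> {..<Suc i})" .
          assume z': "?box (Suc i) B z'" and eq: "?\<rho> z = ?\<rho> z'"
          have "nat (z i mod k i) = nat (z' i mod k i) \<and> \<rho> ?B (red z) = \<rho> ?B (red z')"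
            by (rule int_split[OF eq \<rho>1[OF box[OF z]] \<rho>1[OF box[OF z']]])
          then have e: "z i mod k i = z' i mod k i" "\<rho> ?B (red z) = \<rho> ?B (red z')"
            using k(2) by (auto simp: nat_eq_iff)
          have r: "(\<lambda>j. red z j - red z' j) \<in> H" by (rule \<rho>2[OF box[OF z] box[OF z'] e(2)])
          have "(\<lambda>j. z j - z' j) = (\<lambda>j. red z j - red z' j) + (\<lambda>j. (z i div k i - z' i div k i) * k j)"
          proof
            fix j
            have "z i - z' i = (z i div k i - z' i div k i) * k i"
            proof -
              have "z i = (z i div k i) * k i + z i mod k i" "z' i = (z' i div k i) * k i + z' i mod k i" by simp_all
              then have "z i - z' i = (z i div k i) * k i - (z' i div k i) * k i" using e(1) by linarith
              then show ?thesis by (simp only: left_diff_distrib)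
            qed
            then show "z j - z' j = ((\<lambda>j. red z j - red z' j) + (\<lambda>j. (z i div k i - z' i div k i) * k j)) j"
              by (simp add: red_def algebra_simps)
          qed
          then show "(\<lambda>j. z j - z' j) \<in> H"
            using shifts_add[of _ d\<^sub>0, OF r[unfolded H_def] shifts_scale[OF k(1)[unfolded H_def]]] by (simp add: H_def)
        qed
      qed
    qed
  qed
qed

text \<open>A subset of the tower is described by its trace on the finite blocks and the coset
  modulo \<open>H\<close> of the vector of the rest. Subsets of letters below \<open>i\<close> have
  codes below \<open>i\<close>, so \<open>cosets\<close> applies to that vector, whose entries are
  at most \<open>M\<close>.\<close>

lemma cnt_upper:
  assumes i: "i \<le> len"
  shows "\<exists>B. \<forall>M. cnt (tower {..<i} c) M \<le> B * (M + 1) ^ card (Q \<inter> {..<i})"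
proof -
  define Fin :: "(rat \<times> nat) set" where "Fin = lay 0 (\<lambda>g. if g < i then 0 else c g)"
  let ?Y = "tower {..<i} c"
  obtain K where K: "\<And>B. \<exists>\<rho> :: (nat \<Rightarrow> int) \<Rightarrow> nat. \<forall>z z'.
     (\<forall>j. (z j \<noteq> 0 \<longrightarrow> 1 \<le> j \<and> j < i) \<and> \<bar>z j\<bar> \<le> int B) \<longrightarrow>
     \<rho> z < K * (B + 1) ^ card (Q \<inter> {..<i}) \<and>
     ((\<forall>j. (z' j \<noteq> 0 \<longrightarrow> 1 \<le> j \<and> j < i) \<and> \<bar>z' j\<bar> \<le> int B) \<longrightarrow> \<rho> z = \<rho> z' \<longrightarrow> (\<lambda>j. z j - z' j) \<in> H)"
    using cosets[OF i] by blast
  have "cnt ?Y M \<le> 2 ^ card Fin * K * (M + 1) ^ card (Q \<inter> {..<i})" for M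
  proof -
    obtain \<rho> :: "(nat \<Rightarrow> int) \<Rightarrow> nat" where \<rho>: "\<And>z z'.
       (\<forall>j. (z j \<noteq> 0 \<longrightarrow> 1 \<le> j \<and> j < i) \<and> \<bar>z j\<bar> \<le> int M) \<Longrightarrow>
       \<rho> z < K * (M + 1) ^ card (Q \<inter> {..<i}) \<and>
       ((\<forall>j. (z' j \<noteq> 0 \<longrightarrow> 1 \<le> j \<and> j < i) \<and> \<bar>z' j\<bar> \<le> int M) \<longrightarrow> \<rho> z = \<rho> z' \<longrightarrow> (\<lambda>j. z j - z' j) \<in> H)"
      using K[of M] by blast
    let ?z = "\<lambda>F j. int (vec (F - Fin) j)"
    let ?Z = "{F. finite F \<and> F \<subseteq> ?Y \<and> card F \<le> M}"
    have YE: "?Y \<subseteq> E" by (rule tower_E)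
    have box: "\<forall>j. (?z F j \<noteq> 0 \<longrightarrow> 1 \<le> j \<and> j < i) \<and> \<bar>?z F j\<bar> \<le> int M"
      if F: "finite F" "F \<subseteq> ?Y" "card F \<le> M" for F
    proof (intro allI conjI impI)
      fix j
      have DE: "F - Fin \<subseteq> E" using F(2) YE by blast
      have "vec (F - Fin) j \<le> card (fst ` (F - Fin))"
        unfolding vec_def by (rule card_mono) (use F(1) in auto)
      also have "\<dots> \<le> card (F - Fin)" by (rule card_image_le) (use F(1) in simp)
      also have "\<dots> \<le> card F" by (rule card_mono) (use F(1) in auto)
      finally show "\<bar>?z F j\<bar> \<le> int M" using F(3) by simp
      assume nz: "?z F j \<noteq> 0"
      then have "clip (vec (F - Fin)) j \<noteq> 0" using vec_clip[OF DE] by simp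
      then show "1 \<le> j" by (auto simp: clip_def split: if_splits)
      have "{x \<in> fst ` (F - Fin). set_encode (trace (F - Fin) x) = j} \<noteq> {}"
        using nz unfolding vec_def by (metis card.empty of_nat_0)
      then obtain x where x: "x \<in> fst ` (F - Fin)" "set_encode (trace (F - Fin) x) = j" by blast
      then obtain p where p: "(x, p) \<in> F" "(x, p) \<notin> Fin" by auto
      then have "(x, p) \<in> ?Y" using F(2) by blast
      then obtain g n where g: "x = of_nat (prod_encode (0, prod_encode (g, n)))" "g < len" "g < i \<or> n < c g" "p \<in> set_decode g"
        by (auto simp: tower_def)
      have "g < i"
      proof (rule ccontr)
        assume "\<not> g < i"
        then have "(x, p) \<in> Fin" using g by (auto simp: Fin_def lay_def)
        then show False using p(2) by simp
      qed
      have "trace (F - Fin) x \<subseteq> set_decode g"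
      proof
        fix q assume "q \<in> trace (F - Fin) x"
        then have "(x, q) \<in> ?Y" using F(2) by auto
        then show "q \<in> set_decode g" using g(1) by (auto simp: tower_def)
      qed
      then have "j \<le> g" using set_encode_mono(1)[OF _ finite_set_decode, of "trace (F - Fin) x" g] x(2) by simp
      then show "j < i" using \<open>g < i\<close> by simp
    qed
    let ?S = "Pow Fin \<times> {..<K * (M + 1) ^ card (Q \<inter> {..<i})}"
    have finFin: "finite Fin" by (simp add: Fin_def finite_lay)
    have "cnt ?Y M \<le> card ?S"
    proof (rule cnt_le[where D = "\<lambda>F. (F \<inter> Fin, \<rho> (?z F))"])
      show "finite ?S" using finFin by simp
      show "(F \<inter> Fin, \<rho> (?z F)) \<in> ?S" if F: "finite F" "F \<subseteq> ?Y" "card F \<le> M" for F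
        using \<rho>[OF box[OF F]] by simp
      fix F G assume F: "finite F" "F \<subseteq> ?Y" "card F \<le> M" and G: "finite G" "G \<subseteq> ?Y" "card G \<le> M"
        and eq: "(F \<inter> Fin, \<rho> (?z F)) = (G \<inter> Fin, \<rho> (?z G))"
      have zH: "(\<lambda>j. ?z F j - ?z G j) \<in> H" using \<rho>[OF box[OF F], of "?z G"] box[OF G] eq by blast
      have vec_eq: "vec F = vec (F \<inter> Fin) + vec (F - Fin)" if F: "finite F" "F \<subseteq> ?Y" for F
      proof -
        have disj: "fst ` (F \<inter> Fin) \<inter> fst ` (F - Fin) = {}"
        proof (rule ccontr)
          assume "\<not> ?thesis"
          then obtain x p q where x: "(x, p) \<in> F" "(x, p) \<in> Fin" "(x, q) \<in> F" "(x, q) \<notin> Fin" by auto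
          obtain g n where g: "x = of_nat (prod_encode (0, prod_encode (g, n)))" "g < len"
              "n < (if g < i then 0 else c g)"
            using x(2) unfolding Fin_def lay_def by blast
          have "(x, q) \<in> ?Y" using x(3) F(2) by blast
          then have "q \<in> set_decode g" using g(1) by (auto simp: tower_def)
          then show False using x(4) g by (auto simp: Fin_def lay_def)
        qed
        have "F = (F \<inter> Fin) \<union> (F - Fin)" by blast
        then show ?thesis using vec_Un[OF _ _ disj] F(1) by (metis finite_Diff finite_Int)
      qed
      have "(\<lambda>j. int (vec F j) - int (vec G j)) = (\<lambda>j. ?z F j - ?z G j)"
        using vec_eq[OF F(1,2)] vec_eq[OF G(1,2)] eq by (simp add: fun_eq_iff)
      then show "t F = t G"
        by (intro t_eq_of_H) (use F G YE zH in auto)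
    qed
    also have "card ?S = 2 ^ card Fin * K * (M + 1) ^ card (Q \<inter> {..<i})"
      using finFin by (simp add: card_cartesian_product card_Pow)
    finally show ?thesis .
  qed
  then show ?thesis by blast
qed

text \<open>Making the block of a letter in \<open>Q\<close> infinite raises the degree of growth
  and hence \<open>R1\<close>; for other letters monotonicity of \<open>R1\<close> is enough. The
  lower bound on \<open>c\<close> is what \<open>distinguished\<close> asks for.\<close>

lemma R1_tower:
  assumes "i \<le> len" "\<And>g. Suc d\<^sub>0 \<le> c g"
  shows "card (Q \<inter> {..<i}) \<le> R1 (ag (tower {..<i} c))"
  using assms
proof (induction i arbitrary: c)
  case (Suc i)
  show ?case
  proof (cases "i \<in> Q")
    case True
    have Q_eq: "Q \<inter> {..<Suc i} = insert i (Q \<inter> {..<i})" using True by (auto simp: less_Suc_eq)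
    have "Suc (card (Q \<inter> {..<i})) \<le> R1 (ag (tower {..<Suc i} c))"
    proof (rule R1_tower_step[where K = "Q \<inter> {..<Suc i}" and J = "{..<i}" and e = "card (Q \<inter> {..<i})"])
      show "permutable" by (rule permutable)
      show "distinguished (Q \<inter> {..<Suc i}) c" by (rule distinguished) (use Suc.prems in auto)
      show "card (Q \<inter> {..<i}) < card (Q \<inter> {..<Suc i})" unfolding Q_eq by simp
      show "\<exists>B. \<forall>M. cnt (tower {..<i} c') M \<le> B * (M + 1) ^ card (Q \<inter> {..<i})" for c'
        by (rule cnt_upper) (use Suc.prems in simp)
      show "card (Q \<inter> {..<i}) \<le> R1 (ag (tower {..<i} c'))" if "\<And>g. c g \<le> c' g" for c'
        by (rule Suc.IH) (use Suc.prems that in \<open>auto intro: order_trans\<close>)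
    qed (use Suc.prems in auto)
    then show ?thesis unfolding Q_eq by simp
  next
    case False
    then have "Q \<inter> {..<Suc i} = Q \<inter> {..<i}" by (auto simp: less_Suc_eq)
    moreover have "card (Q \<inter> {..<i}) \<le> R1 (ag (tower {..<i} c))" using Suc by simp
    moreover have "R1 (ag (tower {..<i} c)) \<le> R1 (ag (tower {..<Suc i} c))"
      by (rule R1_mono[OF _ tower_E]) (auto simp: tower_def)
    ultimately show ?thesis by simp
  qed
qed simp

theorem types_bound:
  assumes "T \<subseteq> {t F |F. finite F \<and> F \<subseteq> E \<and> card F = n}" and "\<kappa> \<le> Suc k"
  shows "card T \<le> (n + k) choose k"
proof -
  have "Q \<inter> {..<len} = Q" by (auto simp: Q_def)
  then have "card Q \<le> R1 (ag (tower {..<len} (\<lambda>_. Suc d\<^sub>0)))" using R1_tower[of len "\<lambda>_. Suc d\<^sub>0"] by simp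
  also have "\<dots> \<le> \<kappa>" unfolding ag_def by (rule R1_le[OF tower_E])
  finally have "card T \<le> (n + k) choose n" by (intro types_count[OF assms(1)]) (use assms(2) in simp)
  also have "\<dots> = (n + k) choose k" using binomial_symmetric[of n "n + k"] by simp
  finally show ?thesis .
qed

end

subsection \<open>A rank function on ideals\<close>

lemma underS_omega_times:
  assumes less: "Restr (omega_times m) (underS (omega_times m) p) <o Restr (omega_times m) (underS (omega_times m) q)"
    and p: "p \<in> Field (omega_times m)" and q: "q \<in> Field (omega_times m)"
  shows "fst p < fst q \<or> fst p = fst q \<and> snd p < snd q"
proof (rule ccontr)
  let ?r = "omega_times m"
  assume n: "\<not> ?thesis"
  have W: "Well_order ?r" by (rule Well_order_omega_times)
  then have wo: "wo_rel ?r" by (simp add: wo_rel_def)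
  have "fst p < m" "fst q < m" using p q unfolding Field_omega_times by auto
  then have "(q, p) \<in> ?r" using n by (cases p; cases q) (auto simp: omega_times_def)
  then have "underS ?r q \<subseteq> underS ?r p" using W by (intro underS_incr) (auto simp: order_on_defs)
  then have "Restr ?r (underS ?r q) \<le>o Restr ?r (underS ?r p)"
    using ofilter_subset_ordLeq[OF W] wo by (simp add: wo_rel.underS_ofilter)
  then show False using less not_ordLess_ordLeq by blast
qed

text \<open>A proper ideal has height below \<omega>(k+1), that is \<omega> * i + a with i at most
  \<open>k\<close>. The age may have height exactly \<omega>(k+1), so it gets the pair
  \<open>Suc k\<close>, \<open>0\<close> above all the others.\<close>

lemma ideal_rank:
  assumes wf: "age_height_defined \<mu> \<A>" and le: "age_height \<mu> \<A> \<le>o omega_times (k + 1)" and \<A>: "is_ideal \<mu> \<A>"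
  obtains R1 R2 :: "'i iso_type set \<Rightarrow> nat"
  where "\<And>I J. is_ideal \<mu> I \<Longrightarrow> is_ideal \<mu> J \<Longrightarrow> I \<subset> J \<Longrightarrow> J \<subseteq> \<A> \<Longrightarrow>
      R1 I < R1 J \<or> R1 I = R1 J \<and> R2 I < R2 J"
    "\<And>I. is_ideal \<mu> I \<Longrightarrow> I \<subseteq> \<A> \<Longrightarrow> R1 I \<le> Suc k"
proof -
  let ?r = "ideal_less \<mu> \<A>" and ?\<Omega> = "omega_times (k + 1)"
  have sup: "is_sup_succ (height ?r ` {y. (y, x) \<in> ?r}) (height ?r x)" for x
    by (rule height_is_sup_succ[OF infinite_ideal_type]) (use wf in \<open>simp add: age_height_defined_def\<close>)
  have W: "Well_order (height ?r x)" for x using sup[of x] by (simp add: is_sup_succ_def)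
  have mono: "height ?r I <o height ?r J" if "(I, J) \<in> ?r" for I J
    using sup[of J] that by (auto simp: is_sup_succ_def)
  have less: "height ?r I <o ?\<Omega>" if "is_ideal \<mu> I" "I \<subset> \<A>" for I
  proof -
    have "(I, \<A>) \<in> ?r" using that \<A> by (auto simp: ideal_less_def)
    then have "height ?r I <o height ?r \<A>" by (rule mono)
    then show ?thesis using le unfolding age_height_def by (rule ordLess_ordLeq_trans)
  qed
  have "\<forall>I. \<exists>p. is_ideal \<mu> I \<and> I \<subset> \<A> \<longrightarrow>
      p \<in> Field ?\<Omega> \<and> height ?r I =o Restr ?\<Omega> (underS ?\<Omega> p)"
    using less ordLess_iff_ordIso_Restr[OF Well_order_omega_times W] by blast
  from choice[OF this] obtain \<rho> where \<rho>: "\<And>I. is_ideal \<mu> I \<Longrightarrow> I \<subset> \<A> \<Longrightarrow> \<rho> I \<in> Field ?\<Omega>"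
    "\<And>I. is_ideal \<mu> I \<Longrightarrow> I \<subset> \<A> \<Longrightarrow> height ?r I =o Restr ?\<Omega> (underS ?\<Omega> (\<rho> I))" by blast
  let ?R1 = "\<lambda>I. if I = \<A> then Suc k else fst (\<rho> I)" and ?R2 = "\<lambda>I. if I = \<A> then 0 else snd (\<rho> I)"
  have lt: "fst (\<rho> I) < Suc k" if "is_ideal \<mu> I" "I \<subset> \<A>" for I
    using \<rho>(1)[OF that] unfolding Field_omega_times by auto
  show ?thesis
  proof (rule that[of ?R1 ?R2])
    fix I J assume IJ: "is_ideal \<mu> I" "is_ideal \<mu> J" "I \<subset> J" "J \<subseteq> \<A>"
    then have I: "I \<subset> \<A>" by blast
    show "?R1 I < ?R1 J \<or> ?R1 I = ?R1 J \<and> ?R2 I < ?R2 J"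
    proof (cases "J = \<A>")
      case True
      then show ?thesis using lt[OF IJ(1) I] I by auto
    next
      case False
      then have J: "J \<subset> \<A>" using IJ(4) by blast
      have "(I, J) \<in> ?r" using IJ by (auto simp: ideal_less_def)
      then have "height ?r I <o height ?r J" by (rule mono)
      then have "Restr ?\<Omega> (underS ?\<Omega> (\<rho> I)) <o Restr ?\<Omega> (underS ?\<Omega> (\<rho> J))"
        using \<rho>(2)[OF IJ(1) I] \<rho>(2)[OF IJ(2) J]
        by (meson ordIso_ordLess_trans ordIso_symmetric ordLess_ordIso_trans)
      then have "fst (\<rho> I) < fst (\<rho> J) \<or> fst (\<rho> I) = fst (\<rho> J) \<and> snd (\<rho> I) < snd (\<rho> J)"
        using \<rho>(1)[OF IJ(1) I] \<rho>(1)[OF IJ(2) J] by (rule underS_omega_times)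
      then show ?thesis using I J by auto
    qed
  next
    fix I assume "is_ideal \<mu> I" "I \<subseteq> \<A>"
    then show "?R1 I \<le> Suc k" using lt[of I] by (cases "I = \<A>") (auto simp: psubset_eq)
  qed
qed

subsection \<open>Isomorphism types\<close>

lemma base_restriction [simp]: "base (restriction \<mu> R A) = A"
  by (simp add: restriction_def)

lemma rels_restriction [simp]: "rels (restriction \<mu> R A) i = rels R i \<inter> tuples A (arity \<mu> i)"
  by (simp add: restriction_def)

lemma restriction_restriction: "A \<subseteq> B \<Longrightarrow> restriction \<mu> (restriction \<mu> R B) A = restriction \<mu> R A"
  by (auto simp: restriction_def tuples_def fun_eq_iff)

lemma is_iso_inv:
  assumes "is_iso \<mu> R S f"
  shows "is_iso \<mu> S R (inv_into (base R) f)"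
  unfolding is_iso_def
proof (intro conjI ballI)
  have f: "bij_betw f (base R) (base S)" using assms by (simp add: is_iso_def)
  then show "bij_betw (inv_into (base R) f) (base S) (base R)" by (rule bij_betw_inv_into)
  fix i ys assume i: "i \<in> idx \<mu>" and ys: "ys \<in> tuples (base S) (arity \<mu> i)"
  let ?xs = "map (inv_into (base R) f) ys"
  have im: "f ` base R = base S" using f by (simp add: bij_betw_def)
  have "?xs \<in> tuples (base R) (arity \<mu> i)"
    using ys im by (auto simp: tuples_def intro!: inv_into_into)
  moreover have "map f ?xs = ys"
    unfolding map_map by (rule map_idI) (use ys im in \<open>auto simp: tuples_def f_inv_into_f\<close>)
  ultimately show "ys \<in> rels S i \<longleftrightarrow> ?xs \<in> rels R i" using assms i unfolding is_iso_def by metis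
qed

lemma is_iso_comp:
  assumes "is_iso \<mu> R S f" "is_iso \<mu> S T g"
  shows "is_iso \<mu> R T (g \<circ> f)"
  unfolding is_iso_def
proof (intro conjI ballI)
  have f: "bij_betw f (base R) (base S)" and g: "bij_betw g (base S) (base T)"
    using assms by (simp_all add: is_iso_def)
  show "bij_betw (g \<circ> f) (base R) (base T)" by (rule bij_betw_trans[OF f g])
  fix i xs assume i: "i \<in> idx \<mu>" and xs: "xs \<in> tuples (base R) (arity \<mu> i)"
  then have "map f xs \<in> tuples (base S) (arity \<mu> i)" using f by (auto simp: tuples_def bij_betw_def)
  then have "map f xs \<in> rels S i \<longleftrightarrow> map g (map f xs) \<in> rels T i"
    using assms(2) i unfolding is_iso_def by blast
  moreover have "xs \<in> rels R i \<longleftrightarrow> map f xs \<in> rels S i" using assms(1) i xs unfolding is_iso_def by blast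
  ultimately show "xs \<in> rels R i \<longleftrightarrow> map (g \<circ> f) xs \<in> rels T i" by simp
qed

lemma isomorphic_sym: "isomorphic \<mu> R S \<Longrightarrow> isomorphic \<mu> S R"
  unfolding isomorphic_def using is_iso_inv by blast

lemma isomorphic_trans: "isomorphic \<mu> R S \<Longrightarrow> isomorphic \<mu> S T \<Longrightarrow> isomorphic \<mu> R T"
  unfolding isomorphic_def using is_iso_comp by blast

lemma is_iso_restriction:
  assumes f: "is_iso \<mu> R S f" and Z: "Z \<subseteq> base R"
  shows "is_iso \<mu> (restriction \<mu> R Z) (restriction \<mu> S (f ` Z)) f"
  unfolding is_iso_def base_restriction rels_restriction
proof (intro conjI ballI)
  have "inj_on f (base R)" using f by (simp add: is_iso_def bij_betw_def)
  then show "bij_betw f Z (f ` Z)" using Z by (meson inj_on_imp_bij_betw inj_on_subset)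
  fix i xs assume i: "i \<in> idx \<mu>" and xs: "xs \<in> tuples Z (arity \<mu> i)"
  then have "xs \<in> tuples (base R) (arity \<mu> i)" "map f xs \<in> tuples (f ` Z) (arity \<mu> i)"
    using Z by (auto simp: tuples_def)
  moreover from this have "xs \<in> rels R i \<longleftrightarrow> map f xs \<in> rels S i" using f i unfolding is_iso_def by blast
  ultimately show "xs \<in> rels R i \<inter> tuples Z (arity \<mu> i) \<longleftrightarrow> map f xs \<in> rels S i \<inter> tuples (f ` Z) (arity \<mu> i)"
    using xs by simp
qed

lemma type_of_cong:
  assumes "isomorphic \<mu> R S"
  shows "type_of \<mu> R = type_of \<mu> S"
  unfolding type_of_def using isomorphic_trans[OF assms] isomorphic_trans[OF isomorphic_sym[OF assms]] by blast

lemma type_of_nonempty: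
  assumes "finite (base R)"
  obtains S where "S \<in> finite_structures \<mu>" "isomorphic \<mu> R S"
proof -
  obtain h where h: "bij_betw h (base R) {0..<card (base R)}" using ex_bij_betw_finite_nat[OF assms] by blast
  let ?S = "\<lparr>base = {0..<card (base R)}, rels = \<lambda>i. map h ` (rels R i \<inter> tuples (base R) (arity \<mu> i))\<rparr>"
  have "?S \<in> finite_structures \<mu>"
    using bij_betwE[OF h] by (auto simp: finite_structures_def is_structure_def tuples_def subset_eq)
  moreover have "is_iso \<mu> R ?S h"
    unfolding is_iso_def
  proof (intro conjI ballI)
    show "bij_betw h (base R) (base ?S)" using h by simp
    fix i xs assume xs: "xs \<in> tuples (base R) (arity \<mu> i)"
    have "ys = xs" if "map h xs = map h ys" "ys \<in> tuples (base R) (arity \<mu> i)" for ys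
    proof (rule map_inj_on[of h])
      show "inj_on h (set ys \<union> set xs)"
        by (rule inj_on_subset[of h "base R"]) (use h xs that in \<open>auto simp: bij_betw_def tuples_def\<close>)
    qed (use that in simp)
    then show "xs \<in> rels R i \<longleftrightarrow> map h xs \<in> rels ?S i" using xs by auto
  qed
  ultimately show ?thesis using that unfolding isomorphic_def by blast
qed

lemma isomorphic_of_type_eq:
  assumes "type_of \<mu> R = type_of \<mu> S" "finite (base R)"
  shows "isomorphic \<mu> R S"
proof -
  obtain T where T: "T \<in> finite_structures \<mu>" "isomorphic \<mu> R T" using type_of_nonempty[OF assms(2)] by blast
  then have "T \<in> type_of \<mu> S" unfolding assms(1)[symmetric] by (simp add: type_of_def)
  then have "isomorphic \<mu> S T" by (simp add: type_of_def)
  then show ?thesis by (rule isomorphic_trans[OF T(2) isomorphic_sym])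
qed

definition tp :: "'i signature \<Rightarrow> ('a, 'i) relstruct \<Rightarrow> 'a set \<Rightarrow> 'i iso_type" where
  "tp \<mu> R X = type_of \<mu> (restriction \<mu> R X)"

lemma tp_Omega: "finite X \<Longrightarrow> tp \<mu> R X \<in> Omega \<mu>"
proof -
  assume "finite X"
  then obtain S where S: "S \<in> finite_structures \<mu>" "isomorphic \<mu> (restriction \<mu> R X) S"
    using type_of_nonempty[of "restriction \<mu> R X" \<mu>] by auto
  show ?thesis unfolding Omega_def tp_def type_of_cong[OF S(2)] using S(1) by (rule imageI)
qed

lemma Omega_mem:
  assumes "s \<in> Omega \<mu>" "S \<in> s"
  shows "type_of \<mu> S = s"
proof -
  obtain S0 :: "(nat, 'a) relstruct" where S0: "s = type_of \<mu> S0" using assms(1) unfolding Omega_def by (rule imageE)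
  then have "isomorphic \<mu> S0 S" using assms(2) by (simp add: type_of_def)
  then show ?thesis unfolding S0 by (rule type_of_cong[symmetric])
qed

lemma tp_eq_iso:
  assumes "finite X" "tp \<mu> R X = tp \<mu> R Y"
  obtains \<theta> where "bij_betw \<theta> X Y" "\<And>Z. Z \<subseteq> X \<Longrightarrow> tp \<mu> R (\<theta> ` Z) = tp \<mu> R Z"
proof -
  obtain \<theta> where \<theta>: "is_iso \<mu> (restriction \<mu> R X) (restriction \<mu> R Y) \<theta>"
    using isomorphic_of_type_eq[of \<mu> "restriction \<mu> R X" "restriction \<mu> R Y"] assms
    unfolding tp_def isomorphic_def by auto
  then have bij: "bij_betw \<theta> X Y" by (simp add: is_iso_def)
  moreover have "tp \<mu> R (\<theta> ` Z) = tp \<mu> R Z" if Z: "Z \<subseteq> X" for Z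
  proof -
    have "\<theta> ` Z \<subseteq> Y" using bij Z by (auto simp: bij_betw_def)
    then have "is_iso \<mu> (restriction \<mu> R Z) (restriction \<mu> R (\<theta> ` Z)) \<theta>"
      using is_iso_restriction[OF \<theta>, of Z] Z by (simp add: restriction_restriction)
    then show ?thesis unfolding tp_def using type_of_cong isomorphic_def by metis
  qed
  ultimately show ?thesis by (rule that)
qed

lemma card_eq_of_tp_eq: "finite X \<Longrightarrow> tp \<mu> R X = tp \<mu> R Y \<Longrightarrow> card X = card Y"
  using tp_eq_iso bij_betw_same_card by metis

lemma member_tp_sub:
  assumes "V \<in> tp \<mu> R Y" "A \<subseteq> base V"
  obtains g where "inj_on g (base V)" "g ` A \<subseteq> Y" "isomorphic \<mu> (restriction \<mu> V A) (restriction \<mu> R (g ` A))"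
    "g ` base V = Y"
proof -
  have "isomorphic \<mu> V (restriction \<mu> R Y)" using assms(1) isomorphic_sym by (auto simp: tp_def type_of_def)
  then obtain g where g: "is_iso \<mu> V (restriction \<mu> R Y) g" unfolding isomorphic_def by blast
  then have bij: "bij_betw g (base V) Y" by (simp add: is_iso_def)
  then have sub: "g ` A \<subseteq> Y" using assms(2) by (auto simp: bij_betw_def)
  have "is_iso \<mu> (restriction \<mu> V A) (restriction \<mu> R (g ` A)) g"
    using is_iso_restriction[OF g assms(2)] sub by (simp add: restriction_restriction)
  then show ?thesis using that[of g] bij sub unfolding isomorphic_def bij_betw_def by blast
qed

lemma type_le_tp:
  assumes "s \<in> Omega \<mu>" "type_le \<mu> s (tp \<mu> R Y)"
  obtains Z where "Z \<subseteq> Y" "s = tp \<mu> R Z"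
proof -
  obtain S T A where ST: "S \<in> s" "T \<in> tp \<mu> R Y" "A \<subseteq> base T" "isomorphic \<mu> S (restriction \<mu> T A)"
    using assms(2) unfolding type_le_def embeds_def by blast
  obtain g where g: "g ` A \<subseteq> Y" "isomorphic \<mu> (restriction \<mu> T A) (restriction \<mu> R (g ` A))"
    using member_tp_sub[OF ST(2,3)] by blast
  have "s = type_of \<mu> S" using Omega_mem[OF assms(1) ST(1)] by simp
  also have "\<dots> = tp \<mu> R (g ` A)" unfolding tp_def by (rule type_of_cong[OF isomorphic_trans[OF ST(4) g(2)]])
  finally show ?thesis using that g(1) by blast
qed

lemma tp_mono:
  assumes "finite Y" "Z \<subseteq> Y"
  shows "type_le \<mu> (tp \<mu> R Z) (tp \<mu> R Y)"
proof -
  obtain T where T: "T \<in> finite_structures \<mu>" "isomorphic \<mu> (restriction \<mu> R Y) T"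
    using type_of_nonempty[of "restriction \<mu> R Y" \<mu>] assms(1) by auto
  have "finite Z" using assms finite_subset by blast
  then obtain S where S: "S \<in> finite_structures \<mu>" "isomorphic \<mu> (restriction \<mu> R Z) S"
    using type_of_nonempty[of "restriction \<mu> R Z" \<mu>] by auto
  obtain f where f: "is_iso \<mu> (restriction \<mu> R Y) T f" using T(2) unfolding isomorphic_def by blast
  have "is_iso \<mu> (restriction \<mu> R Z) (restriction \<mu> T (f ` Z)) f"
    using is_iso_restriction[OF f, of Z] assms(2) by (simp add: restriction_restriction)
  then have "isomorphic \<mu> S (restriction \<mu> T (f ` Z))"
    using isomorphic_trans[OF isomorphic_sym[OF S(2)]] unfolding isomorphic_def by blast
  moreover have "f ` Z \<subseteq> base T" using f assms(2) by (auto simp: is_iso_def bij_betw_def)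
  ultimately have "embeds \<mu> S T" unfolding embeds_def by blast
  then show ?thesis unfolding type_le_def tp_def type_of_def using S T by blast
qed

lemma is_ideal_tp:
  assumes up: "\<And>F G. F \<in> \<F> \<Longrightarrow> G \<in> \<F> \<Longrightarrow> \<exists>H\<in>\<F>. F \<subseteq> H \<and> G \<subseteq> H"
    and down: "\<And>F G. F \<in> \<F> \<Longrightarrow> G \<subseteq> F \<Longrightarrow> G \<in> \<F>" and ne: "\<F> \<noteq> {}" and fin: "\<And>F. F \<in> \<F> \<Longrightarrow> finite F"
  shows "is_ideal \<mu> (tp \<mu> R ` \<F>)"
  unfolding is_ideal_def
proof (intro conjI ballI impI)
  show "tp \<mu> R ` \<F> \<subseteq> Omega \<mu>" using fin tp_Omega by blast
  show "tp \<mu> R ` \<F> \<noteq> {}" using ne by simp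
  fix q s assume q: "q \<in> tp \<mu> R ` \<F>" and s: "s \<in> Omega \<mu>" "type_le \<mu> s q"
  then obtain F where F: "F \<in> \<F>" "q = tp \<mu> R F" by blast
  then obtain Z where "Z \<subseteq> F" "s = tp \<mu> R Z" using type_le_tp s by metis
  then show "s \<in> tp \<mu> R ` \<F>" using down F(1) by blast
next
  fix q s assume "q \<in> tp \<mu> R ` \<F>" "s \<in> tp \<mu> R ` \<F>"
  then obtain F G where FG: "F \<in> \<F>" "q = tp \<mu> R F" "G \<in> \<F>" "s = tp \<mu> R G" by blast
  then obtain H where "H \<in> \<F>" "F \<subseteq> H" "G \<subseteq> H" using up by blast
  then show "\<exists>u\<in>tp \<mu> R ` \<F>. type_le \<mu> q u \<and> type_le \<mu> s u"
    using tp_mono[OF fin] FG by blast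
qed

lemma age_tp: "age \<mu> R = tp \<mu> R ` {F. finite F \<and> F \<subseteq> base R}"
  by (auto simp: age_def tp_def)

lemma is_ideal_age_tp: "is_ideal \<mu> (tp \<mu> R ` {F. finite F \<and> F \<subseteq> X})"
proof (rule is_ideal_tp)
  show "\<exists>H\<in>{F. finite F \<and> F \<subseteq> X}. F \<subseteq> H \<and> G \<subseteq> H"
    if "F \<in> {F. finite F \<and> F \<subseteq> X}" "G \<in> {F. finite F \<and> F \<subseteq> X}" for F G
    using that by (intro bexI[of _ "F \<union> G"]) auto
qed (auto intro: finite_subset)

subsection \<open>Disjoint copies\<close>

text \<open>Inexhaustibility is applied to the union of the copies found so far and to
  \<open>S\<close>. Its disjoint images are in general new sets, so the old copies are transported
  rather than extended.\<close>

lemma disjoint_copies: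
  fixes n :: nat
  assumes inex: "inexhaustible \<mu> (age \<mu> R)" and S: "finite S" "S \<subseteq> base R"
  shows "\<exists>f. (\<forall>i<n. finite (f i) \<and> f i \<subseteq> base R \<and> tp \<mu> R (f i) = tp \<mu> R S) \<and>
    (\<forall>i<n. \<forall>j<n. i \<noteq> j \<longrightarrow> f i \<inter> f j = {})"
proof (induction n)
  case (Suc n)
  then obtain f where "(\<forall>i<n. finite (f i) \<and> f i \<subseteq> base R \<and> tp \<mu> R (f i) = tp \<mu> R S) \<and>
    (\<forall>i<n. \<forall>j<n. i \<noteq> j \<longrightarrow> f i \<inter> f j = {})" by (rule exE)
  then have f: "\<And>i. i < n \<Longrightarrow> finite (f i) \<and> f i \<subseteq> base R \<and> tp \<mu> R (f i) = tp \<mu> R S"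
    "\<And>i j. i < n \<Longrightarrow> j < n \<Longrightarrow> i \<noteq> j \<Longrightarrow> f i \<inter> f j = {}" by simp_all
  define U where "U = (\<Union>i<n. f i)"
  have U: "finite U" "U \<subseteq> base R" using f(1) by (auto simp: U_def)
  have mem: "tp \<mu> R U \<in> age \<mu> R" "tp \<mu> R S \<in> age \<mu> R" using U S by (auto simp: age_tp)
  obtain w S' T V A B where w: "w \<in> age \<mu> R" "S' \<in> tp \<mu> R U" "T \<in> tp \<mu> R S" "V \<in> w"
    and AB: "A \<subseteq> base V" "B \<subseteq> base V" "A \<inter> B = {}"
    and iso: "isomorphic \<mu> S' (restriction \<mu> V A)" "isomorphic \<mu> T (restriction \<mu> V B)"
    using inex[unfolded inexhaustible_def, rule_format, OF mem] by blast
  obtain Y where Y: "finite Y" "Y \<subseteq> base R" "w = tp \<mu> R Y" using w(1) by (auto simp: age_tp)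
  have "isomorphic \<mu> V (restriction \<mu> R Y)"
    using w(4) isomorphic_sym unfolding Y(3) by (auto simp: tp_def type_of_def)
  then obtain g where g: "is_iso \<mu> V (restriction \<mu> R Y) g" unfolding isomorphic_def by blast
  then have bij: "bij_betw g (base V) Y" by (simp add: is_iso_def)
  have sub: "g ` X \<subseteq> Y" if "X \<subseteq> base V" for X using that bij by (auto simp: bij_betw_def)
  have isoX: "isomorphic \<mu> (restriction \<mu> V X) (restriction \<mu> R (g ` X))" if X: "X \<subseteq> base V" for X
    using is_iso_restriction[OF g X] sub[OF X] unfolding isomorphic_def by (auto simp: restriction_restriction)
  have tpX: "tp \<mu> R (g ` X) = tp \<mu> R Z"
    if X: "X \<subseteq> base V" "isomorphic \<mu> P (restriction \<mu> V X)" "P \<in> tp \<mu> R Z" for X P Z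
  proof -
    have "isomorphic \<mu> (restriction \<mu> R Z) P" using X(3) by (simp add: tp_def type_of_def)
    then have "isomorphic \<mu> (restriction \<mu> R Z) (restriction \<mu> R (g ` X))"
      by (rule isomorphic_trans[OF _ isomorphic_trans[OF X(2) isoX[OF X(1)]]])
    then show ?thesis unfolding tp_def by (rule type_of_cong[symmetric])
  qed
  have gA: "tp \<mu> R U = tp \<mu> R (g ` A)" and gB: "tp \<mu> R (g ` B) = tp \<mu> R S"
    using tpX[OF AB(1) iso(1) w(2)] tpX[OF AB(2) iso(2) w(3)] by simp_all
  obtain \<theta> where \<theta>: "bij_betw \<theta> U (g ` A)" "\<And>Z. Z \<subseteq> U \<Longrightarrow> tp \<mu> R (\<theta> ` Z) = tp \<mu> R Z"
    using tp_eq_iso[OF U(1) gA] by blast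
  have fU: "f i \<subseteq> U" if "i < n" for i using that by (auto simp: U_def)
  have disj: "g ` A \<inter> g ` B = {}"
    using bij AB(3) inj_on_image_Int[OF _ AB(1,2), of g] by (simp add: bij_betw_def)
  let ?f = "\<lambda>i. if i < n then \<theta> ` f i else g ` B"
  have \<theta>A: "\<theta> ` f i \<subseteq> g ` A" if "i < n" for i using \<theta>(1) fU[OF that] by (auto simp: bij_betw_def)
  have "finite (?f i) \<and> ?f i \<subseteq> base R \<and> tp \<mu> R (?f i) = tp \<mu> R S" for i
  proof (cases "i < n")
    case True
    then show ?thesis using f(1)[OF True] \<theta>(2)[OF fU[OF True]] \<theta>A[OF True] sub[OF AB(1)] Y(2) by auto
  next
    case False
    have "finite (g ` B)" using sub[OF AB(2)] Y(1) finite_subset by blast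
    then show ?thesis using False gB sub[OF AB(2)] Y(2) by auto
  qed
  moreover have "?f i \<inter> ?f j = {}" if ij: "i < Suc n" "j < Suc n" "i \<noteq> j" for i j
  proof -
    consider "i < n" "j < n" | "i < n" "j = n" | "i = n" "j < n" using ij by linarith
    then show ?thesis
    proof cases
      case 1
      have "inj_on \<theta> U" using \<theta>(1) by (simp add: bij_betw_def)
      then have "\<theta> ` f i \<inter> \<theta> ` f j = \<theta> ` (f i \<inter> f j)" using fU 1 by (simp add: inj_on_image_Int)
      then show ?thesis using 1 f(2) ij(3) by simp
    qed (use \<theta>A disj in auto)
  qed
  ultimately show ?case by (intro exI[of _ ?f]) blast
qed auto

text \<open>A finite set cannot meet all of \<open>card F + 1\<close> disjoint copies. With this,
  finite families that change with their length are turned into one infinite sequence.\<close>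

lemma copy_avoiding:
  assumes inex: "inexhaustible \<mu> (age \<mu> R)" and S: "finite S" "S \<subseteq> base R" and F: "finite F"
  obtains X where "finite X" "X \<subseteq> base R" "tp \<mu> R X = tp \<mu> R S" "X \<inter> F = {}"
proof -
  obtain f where "(\<forall>i<Suc (card F). finite (f i) \<and> f i \<subseteq> base R \<and> tp \<mu> R (f i) = tp \<mu> R S) \<and>
    (\<forall>i<Suc (card F). \<forall>j<Suc (card F). i \<noteq> j \<longrightarrow> f i \<inter> f j = {})"
    using disjoint_copies[OF inex S] by (rule exE)
  then have f: "\<And>i. i < Suc (card F) \<Longrightarrow> finite (f i) \<and> f i \<subseteq> base R \<and> tp \<mu> R (f i) = tp \<mu> R S"
    "\<And>i j. i < Suc (card F) \<Longrightarrow> j < Suc (card F) \<Longrightarrow> i \<noteq> j \<Longrightarrow> f i \<inter> f j = {}" by simp_all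
  have "\<exists>i<Suc (card F). f i \<inter> F = {}"
  proof (rule ccontr)
    assume "\<not> ?thesis"
    then have "\<forall>i\<in>{..<Suc (card F)}. \<exists>x. x \<in> f i \<inter> F" by auto
    from bchoice[OF this] obtain p where p: "\<forall>i\<in>{..<Suc (card F)}. p i \<in> f i \<inter> F" ..
    have "inj_on p {..<Suc (card F)}"
    proof (rule inj_onI)
      fix i j assume ij: "i \<in> {..<Suc (card F)}" "j \<in> {..<Suc (card F)}" "p i = p j"
      then have "p i \<in> f i" "p i \<in> f j" using bspec[OF p ij(1)] bspec[OF p ij(2)] by simp_all
      then show "i = j" using f(2)[of i j] ij by blast
    qed
    moreover have "p ` {..<Suc (card F)} \<subseteq> F" using p by blast
    ultimately have "card {..<Suc (card F)} \<le> card F" using F by (rule card_inj_on_le)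
    then show False by simp
  qed
  then obtain i where "i < Suc (card F)" "f i \<inter> F = {}" by blast
  then show ?thesis using that[of "f i"] f(1)[of i] by simp
qed

lemma infinitely_many_copies:
  assumes inex: "inexhaustible \<mu> (age \<mu> R)" and S: "finite S" "S \<subseteq> base R"
  obtains X :: "nat \<Rightarrow> 'a set" where "\<And>n. finite (X n) \<and> X n \<subseteq> base R \<and> tp \<mu> R (X n) = tp \<mu> R S"
    "\<And>i j. i \<noteq> j \<Longrightarrow> X i \<inter> X j = {}"
proof -
  have "\<forall>F\<in>Collect finite. \<exists>X. finite X \<and> X \<subseteq> base R \<and> tp \<mu> R X = tp \<mu> R S \<and> X \<inter> F = {}"
  proof
    fix F :: "'a set" assume "F \<in> Collect finite"
    then have "finite F" by simp
    then obtain X where "finite X" "X \<subseteq> base R" "tp \<mu> R X = tp \<mu> R S" "X \<inter> F = {}"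
      by (rule copy_avoiding[OF inex S])
    then show "\<exists>X. finite X \<and> X \<subseteq> base R \<and> tp \<mu> R X = tp \<mu> R S \<and> X \<inter> F = {}"
      by (intro exI[of _ X] conjI)
  qed
  from bchoice[OF this] obtain pick where pk: "\<forall>F\<in>Collect finite. finite (pick F) \<and> pick F \<subseteq> base R \<and>
      tp \<mu> R (pick F) = tp \<mu> R S \<and> pick F \<inter> F = {}" ..
  have pick: "finite (pick F) \<and> pick F \<subseteq> base R \<and> tp \<mu> R (pick F) = tp \<mu> R S \<and> pick F \<inter> F = {}"
    if "finite F" for F using bspec[OF pk, of F] that by simp
  define U where "U = rec_nat {} (\<lambda>_ F. F \<union> pick F)"
  have U: "U 0 = {}" "\<And>n. U (Suc n) = U n \<union> pick (U n)" by (simp_all add: U_def)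
  have finU: "finite (U n)" for n by (induction n) (simp_all add: U pick)
  have mono: "U i \<subseteq> U j" if "i \<le> j" for i j using that by (induction j) (auto simp: U le_Suc_eq)
  have less: "pick (U i) \<inter> pick (U j) = {}" if "i < j" for i j
  proof -
    have "pick (U i) \<subseteq> U j" using mono[of "Suc i" j] that by (simp add: U)
    then show ?thesis using pick[OF finU[of j]] by blast
  qed
  show ?thesis
  proof (rule that[of "\<lambda>n. pick (U n)"])
    show "finite (pick (U n)) \<and> pick (U n) \<subseteq> base R \<and> tp \<mu> R (pick (U n)) = tp \<mu> R S" for n
      using pick[OF finU] by blast
    show "pick (U i) \<inter> pick (U j) = {}" if "i \<noteq> j" for i j
      using less[of i j] less[of j i] that by (cases rule: linorder_cases[of i j]) auto
  qed
qed

subsection \<open>Indiscernible copies\<close>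

definition rk :: "'i::linorder set \<Rightarrow> 'i \<Rightarrow> nat" where
  "rk K i = card {j \<in> K. j < i}"

text \<open>Undoes \<open>mv (rk K)\<close> on sets over \<open>K\<close>. It lets patterns on the
  positions 0, 1, ... be compared over different finite index sets.\<close>

definition pull :: "'i::linorder set \<Rightarrow> (nat \<times> 'c) set \<Rightarrow> ('i \<times> 'c) set" where
  "pull K F = {(i, c). i \<in> K \<and> (rk K i, c) \<in> F}"

lemma rk_less: "finite K \<Longrightarrow> i \<in> K \<Longrightarrow> rk K i < card K"
  unfolding rk_def by (rule psubset_card_mono) auto

lemma strict_mono_on_rk: "finite K \<Longrightarrow> strict_mono_on K (rk K)"
  unfolding rk_def by (intro strict_mono_onI psubset_card_mono) (auto simp: less_le_trans)

lemma rk_image: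
  fixes g :: "'i::linorder \<Rightarrow> 'j::linorder"
  assumes "strict_mono_on S g" "s \<in> S"
  shows "rk (g ` S) (g s) = rk S s"
proof -
  have "g j < g s \<longleftrightarrow> j < s" if "j \<in> S" for j
    using that assms strict_mono_on_less by blast
  then have "{j \<in> g ` S. j < g s} = g ` {j \<in> S. j < s}" by auto
  moreover have "inj_on g {j \<in> S. j < s}"
    by (rule inj_on_subset[OF strict_mono_on_imp_inj_on[OF assms(1)]]) auto
  ultimately show ?thesis by (simp add: rk_def card_image)
qed

lemma pull_image:
  fixes g :: "'i::linorder \<Rightarrow> 'j::linorder" and F :: "('i \<times> 'c) set"
  assumes g: "strict_mono_on S g" and S: "finite S" and F: "fst ` F \<subseteq> S"
  shows "pull (g ` S) (mv (rk S) F) = mv g F"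
proof (rule set_eqI, clarify)
  fix i :: 'j and c :: 'c
  have inj: "x = y" if "x \<in> S" "y \<in> S" "rk S x = rk S y" for x y
    using strict_mono_on_imp_inj_on[OF strict_mono_on_rk[OF S]] that by (auto simp: inj_on_def)
  have FS: "x \<in> S" if "(x, d) \<in> F" for x d using F that by force
  have "(g s, c) \<in> pull (g ` S) (mv (rk S) F) \<longleftrightarrow> (s, c) \<in> F" if "s \<in> S" for s
    using that FS inj[OF that] rk_image[OF g that] by (auto simp: pull_def mem_mv)
  moreover have "(g s, c) \<in> mv g F \<longleftrightarrow> (s, c) \<in> F" if "s \<in> S" for s
    using that FS strict_mono_on_imp_inj_on[OF g] by (auto simp: mem_mv inj_on_def)
  moreover have "i \<in> g ` S" if "(i, c) \<in> mv g F" using that FS by (auto simp: mem_mv)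
  moreover have "i \<in> g ` S" if "(i, c) \<in> pull (g ` S) (mv (rk S) F)" using that by (simp add: pull_def)
  ultimately show "(i, c) \<in> pull (g ` S) (mv (rk S) F) \<longleftrightarrow> (i, c) \<in> mv g F" by blast
qed

lemma mv_rk_subset: "finite K \<Longrightarrow> F \<subseteq> K \<times> C \<Longrightarrow> mv (rk K) F \<subseteq> {..<card K} \<times> C"
  using rk_less by (fastforce simp: mv_def)

lemma pull_subset: "F \<subseteq> UNIV \<times> C \<Longrightarrow> pull K F \<subseteq> K \<times> C"
  by (auto simp: pull_def)

lemma pull_mv_rk:
  assumes "finite K" "G \<subseteq> K \<times> C"
  shows "pull K (mv (rk K) G) = G"
proof -
  have "fst ` G \<subseteq> K" using assms(2) by auto
  then show ?thesis
    using pull_image[of K "\<lambda>x. x" G] assms(1) by (simp add: strict_mono_on_def mv_def)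
qed

lemma Ramsey_colours:
  fixes f :: "nat set \<Rightarrow> 'x"
  assumes Z: "infinite Z" and fin: "finite (f ` {K. K \<subseteq> Z \<and> finite K \<and> card K = r})"
  shows "\<exists>Y\<subseteq>Z. infinite Y \<and> (\<exists>c. \<forall>K\<subseteq>Y. finite K \<longrightarrow> card K = r \<longrightarrow> f K = c)"
proof -
  let ?D = "f ` {K. K \<subseteq> Z \<and> finite K \<and> card K = r}"
  obtain h where h: "bij_betw h ?D {0..<card ?D}" using ex_bij_betw_finite_nat[OF fin] by blast
  have "\<forall>K. K \<subseteq> Z \<and> finite K \<and> card K = r \<longrightarrow> h (f K) < card ?D"
    using bij_betwE[OF h] by auto
  from Ramsey[OF Z this] obtain Y d where Y: "Y \<subseteq> Z" "infinite Y"
    and d: "\<forall>K. K \<subseteq> Y \<and> finite K \<and> card K = r \<longrightarrow> h (f K) = d" by blast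
  show ?thesis
  proof (intro exI[of _ Y] exI[of _ "inv_into ?D h d"] conjI allI impI Y)
    fix K assume K: "K \<subseteq> Y" "finite K" "card K = r"
    then have "f K \<in> ?D" "h (f K) = d" using Y d by auto
    then show "f K = inv_into ?D h d" using bij_betw_inv_into_left[OF h, of "f K"] by simp
  qed
qed

lemma superset_card:
  assumes "infinite Y" "finite A" "A \<subseteq> Y" "card A \<le> n"
  obtains K where "A \<subseteq> K" "K \<subseteq> Y" "finite K" "card K = n"
proof -
  have "infinite (Y - A)" using assms by simp
  from infinite_arbitrarily_large[OF this, of "n - card A"]
  obtain B where B: "B \<subseteq> Y - A" "finite B" "card B = n - card A" by blast
  then have "card (A \<union> B) = n" using assms by (subst card_Un_disjoint) auto
  then show ?thesis using that[of "A \<union> B"] B assms by auto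
qed

text \<open>On a homogeneous infinite \<open>Y\<close> each pattern on \<open>n\<close> positions
  realises at most one of the chosen types in \<open>T\<close>. Since \<open>Y\<close> has the same
  types as \<open>I\<close>, all of \<open>T\<close> occurs, so \<open>T\<close> has at most as many
  members as there are patterns.\<close>

lemma finitely_many_types:
  fixes \<tau> :: "(nat \<times> nat) set \<Rightarrow> 'q"
  assumes C: "finite C" and I: "infinite I"
    and card: "\<And>F G. finite F \<Longrightarrow> finite G \<Longrightarrow> F \<subseteq> UNIV \<times> C \<Longrightarrow> G \<subseteq> UNIV \<times> C \<Longrightarrow> \<tau> F = \<tau> G \<Longrightarrow> card F = card G"
    and same: "\<And>I'. I' \<subseteq> I \<Longrightarrow> infinite I' \<Longrightarrow>
      \<tau> ` {F. finite F \<and> F \<subseteq> I' \<times> C} = \<tau> ` {F. finite F \<and> F \<subseteq> I \<times> C}"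
  shows "finite (\<tau> ` {F. finite F \<and> F \<subseteq> I \<times> C \<and> card F \<le> n})" (is "finite ?P")
proof (rule ccontr)
  let ?B = "Pow ({..<n} \<times> C)"
  assume "infinite ?P"
  from infinite_arbitrarily_large[OF this, of "Suc (card ?B)"]
  obtain T where T: "T \<subseteq> ?P" "finite T" "card T = Suc (card ?B)" by blast
  \<comment> \<open>Types outside the finite set \<open>T\<close> are merged into
    \<open>None\<close>, so that the number of colours is finite.\<close>
  define f where "f K = (\<lambda>F\<in>?B. if \<tau> (pull K F) \<in> T then Some (\<tau> (pull K F)) else None)" for K
  have B: "finite ?B" using C by simp
  have "f ` {K. K \<subseteq> I \<and> finite K \<and> card K = n} \<subseteq> ?B \<rightarrow>\<^sub>E insert None (Some ` T)"
    unfolding f_def by (rule image_subsetI) (simp add: restrict_PiE_iff)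
  moreover have "finite (?B \<rightarrow>\<^sub>E insert None (Some ` T))" using B T(2) by (intro finite_PiE) auto
  ultimately have "finite (f ` {K. K \<subseteq> I \<and> finite K \<and> card K = n})" by (rule finite_subset)
  from Ramsey_colours[OF I this] obtain Y c where Y: "Y \<subseteq> I" "infinite Y"
    "\<And>K. K \<subseteq> Y \<Longrightarrow> finite K \<Longrightarrow> card K = n \<Longrightarrow> f K = c" by blast
  have "T \<subseteq> (\<lambda>F. the (c F)) ` ?B"
  proof
    fix q assume q: "q \<in> T"
    then obtain F where F: "finite F" "F \<subseteq> I \<times> C" "card F \<le> n" "q = \<tau> F" using T(1) by blast
    then have "q \<in> \<tau> ` {F. finite F \<and> F \<subseteq> Y \<times> C}" using same[OF Y(1,2)] by blast
    then obtain G where G: "finite G" "G \<subseteq> Y \<times> C" "q = \<tau> G" by blast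
    have "card G = card F" using G F by (intro card) auto
    then have cn: "card (fst ` G) \<le> n" using card_image_le[OF G(1), of fst] F(3) by linarith
    have "fst ` G \<subseteq> Y" using G(2) by auto
    then obtain K where K: "fst ` G \<subseteq> K" "K \<subseteq> Y" "finite K" "card K = n"
      by (rule superset_card[OF Y(2) finite_imageI[OF G(1)] _ cn])
    let ?F = "mv (rk K) G"
    have GK: "G \<subseteq> K \<times> C" using G(2) K(1) by force
    have "?F \<in> ?B" using mv_rk_subset[OF K(3) GK] K(4) by simp
    moreover have "c ?F = Some q"
      using Y(3)[OF K(2,3,4), symmetric] \<open>?F \<in> ?B\<close> q pull_mv_rk[OF K(3) GK] G(3) by (simp add: f_def)
    ultimately show "q \<in> (\<lambda>F. the (c F)) ` ?B" by (intro image_eqI[of _ _ ?F]) simp_all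
  qed
  then have "card T \<le> card ?B" by (rule surj_card_le[OF B])
  then show False using T(3) by simp
qed

text \<open>The colour of an \<open>l\<close>-set lists the types of all patterns over it, which
  have at most \<open>l * card C\<close> points, so \<open>fin\<close> makes the colours finite in
  number. The chain decreases, so finite sets with at most \<open>l\<close> indices can be compared
  inside \<open>Y l\<close>.\<close>

lemma homogeneous_chain:
  fixes \<tau> :: "(nat \<times> nat) set \<Rightarrow> 'q"
  assumes C: "finite C" and I: "infinite I"
    and fin: "\<And>n. finite (\<tau> ` {F. finite F \<and> F \<subseteq> I \<times> C \<and> card F \<le> n})"
  obtains Y :: "nat \<Rightarrow> nat set" and \<chi> where "\<And>l. infinite (Y l)" "\<And>i j. i \<le> j \<Longrightarrow> Y j \<subseteq> Y i"
    "\<And>l K F. K \<subseteq> Y l \<Longrightarrow> finite K \<Longrightarrow> card K = l \<Longrightarrow> F \<subseteq> {..<l} \<times> C \<Longrightarrow> \<tau> (pull K F) = \<chi> l F"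
proof -
  define f where "f l K = (\<lambda>F\<in>Pow ({..<l} \<times> C). \<tau> (pull K F))" for l K
  define good where "good l Z \<longleftrightarrow> Z \<subseteq> I \<and> infinite Z \<and> (\<exists>c. \<forall>K\<subseteq>Z. finite K \<longrightarrow> card K = l \<longrightarrow> f l K = c)"
    for l Z
  have step: "\<exists>Z'. good l Z' \<and> Z' \<subseteq> Z" if Z: "Z \<subseteq> I" "infinite Z" for l Z
  proof -
    let ?Q = "\<tau> ` {F. finite F \<and> F \<subseteq> I \<times> C \<and> card F \<le> l * card C}"
    have "f l K \<in> Pow ({..<l} \<times> C) \<rightarrow>\<^sub>E ?Q" if K: "K \<subseteq> Z" "finite K" "card K = l" for K
      unfolding f_def
    proof (rule restrict_PiE_iff[THEN iffD2], rule ballI)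
      fix F assume "F \<in> Pow ({..<l} \<times> C)"
      then have "pull K F \<subseteq> K \<times> C" by (intro pull_subset) auto
      moreover from this have "card (pull K F) \<le> l * card C"
        using card_mono[of "K \<times> C" "pull K F"] K C by (simp add: card_cartesian_product)
      ultimately show "\<tau> (pull K F) \<in> ?Q"
        using K Z(1) C by (intro imageI) (auto intro: finite_subset[of _ "K \<times> C"])
    qed
    then have "f l ` {K. K \<subseteq> Z \<and> finite K \<and> card K = l} \<subseteq> Pow ({..<l} \<times> C) \<rightarrow>\<^sub>E ?Q" by blast
    moreover have "finite (Pow ({..<l} \<times> C) \<rightarrow>\<^sub>E ?Q)" using C fin by (intro finite_PiE) auto
    ultimately have "finite (f l ` {K. K \<subseteq> Z \<and> finite K \<and> card K = l})" by (rule finite_subset)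
    from Ramsey_colours[OF Z(2) this] obtain Y where Y: "Y \<subseteq> Z \<and> infinite Y \<and>
      (\<exists>c. \<forall>K\<subseteq>Y. finite K \<longrightarrow> card K = l \<longrightarrow> f l K = c)" by (rule exE)
    then have "Y \<subseteq> I" using Z(1) by (meson subset_trans)
    then have "good l Y \<and> Y \<subseteq> Z" unfolding good_def using Y by simp
    then show ?thesis ..
  qed
  have ex: "\<exists>Y. \<forall>l. good l (Y l) \<and> Y (Suc l) \<subseteq> Y l"
  proof (rule dependent_nat_choice)
    show "\<exists>Z. good 0 Z" using step[OF subset_refl I] by blast
    show "\<exists>Z'. good (Suc l) Z' \<and> Z' \<subseteq> Z" if "good l Z" for Z l
      using step[of Z "Suc l"] that unfolding good_def by simp
  qed
  from ex obtain Y where "\<forall>l. good l (Y l) \<and> Y (Suc l) \<subseteq> Y l" ..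
  then have Y: "\<And>l. good l (Y l)" "\<And>l. Y (Suc l) \<subseteq> Y l" by simp_all
  have "\<forall>l. \<exists>c. \<forall>K\<subseteq>Y l. finite K \<longrightarrow> card K = l \<longrightarrow> f l K = c" using Y(1) unfolding good_def by simp
  from choice[OF this] obtain \<chi> where \<chi>: "\<forall>l. \<forall>K\<subseteq>Y l. finite K \<longrightarrow> card K = l \<longrightarrow> f l K = \<chi> l" ..
  show ?thesis
  proof (rule that[of Y \<chi>])
    show "infinite (Y l)" for l using Y(1)[of l] by (simp add: good_def)
    show "Y j \<subseteq> Y i" if "i \<le> j" for i j using Y(2) that by (rule lift_Suc_antimono_le)
    fix l K F assume "K \<subseteq> Y l" "finite K" "card K = l" "F \<subseteq> {..<l} \<times> C"
    then have "f l K = \<chi> l" "F \<in> Pow ({..<l} \<times> C)" using \<chi>[rule_format, of K l] by simp_all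
    then show "\<tau> (pull K F) = \<chi> l F" unfolding f_def by (metis restrict_apply')
  qed
qed

text \<open>Well-foundedness yields infinitely many copies whose age is that of any infinite subfamily.
  If they had infinitely many types of some size, a finite colouring that recognises many of these
  types would have a homogeneous subfamily omitting one of them. With finitely many types of each
  size, Ramsey's theorem applies to the types themselves, even if the signature is infinite.\<close>

lemma indiscernible_copies:
  assumes inex: "inexhaustible \<mu> (age \<mu> R)" and wf: "age_height_defined \<mu> (age \<mu> R)"
    and S: "finite S" "S \<subseteq> base R"
  obtains m and t :: "(rat \<times> nat) set \<Rightarrow> 'i iso_type"
  where "\<And>F. finite F \<Longrightarrow> F \<subseteq> UNIV \<times> {..<m} \<Longrightarrow>
      \<exists>\<Phi>. inj_on \<Phi> F \<and> \<Phi> ` F \<subseteq> base R \<and> (\<forall>X\<subseteq>F. t X = tp \<mu> R (\<Phi> ` X))"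
    "\<And>F g. finite F \<Longrightarrow> F \<subseteq> UNIV \<times> {..<m} \<Longrightarrow> strict_mono_on (fst ` F) g \<Longrightarrow> t (mv g F) = t F"
    "\<And>Z. Z \<subseteq> S \<Longrightarrow> \<exists>F. finite F \<and> F \<subseteq> UNIV \<times> {..<m} \<and> card F = card Z \<and> t F = tp \<mu> R Z"
proof -
  define m where "m = card S"
  let ?C = "{..<m}"
  obtain X :: "nat \<Rightarrow> 'a set" where X: "\<And>n. finite (X n) \<and> X n \<subseteq> base R \<and> tp \<mu> R (X n) = tp \<mu> R S"
    "\<And>i j. i \<noteq> j \<Longrightarrow> X i \<inter> X j = {}" using inex S by (rule infinitely_many_copies) (rule that)
  have "\<forall>n. \<exists>e. bij_betw e ?C (X n)"
  proof
    fix n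
    have "card (X n) = m" unfolding m_def by (rule card_eq_of_tp_eq) (use X(1) in auto)
    then show "\<exists>e. bij_betw e ?C (X n)" using X(1)[of n] by (metis ex_bij_betw_nat_finite lessThan_atLeast0)
  qed
  from choice[OF this] obtain e where e: "\<forall>n. bij_betw (e n) ?C (X n)" ..
  define pt where "pt = (\<lambda>(n, c). e n c)"
  have pt_X: "e n c \<in> X n" if "c < m" for n c using bij_betwE[of "e n" ?C "X n"] e that by simp
  have inj: "inj_on pt (UNIV \<times> ?C)"
  proof (rule inj_onI, clarsimp simp: pt_def)
    fix n c n' c' assume c: "c < m" "c' < m" "e n c = e n' c'"
    then have "n = n'" using X(2)[of n n'] pt_X[of c n] pt_X[of c' n'] by auto
    moreover have "inj_on (e n) ?C" using e by (simp add: bij_betw_def)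
    ultimately show "n = n' \<and> c = c'" using c by (simp add: inj_on_def)
  qed
  have injF: "inj_on pt F" if "F \<subseteq> UNIV \<times> ?C" for F using inj that by (rule inj_on_subset)
  have base: "pt ` F \<subseteq> base R" if "F \<subseteq> UNIV \<times> ?C" for F
  proof
    fix x assume "x \<in> pt ` F"
    then obtain n c where "(n, c) \<in> F" "x = e n c" by (auto simp: pt_def)
    then have "x \<in> X n" using that pt_X by auto
    then show "x \<in> base R" using X(1)[of n] by blast
  qed
  define \<tau> where "\<tau> F = tp \<mu> R (pt ` F)" for F
  define ages where "ages I = \<tau> ` {F. finite F \<and> F \<subseteq> I \<times> ?C}" for I :: "nat set"
  have ages_tp: "ages I = tp \<mu> R ` {F. finite F \<and> F \<subseteq> pt ` (I \<times> ?C)}" for I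
  proof -
    have "{F. finite F \<and> F \<subseteq> pt ` (I \<times> ?C)} = (\<lambda>F. pt ` F) ` {F. finite F \<and> F \<subseteq> I \<times> ?C}"
    proof
      show "{F. finite F \<and> F \<subseteq> pt ` (I \<times> ?C)} \<subseteq> (\<lambda>F. pt ` F) ` {F. finite F \<and> F \<subseteq> I \<times> ?C}"
        using finite_subset_image[of _ pt "I \<times> ?C"] by blast
    qed auto
    then show ?thesis by (simp add: ages_def \<tau>_def image_image)
  qed
  have ideal: "is_ideal \<mu> (ages I)" for I unfolding ages_tp by (rule is_ideal_age_tp)
  have ages_age: "ages I \<subseteq> age \<mu> R" for I
  proof -
    have "pt ` (I \<times> ?C) \<subseteq> base R" by (rule base) auto
    then show ?thesis unfolding ages_tp age_tp by (intro image_mono) auto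
  qed
  have ages_mono: "I \<subseteq> J \<Longrightarrow> ages I \<subseteq> ages J" for I J unfolding ages_def by blast
  obtain I where I: "infinite I" "\<And>I'. infinite I' \<Longrightarrow> (ages I', ages I) \<notin> ideal_less \<mu> (age \<mu> R)"
  proof -
    have "ages UNIV \<in> ages ` Collect infinite" by simp
    with wf obtain z where z: "z \<in> ages ` Collect infinite"
      "\<And>y. (y, z) \<in> ideal_less \<mu> (age \<mu> R) \<Longrightarrow> y \<notin> ages ` Collect infinite"
      unfolding age_height_defined_def by (rule wfE_min) (rule that)
    from z(1) obtain I where "z = ages I" "I \<in> Collect infinite" by (rule imageE)
    then have I: "infinite I" "z = ages I" by simp_all
    show ?thesis
    proof (rule that[OF I(1)])
      show "(ages I', ages I) \<notin> ideal_less \<mu> (age \<mu> R)" if "infinite I'" for I'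
      proof
        assume "(ages I', ages I) \<in> ideal_less \<mu> (age \<mu> R)"
        then have "ages I' \<notin> ages ` Collect infinite" unfolding I(2)[symmetric] by (rule z(2))
        then show False using that by simp
      qed
    qed
  qed
  have same: "ages I' = ages I" if "I' \<subseteq> I" "infinite I'" for I'
  proof (rule ccontr)
    assume "ages I' \<noteq> ages I"
    then have "(ages I', ages I) \<in> ideal_less \<mu> (age \<mu> R)"
      using ages_mono[OF that(1)] ideal ages_age by (auto simp: ideal_less_def)
    then show False using I(2)[OF that(2)] by simp
  qed
  have "finite (\<tau> ` {F. finite F \<and> F \<subseteq> I \<times> ?C \<and> card F \<le> n})" for n
  proof (rule finitely_many_types[OF _ I(1)])
    show "card F = card G" if "finite F" "finite G" "F \<subseteq> UNIV \<times> ?C" "G \<subseteq> UNIV \<times> ?C" "\<tau> F = \<tau> G" for F G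
      using card_eq_of_tp_eq[of "pt ` F" \<mu> R "pt ` G"] that injF by (simp add: \<tau>_def card_image)
    show "\<tau> ` {F. finite F \<and> F \<subseteq> I' \<times> ?C} = \<tau> ` {F. finite F \<and> F \<subseteq> I \<times> ?C}"
      if "I' \<subseteq> I" "infinite I'" for I' using same[OF that] by (simp add: ages_def)
  qed simp
  then obtain Y \<chi> where Y: "\<And>l. infinite (Y l)" "\<And>i j. i \<le> j \<Longrightarrow> Y j \<subseteq> Y i"
    and \<chi>: "\<And>l K F. K \<subseteq> Y l \<Longrightarrow> finite K \<Longrightarrow> card K = l \<Longrightarrow> F \<subseteq> {..<l} \<times> ?C \<Longrightarrow> \<tau> (pull K F) = \<chi> l F"
    by (rule homogeneous_chain[OF finite_lessThan I(1)]) (rule that)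
  \<comment> \<open>Only the ranks of the indices enter, so invariance under increasing maps is
    built in; \<open>real\<close> shows that the value is the type of an actual
    substructure.\<close>
  define t where "t F = \<chi> (card (fst ` F)) (mv (rk (fst ` F)) F)" for F :: "(rat \<times> nat) set"
  have real: "t F = \<tau> (mv g F)"
    if F: "finite F" "F \<subseteq> UNIV \<times> ?C" and g: "strict_mono_on (fst ` F) g" "g ` fst ` F \<subseteq> Y l" "card (fst ` F) \<le> l"
    for F g l
  proof -
    let ?S = "fst ` F" and ?K = "g ` fst ` F"
    have "\<tau> (pull ?K (mv (rk ?S) F)) = \<chi> (card ?S) (mv (rk ?S) F)"
    proof (rule \<chi>)
      show "?K \<subseteq> Y (card ?S)" using g(2) Y(2)[OF g(3)] by blast
      show "card ?K = card ?S" by (rule card_image[OF strict_mono_on_imp_inj_on[OF g(1)]])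
      show "mv (rk ?S) F \<subseteq> {..<card ?S} \<times> ?C"
        by (rule mv_rk_subset) (use F in force)+
    qed (use F in simp)
    then show ?thesis using pull_image[OF g(1) _ subset_refl] F(1) by (simp add: t_def)
  qed
  show ?thesis
  proof (rule that[of m t])
    fix F :: "(rat \<times> nat) set" assume F: "finite F" "F \<subseteq> UNIV \<times> ?C"
    let ?l = "card (fst ` F)"
    obtain K where K: "K \<subseteq> Y ?l" "finite K" "card K = ?l"
      using superset_card[OF Y(1), of "{}" ?l ?l] by auto
    then obtain g where g: "bij_betw g (fst ` F) K" "strict_mono_on (fst ` F) g"
      using strict_mono_bij_ex[of "fst ` F" K] F(1) by auto
    have gK: "g ` fst ` F = K" using g(1) by (simp add: bij_betw_def)
    let ?\<Phi> = "\<lambda>(i, c). pt (g i, c)"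
    have \<Phi>: "?\<Phi> ` X = pt ` mv g X" for X by (force simp: mv_def)
    have "inj_on ?\<Phi> F"
    proof -
      have "?\<Phi> = pt \<circ> (\<lambda>(i, c). (g i, c))" by auto
      moreover have "inj_on (\<lambda>(i, c). (g i, c)) F"
        by (rule inj_on_mv[OF strict_mono_on_imp_inj_on[OF g(2)]])
      moreover have "inj_on pt ((\<lambda>(i, c). (g i, c)) ` F)" by (rule injF) (use F in auto)
      ultimately show ?thesis by (simp add: comp_inj_on)
    qed
    moreover have "?\<Phi> ` F \<subseteq> base R" unfolding \<Phi> by (rule base[OF mv_columns[OF F(2)]])
    moreover have "t X = tp \<mu> R (?\<Phi> ` X)" if XF: "X \<subseteq> F" for X
    proof -
      have "fst ` X \<subseteq> fst ` F" using XF by blast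
      moreover from this have "g ` fst ` X \<subseteq> Y ?l" using gK K(1) by blast
      ultimately have "t X = \<tau> (mv g X)"
        using finite_subset[OF XF F(1)] XF F monotone_on_subset[OF g(2)]
        by (intro real[where l = ?l] card_mono) auto
      then show ?thesis unfolding \<tau>_def \<Phi> .
    qed
    ultimately show "\<exists>\<Phi>. inj_on \<Phi> F \<and> \<Phi> ` F \<subseteq> base R \<and> (\<forall>X\<subseteq>F. t X = tp \<mu> R (\<Phi> ` X))"
      by (intro exI[of _ ?\<Phi>]) blast
  next
    fix F :: "(rat \<times> nat) set" and g :: "rat \<Rightarrow> rat"
    assume F: "finite F" "F \<subseteq> UNIV \<times> ?C" and g: "strict_mono_on (fst ` F) g"
    have "card (g ` fst ` F) = card (fst ` F)" by (rule card_image[OF strict_mono_on_imp_inj_on[OF g]])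
    moreover have "mv (rk (g ` fst ` F)) (mv g F) = mv (rk (fst ` F)) F"
      unfolding mv_mv by (rule mv_cong) (simp add: rk_image[OF g])
    ultimately show "t (mv g F) = t F" unfolding t_def fst_mv by simp
  next
    fix Z assume Z: "Z \<subseteq> S"
    \<comment> \<open>A single copy contains all of \<open>Z\<close>, so one piece at the index 0
      represents it.\<close>
    obtain i where i: "i \<in> Y 1" using Y(1)[of 1] infinite_imp_nonempty by blast
    have eX: "e i ` ?C = X i" using e by (simp add: bij_betw_def)
    obtain \<theta> where \<theta>: "bij_betw \<theta> S (X i)" "\<And>Z. Z \<subseteq> S \<Longrightarrow> tp \<mu> R (\<theta> ` Z) = tp \<mu> R Z"
      using tp_eq_iso[OF S(1), of \<mu> R "X i"] X(1)[of i] by auto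
    have "\<theta> ` Z \<subseteq> e i ` ?C" using image_mono[OF Z, of \<theta>] \<theta>(1) eX by (simp add: bij_betw_def)
    then obtain D where D: "D \<subseteq> ?C" "\<theta> ` Z = e i ` D" using subset_imageE by metis
    let ?F = "{0::rat} \<times> D"
    have F: "finite ?F" "?F \<subseteq> UNIV \<times> ?C" using D(1) finite_subset by auto
    have mvF: "pt ` mv (\<lambda>_. i) ?F = \<theta> ` Z" using D(2) by (force simp: mv_def pt_def)
    have "t ?F = \<tau> (mv (\<lambda>_. i) ?F)"
    proof (rule real[OF F, where l = 1])
      have "fst ` ?F \<subseteq> {0}" by auto
      then show "card (fst ` ?F) \<le> 1" using card_mono[of "{0::rat}" "fst ` ?F"] by simp
      show "(\<lambda>_. i) ` fst ` ?F \<subseteq> Y 1" using i by auto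
      show "strict_mono_on (fst ` ?F) (\<lambda>_. i)" by (auto simp: strict_mono_on_def)
    qed
    then have "t ?F = tp \<mu> R Z" unfolding \<tau>_def mvF using \<theta>(2)[OF Z] by simp
    moreover have "card ?F = card Z"
    proof -
      have "card (e i ` D) = card D" using e D(1) by (meson bij_betw_def card_image inj_on_subset)
      moreover have "card (\<theta> ` Z) = card Z" using \<theta>(1) Z by (meson bij_betw_def card_image inj_on_subset)
      ultimately show ?thesis using D(2) by (simp add: card_cartesian_product)
    qed
    ultimately show "\<exists>F. finite F \<and> F \<subseteq> UNIV \<times> ?C \<and> card F = card Z \<and> t F = tp \<mu> R Z"
      using F by blast
  qed
qed

subsection \<open>The profile\<close>

text \<open>With the union of representatives of \<open>T\<close> as \<open>S\<close>, all of
  \<open>T\<close> appears among the types of one \<open>letter_system\<close>. As \<open>S\<close>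
  has to be finite, finite sets of types are treated first.\<close>

lemma card_types_le:
  fixes \<mu> :: "'i signature" and R :: "('a, 'i) relstruct"
  assumes inex: "inexhaustible \<mu> (age \<mu> R)" and wf: "age_height_defined \<mu> (age \<mu> R)"
    and height: "age_height \<mu> (age \<mu> R) \<le>o omega_times (k + 1)"
    and T: "finite T" "T \<subseteq> {tp \<mu> R A |A. A \<subseteq> base R \<and> finite A \<and> card A = n}"
  shows "card T \<le> (n + k) choose k"
proof -
  have "\<forall>q\<in>T. \<exists>A. A \<subseteq> base R \<and> finite A \<and> card A = n \<and> q = tp \<mu> R A" using T(2) by auto
  from bchoice[OF this] obtain A where A: "\<forall>q\<in>T. A q \<subseteq> base R \<and> finite (A q) \<and> card (A q) = n \<and>
      q = tp \<mu> R (A q)" ..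
  have "finite (\<Union>q\<in>T. A q)" "(\<Union>q\<in>T. A q) \<subseteq> base R" using T(1) A by auto
  with inex wf obtain m and t :: "(rat \<times> nat) set \<Rightarrow> 'i iso_type"
  where real: "\<And>F. finite F \<Longrightarrow> F \<subseteq> UNIV \<times> {..<m} \<Longrightarrow>
      \<exists>\<Phi>. inj_on \<Phi> F \<and> \<Phi> ` F \<subseteq> base R \<and> (\<forall>X\<subseteq>F. t X = tp \<mu> R (\<Phi> ` X))"
    and indisc: "\<And>F g. finite F \<Longrightarrow> F \<subseteq> UNIV \<times> {..<m} \<Longrightarrow> strict_mono_on (fst ` F) g \<Longrightarrow> t (mv g F) = t F"
    and copy: "\<And>Z. Z \<subseteq> (\<Union>q\<in>T. A q) \<Longrightarrow>
      \<exists>F. finite F \<and> F \<subseteq> UNIV \<times> {..<m} \<and> card F = card Z \<and> t F = tp \<mu> R Z"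
    by (rule indiscernible_copies) (rule that)
  let ?E = "(UNIV :: rat set) \<times> {..<m}"
  let ?ag = "\<lambda>X. {t F |F. finite F \<and> F \<subseteq> X}"
  have realE: "\<exists>\<Phi>. inj_on \<Phi> F \<and> \<Phi> ` F \<subseteq> base R \<and> (\<forall>X\<subseteq>F. t X = tp \<mu> R (\<Phi> ` X))"
    if "finite F" "F \<subseteq> X" "X \<subseteq> ?E" for F X using that by (intro real) auto
  have ideal: "is_ideal \<mu> (?ag X)" and sub: "?ag X \<subseteq> age \<mu> R" if X: "X \<subseteq> ?E" for X
  proof -
    show sub: "?ag X \<subseteq> age \<mu> R"
    proof
      fix q assume "q \<in> ?ag X"
      then obtain F where F: "finite F" "F \<subseteq> X" "q = t F" by blast
      obtain \<Phi> where \<Phi>: "\<Phi> ` F \<subseteq> base R" "\<forall>X\<subseteq>F. t X = tp \<mu> R (\<Phi> ` X)" using realE[OF F(1,2) X] by blast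
      then show "q \<in> age \<mu> R" unfolding age_tp using F by auto
    qed
    show "is_ideal \<mu> (?ag X)"
      unfolding is_ideal_def
    proof (intro conjI ballI impI)
      have "age \<mu> R \<subseteq> Omega \<mu>" unfolding age_tp by (intro image_subsetI) (simp add: tp_Omega)
      then show "?ag X \<subseteq> Omega \<mu>" by (rule order_trans[OF sub])
      have "t {} \<in> ?ag X" by blast
      then show "?ag X \<noteq> {}" by blast
    next
      fix q s assume q: "q \<in> ?ag X" and s: "s \<in> Omega \<mu>" "type_le \<mu> s q"
      from q obtain F where F: "finite F" "F \<subseteq> X" "q = t F" by blast
      obtain \<Phi> where \<Phi>: "\<forall>X\<subseteq>F. t X = tp \<mu> R (\<Phi> ` X)" using realE[OF F(1,2) X] by blast
      have "type_le \<mu> s (tp \<mu> R (\<Phi> ` F))" using s(2) \<Phi> F(3) by simp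
      with s(1) obtain Z where Z: "Z \<subseteq> \<Phi> ` F" "s = tp \<mu> R Z" by (rule type_le_tp)
      then obtain G where G: "G \<subseteq> F" "Z = \<Phi> ` G" using subset_imageE by metis
      have "s = t G" using Z(2) G \<Phi> by simp
      moreover have "finite G" "G \<subseteq> X" using G(1) F(1,2) finite_subset by auto
      ultimately show "s \<in> ?ag X" by blast
    next
      fix p q assume "p \<in> ?ag X" "q \<in> ?ag X"
      then obtain F G where F: "finite F" "F \<subseteq> X" "p = t F" and G: "finite G" "G \<subseteq> X" "q = t G" by blast
      have FG: "finite (F \<union> G)" "F \<union> G \<subseteq> X" using F G by auto
      obtain \<Phi> where \<Phi>: "\<forall>X\<subseteq>F \<union> G. t X = tp \<mu> R (\<Phi> ` X)" using realE[OF FG X] by blast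
      have le: "type_le \<mu> (t H) (t (F \<union> G))" if "H \<subseteq> F \<union> G" for H
      proof -
        have "type_le \<mu> (tp \<mu> R (\<Phi> ` H)) (tp \<mu> R (\<Phi> ` (F \<union> G)))"
          by (rule tp_mono) (use FG that in auto)
        then show ?thesis using \<Phi> that by simp
      qed
      have "t (F \<union> G) \<in> ?ag X" using FG by blast
      moreover have "type_le \<mu> p (t (F \<union> G))" "type_le \<mu> q (t (F \<union> G))" using le F(3) G(3) by simp_all
      ultimately show "\<exists>u\<in>?ag X. type_le \<mu> p u \<and> type_le \<mu> q u" by (intro bexI conjI)
    qed
  qed
  have "is_ideal \<mu> (age \<mu> R)" unfolding age_tp by (rule is_ideal_age_tp)
  with wf height obtain R1 R2 :: "'i iso_type set \<Rightarrow> nat"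
  where R: "\<And>I J. is_ideal \<mu> I \<Longrightarrow> is_ideal \<mu> J \<Longrightarrow> I \<subset> J \<Longrightarrow> J \<subseteq> age \<mu> R \<Longrightarrow>
      R1 I < R1 J \<or> R1 I = R1 J \<and> R2 I < R2 J"
    "\<And>I. is_ideal \<mu> I \<Longrightarrow> I \<subseteq> age \<mu> R \<Longrightarrow> R1 I \<le> Suc k"
    by (rule ideal_rank) (rule that)
  interpret letter_system m t R1 R2 "Suc k"
  proof unfold_locales
    fix F G assume FG: "finite F" "finite G" "F \<subseteq> ?E" "G \<subseteq> ?E" "t F = t G"
    obtain \<Phi> where \<Phi>: "inj_on \<Phi> F" "\<forall>X\<subseteq>F. t X = tp \<mu> R (\<Phi> ` X)" using real[OF FG(1,3)] by blast
    obtain \<Psi> where \<Psi>: "inj_on \<Psi> G" "\<forall>X\<subseteq>G. t X = tp \<mu> R (\<Psi> ` X)" using real[OF FG(2,4)] by blast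
    have "tp \<mu> R (\<Phi> ` F) = tp \<mu> R (\<Psi> ` G)" using \<Phi>(2) \<Psi>(2) FG(5) by simp
    with finite_imageI[OF FG(1)] obtain \<theta> where \<theta>: "bij_betw \<theta> (\<Phi> ` F) (\<Psi> ` G)"
      "\<And>Z. Z \<subseteq> \<Phi> ` F \<Longrightarrow> tp \<mu> R (\<theta> ` Z) = tp \<mu> R Z" by (rule tp_eq_iso) (rule that)
    let ?\<theta> = "inv_into G \<Psi> \<circ> (\<theta> \<circ> \<Phi>)"
    have b: "bij_betw (\<theta> \<circ> \<Phi>) F (\<Psi> ` G)"
      by (rule bij_betw_trans[OF _ \<theta>(1)]) (simp add: inj_on_imp_bij_betw[OF \<Phi>(1)])
    have "bij_betw ?\<theta> F G"
      by (rule bij_betw_trans[OF b bij_betw_inv_into[OF inj_on_imp_bij_betw[OF \<Psi>(1)]]])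
    moreover have "t (?\<theta> ` X) = t X" if X: "X \<subseteq> F" for X
    proof -
      have "?\<theta> ` X \<subseteq> G" using \<open>bij_betw ?\<theta> F G\<close> X by (auto simp: bij_betw_def)
      moreover have "\<Psi> ` ?\<theta> ` X = \<theta> ` \<Phi> ` X"
      proof -
        have "(\<theta> \<circ> \<Phi>) ` X \<subseteq> \<Psi> ` G" using b X by (auto simp: bij_betw_def)
        then have "\<Psi> ` inv_into G \<Psi> ` ((\<theta> \<circ> \<Phi>) ` X) = (\<theta> \<circ> \<Phi>) ` X" by (rule image_inv_into_cancel[OF refl])
        then show ?thesis by (simp only: image_comp)
      qed
      ultimately have "t (?\<theta> ` X) = tp \<mu> R (\<theta> ` \<Phi> ` X)" using \<Psi>(2) by simp
      also have "\<dots> = tp \<mu> R (\<Phi> ` X)" by (rule \<theta>(2)) (use X in auto)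
      also have "\<dots> = t X" using \<Phi>(2) X by simp
      finally show ?thesis .
    qed
    ultimately show "\<exists>\<theta>. bij_betw \<theta> F G \<and> (\<forall>X\<subseteq>F. t (\<theta> ` X) = t X)"
      by (intro exI[of _ ?\<theta>] conjI allI impI)
  next
    fix X Y assume "X \<subseteq> ?E" "Y \<subseteq> ?E" "?ag X \<subset> ?ag Y"
    then show "R1 (?ag X) < R1 (?ag Y) \<or> R1 (?ag X) = R1 (?ag Y) \<and> R2 (?ag X) < R2 (?ag Y)"
      by (intro R(1) ideal sub)
  qed (simp, rule indisc, assumption+, intro R(2) ideal sub, assumption+)
  have "T \<subseteq> {t F |F. finite F \<and> F \<subseteq> ?E \<and> card F = n}"
  proof
    fix q assume q: "q \<in> T"
    then have "A q \<subseteq> (\<Union>q\<in>T. A q)" by blast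
    from copy[OF this] obtain F where "finite F" "F \<subseteq> ?E" "card F = card (A q)" "t F = tp \<mu> R (A q)" by blast
    then show "q \<in> {t F |F. finite F \<and> F \<subseteq> ?E \<and> card F = n}" using bspec[OF A q] by auto
  qed
  then show ?thesis by (rule types_bound) simp
qed

theorem mainTheorem1:
  fixes \<mu> :: "'i signature" and R :: "('a, 'i) relstruct" and k :: nat
  assumes "valid_signature \<mu>"
    and "is_structure \<mu> R"
    and "countable (base R)" and "infinite (base R)"
    and "inexhaustible \<mu> (age \<mu> R)"
    and "age_height_defined \<mu> (age \<mu> R)"
    and "age_height \<mu> (age \<mu> R) \<le>o omega_times (k + 1)"
  shows "\<forall>n::nat. profile \<mu> R n \<le> enat ((n + k) choose k)"
proof
  fix n :: nat
  let ?T = "{type_of \<mu> (restriction \<mu> R A) |A. A \<subseteq> base R \<and> finite A \<and> card A = n}"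
  let ?b = "(n + k) choose k"
  have le: "card T \<le> ?b" if "finite T" "T \<subseteq> ?T" for T
    using card_types_le[OF assms(5-7) that(1)] that(2) by (simp add: tp_def)
  \<comment> \<open>Infinitely many types of one size are conceivable over an infinite signature;
    the uniform bound on finite subsets excludes them.\<close>
  have "finite ?T"
  proof (rule ccontr)
    assume "infinite ?T"
    from infinite_arbitrarily_large[OF this, of "Suc ?b"]
    obtain T where T: "finite T" "card T = Suc ?b" "T \<subseteq> ?T" by blast
    then show False using le[OF T(1,3)] by simp
  qed
  then show "profile \<mu> R n \<le> enat ?b"
    using le[OF _ subset_refl] by (simp add: profile_def)
qed

end
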